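(* Let $M$ be an oriented smooth $n$-manifold, $\sigma\colon M\times(-\varepsilon,\varepsilon)\to\mathbb H^{n+1}$ a smooth map such that $\sigma_t=\sigma(\cdot,t)$ is an immersion with small principal curvatures for all $t$, with unit normal field $\nu_t$. Let $f\colon M\times(-\varepsilon,\varepsilon)\to\mathbb R$ be a smooth function, $f_t=f(\cdot,t)$, such that $$\frac{d}{dt}\sigma_t=f_t\nu_t,$$ and let $\zeta_t=\zeta_{\sigma_t}\colon M\to T^1\mathbb H^{n+1}$ be the lift and $G_t=G_{\sigma_t}\colon M\to\mathcal G(\mathbb H^{n+1})$ the Gauss map of $\sigma_t$. Then $$\frac{d}{dt}\zeta_t=-d\zeta_t\big(B_t(\overline\nabla^tf_t)\big)-J\big(d\zeta_t(\overline\nabla^tf_t)\big)+f_t\,\chi,$$ $$\frac{d}{dt}G_t=-dG_t\big(B_t(\overline\nabla^tf_t)\big)-\mathbb J\big(dG_t(\overline\nabla^tf_t)\big),$$ where $\overline\nabla^tf_t$ is the gradient of $f_t$ with respect to the first fundamental form $\overline{\mathrm I}_t=G_t^*\mathbb G$ and $B_t$ is the shape operator of $\sigma_t$.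
   Context: Hyperboloid model: $\mathbb R^{n+1,1}$ is $\mathbb R^{n+2}$ with $\langle x,y\rangle=\sum_{i=1}^{n+1}x_iy_i-x_{n+2}y_{n+2}$, and $\mathbb H^{n+1}=\{x:\langle x,x\rangle=-1,\ x_{n+2}>0\}$ with the induced metric and a fixed orientation; $T^1\mathbb H^{n+1}=\{(x,v):x\in\mathbb H^{n+1},\langle x,v\rangle=0,\langle v,v\rangle=1\}\subset\mathbb R^{n+1,1}\times\mathbb R^{n+1,1}$. $\mathcal G(\mathbb H^{n+1})$ is the $2n$-manifold of maximal oriented unparametrized geodesics of $\mathbb H^{n+1}$, and $\mathrm p\colon T^1\mathbb H^{n+1}\to\mathcal G(\mathbb H^{n+1})$ sends $(x,v)$ to the oriented geodesic through $x$ with velocity $v$. It is a principal $\mathbb R$-bundle for the geodesic flow $\varphi_t(x,v)=(\cosh(t)x+\sinh(t)v,\sinh(t)x+\cosh(t)v)$, whose infinitesimal generator is $\chi_{(x,v)}=(v,x)$. For $w\in T_x\mathbb H^{n+1}$ with $w\perp v$ put $w^{\mathcal H}=(w,0)$, $w^{\mathcal V}=(0,w)$. Then $T_{(x,v)}T^1\mathbb H^{n+1}=\mathrm{Span}(\chi)\oplus\{w^{\mathcal H}\}\oplus\{w^{\mathcal V}\}$. The para-Sasaki metric $g$ makes these three summands mutually orthogonal, with $g(\chi,\chi)=1$, $g(w_1^{\mathcal H},w_2^{\mathcal H})=\langle w_1,w_2\rangle$, $g(w_1^{\mathcal V},w_2^{\mathcal V})=-\langle w_1,w_2\rangle$. On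 $\chi^\perp$ let $J(w^{\mathcal H})=w^{\mathcal V}$, $J(w^{\mathcal V})=w^{\mathcal H}$. Since $g$ and $J$ are invariant under $\varphi_t$ and $d\mathrm p\colon\chi^\perp_{(x,v)}\to T_{\mathrm p(x,v)}\mathcal G(\mathbb H^{n+1})$ is an isomorphism, $g|_{\chi^\perp}$ and $J$ descend to a pseudo-Riemannian metric $\mathbb G$ of signature $(n,n)$ and a tensor $\mathbb J$ with $\mathbb J^2=\mathrm{id}$. For an immersion $\sigma$ of an oriented $n$-manifold $M$ into $\mathbb H^{n+1}$ with unit normal $\nu$ compatible with the orientations (for a fixed convention), the lift is $\zeta_\sigma(p)=(\sigma(p),\nu(p))$ (its differential takes values in $\chi^\perp$) and the Gauss map is $G_\sigma=\mathrm p\circ\zeta_\sigma$. The shape operator is defined by $d\sigma(B(W))=-D_W\nu$; $\sigma$ has small principal curvatures if all eigenvalues of $B$ lie in $(-1,1)$ at every point, in which case $G_\sigma^*\mathbb G$ is a Riemannian metric. *)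

theory Defs
  imports "HOL-Analysis.Analysis"
begin

section \<open>Smooth maps and abstract manifolds\<close>

text \<open>The predicates \<open>Ck_on\<close> and \<open>smooth_on\<close> are meant for open sets \<open>S\<close>
  of a finite-dimensional space.\<close>

primrec Ck_on ::
  "nat \<Rightarrow> 'a::real_normed_vector set \<Rightarrow> ('a \<Rightarrow> 'b::real_normed_vector) \<Rightarrow> bool" where
  "Ck_on 0 S f \<longleftrightarrow> continuous_on S f"
| "Ck_on (Suc k) S f \<longleftrightarrow>
     (\<forall>x\<in>S. f differentiable (at x)) \<and> (\<forall>v. Ck_on k S (\<lambda>x. frechet_derivative f (at x) v))"

definition smooth_on ::
  "'a::real_normed_vector set \<Rightarrow> ('a \<Rightarrow> 'b::real_normed_vector) \<Rightarrow> bool" where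
  "smooth_on S f \<longleftrightarrow> (\<forall>k. Ck_on k S f)"

text \<open>Smoothness on an arbitrary subset (in practice: an open subset of an embedded
  submanifold), by local smooth extension.\<close>

definition smooth_on_subset ::
  "'a::real_normed_vector set \<Rightarrow> ('a \<Rightarrow> 'b::real_normed_vector) \<Rightarrow> bool" where
  "smooth_on_subset S f \<longleftrightarrow>
     (\<forall>a\<in>S. \<exists>W F. open W \<and> a \<in> W \<and> smooth_on W F \<and> (\<forall>b\<in>S \<inter> W. F b = f b))"

type_synonym ('m, 'e) atlas = "('m set \<times> ('m \<Rightarrow> 'e)) set"

definition smooth_manifold :: "'m topology \<Rightarrow> ('m, 'e::euclidean_space) atlas \<Rightarrow> bool" where
  "smooth_manifold X A \<longleftrightarrow>
     Hausdorff_space X \<and> second_countable X \<and> (\<Union>(U, \<phi>)\<in>A. U) = topspace X \<and>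
     (\<forall>(U, \<phi>)\<in>A. openin X U \<and> open (\<phi> ` U) \<and>
        homeomorphic_map (subtopology X U) (top_of_set (\<phi> ` U)) \<phi>) \<and>
     (\<forall>(U, \<phi>)\<in>A. \<forall>(V, \<psi>)\<in>A. smooth_on (\<phi> ` (U \<inter> V)) (\<psi> \<circ> inv_into U \<phi>))"

definition oriented_manifold :: "'m topology \<Rightarrow> ('m, real ^ 'n) atlas \<Rightarrow> bool" where
  "oriented_manifold X A \<longleftrightarrow>
     smooth_manifold X A \<and>
     (\<forall>(U, \<phi>)\<in>A. \<forall>(V, \<psi>)\<in>A. \<forall>y\<in>\<phi> ` (U \<inter> V).
        det (matrix (frechet_derivative (\<psi> \<circ> inv_into U \<phi>) (at y))) > 0)"

definition product_atlas ::
  "('m, 'e::euclidean_space) atlas \<Rightarrow> real set \<Rightarrow> ('m \<times> real, 'e \<times> real) atlas" where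
  "product_atlas A I = (\<lambda>(U, \<phi>). (U \<times> I, \<lambda>(p, t). (\<phi> p, t))) ` A"

definition smooth_map ::
  "('m, 'e::euclidean_space) atlas \<Rightarrow> ('m \<Rightarrow> 'b::real_normed_vector) \<Rightarrow> bool" where
  "smooth_map A F \<longleftrightarrow> (\<forall>(U, \<phi>)\<in>A. smooth_on (\<phi> ` U) (F \<circ> inv_into U \<phi>))"

definition smooth_at :: "('m, 'e::euclidean_space) atlas \<Rightarrow> 'm \<Rightarrow> ('m \<Rightarrow> real) set" where
  "smooth_at A p = {h. \<exists>(U, \<phi>)\<in>A. p \<in> U \<and>
     (\<exists>W. open W \<and> \<phi> p \<in> W \<and> W \<subseteq> \<phi> ` U \<and> smooth_on W (h \<circ> inv_into U \<phi>))}"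

section \<open>Tangent vectors as derivations\<close>

text \<open>Below, \<open>C\<close> assigns to every point the set of functions that are smooth in some
  neighbourhood of it. Such functions have arbitrary values outside that neighbourhood.
  A derivation nevertheless depends only on the germ: if \<open>h\<close> and \<open>k\<close> agree on a
  neighbourhood with indicator function \<open>c\<close>, then \<open>(h - k) * c = 0\<close> and the Leibniz
  rule gives \<open>X h = X k\<close>. Derivations are set to 0 outside \<open>C p\<close>, so that equality of
  tangent vectors is equality of functions.\<close>

definition tangent_space ::
  "('a \<Rightarrow> ('a \<Rightarrow> real) set) \<Rightarrow> 'a \<Rightarrow> (('a \<Rightarrow> real) \<Rightarrow> real) set" where
  "tangent_space C p = {X.
     (\<forall>h. h \<notin> C p \<longrightarrow> X h = 0) \<and>
     (\<forall>h\<in>C p. \<forall>k\<in>C p. X (\<lambda>q. h q + k q) = X h + X k) \<and>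
     (\<forall>h\<in>C p. \<forall>c. X (\<lambda>q. c * h q) = c * X h) \<and>
     (\<forall>h\<in>C p. \<forall>k\<in>C p. X (\<lambda>q. h q * k q) = X h * k p + h p * X k)}"

definition pushforward ::
  "('b \<Rightarrow> ('b \<Rightarrow> real) set) \<Rightarrow> ('a \<Rightarrow> 'b) \<Rightarrow> 'a \<Rightarrow> (('a \<Rightarrow> real) \<Rightarrow> real) \<Rightarrow> (('b \<Rightarrow> real) \<Rightarrow> real)"
  where
  "pushforward D F p X = (\<lambda>h. if h \<in> D (F p) then X (h \<circ> F) else 0)"

text \<open>The differential of a map into a Euclidean space or into a submanifold of it, whose
  tangent vectors are identified with vectors of the ambient space.\<close>

definition differential ::
  "('a \<Rightarrow> 'b::euclidean_space) \<Rightarrow> (('a \<Rightarrow> real) \<Rightarrow> real) \<Rightarrow> 'b" where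
  "differential F X = (\<Sum>b\<in>Basis. X (\<lambda>p. F p \<bullet> b) *\<^sub>R b)"

definition has_velocity ::
  "('a \<Rightarrow> ('a \<Rightarrow> real) set) \<Rightarrow> (real \<Rightarrow> 'a) \<Rightarrow> (('a \<Rightarrow> real) \<Rightarrow> real) \<Rightarrow> real \<Rightarrow> bool" where
  "has_velocity C \<gamma> X t \<longleftrightarrow> X \<in> tangent_space C (\<gamma> t) \<and>
     (\<forall>h\<in>C (\<gamma> t). ((\<lambda>s. h (\<gamma> s)) has_real_derivative X h) (at t))"

section \<open>The hyperboloid model and its unit tangent bundle\<close>

text \<open>With \<open>n = CARD('n)\<close>, the index \<open>Some (Some i)\<close> stands for the coordinates
  \<open>1, \<dots>, n\<close>, \<open>Some None\<close> for the coordinate \<open>n + 1\<close> and \<open>None\<close> for the time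
  coordinate \<open>n + 2\<close>.\<close>

type_synonym 'n minkowski = "real ^ ('n option option)"

definition mink :: "'n::finite minkowski \<Rightarrow> 'n minkowski \<Rightarrow> real" where
  "mink x y = (\<Sum>i\<in>UNIV. x $ Some i * y $ Some i) - x $ None * y $ None"

definition hyperbolic_space :: "'n::finite minkowski set" where
  "hyperbolic_space = {x. mink x x = -1 \<and> x $ None > 0}"

definition unit_tangent :: "('n::finite minkowski \<times> 'n minkowski) set" where
  "unit_tangent = {(x, v). x \<in> hyperbolic_space \<and> mink x v = 0 \<and> mink v v = 1}"

definition flow ::
  "real \<Rightarrow> 'n::finite minkowski \<times> 'n minkowski \<Rightarrow> 'n minkowski \<times> 'n minkowski" where
  "flow t = (\<lambda>(x, v). (cosh t *\<^sub>R x + sinh t *\<^sub>R v, sinh t *\<^sub>R x + cosh t *\<^sub>R v))"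

definition chi :: "'n::finite minkowski \<times> 'n minkowski \<Rightarrow> 'n minkowski \<times> 'n minkowski" where
  "chi = (\<lambda>(x, v). (v, x))"

definition orth_space :: "'n::finite minkowski \<times> 'n minkowski \<Rightarrow> 'n minkowski set" where
  "orth_space = (\<lambda>(x, v). {w. mink x w = 0 \<and> mink v w = 0})"

definition hor_lift :: "'n::finite minkowski \<Rightarrow> 'n minkowski \<times> 'n minkowski" where
  "hor_lift w = (w, 0)"

definition ver_lift :: "'n::finite minkowski \<Rightarrow> 'n minkowski \<times> 'n minkowski" where
  "ver_lift w = (0, w)"

definition unit_tangent_tangent ::
  "'n::finite minkowski \<times> 'n minkowski \<Rightarrow> ('n minkowski \<times> 'n minkowski) set" where
  "unit_tangent_tangent a =
     {c *\<^sub>R chi a + hor_lift w + ver_lift u | c w u. w \<in> orth_space a \<and> u \<in> orth_space a}"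

definition components ::
  "'n::finite minkowski \<times> 'n minkowski \<Rightarrow> 'n minkowski \<times> 'n minkowski
     \<Rightarrow> real \<times> 'n minkowski \<times> 'n minkowski" where
  "components a \<xi> = (THE (c, w, u). w \<in> orth_space a \<and> u \<in> orth_space a \<and>
     \<xi> = c *\<^sub>R chi a + hor_lift w + ver_lift u)"

definition para_sasaki ::
  "'n::finite minkowski \<times> 'n minkowski \<Rightarrow> 'n minkowski \<times> 'n minkowski
     \<Rightarrow> 'n minkowski \<times> 'n minkowski \<Rightarrow> real" where
  "para_sasaki a \<xi> \<eta> =
     (let (c, w, u) = components a \<xi>; (c', w', u') = components a \<eta>
      in c * c' + mink w w' - mink u u')"

definition chi_perp ::
  "'n::finite minkowski \<times> 'n minkowski \<Rightarrow> ('n minkowski \<times> 'n minkowski) set" where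
  "chi_perp a = {\<xi> \<in> unit_tangent_tangent a. para_sasaki a \<xi> (chi a) = 0}"

text \<open>Only meaningful on \<open>chi_perp a\<close>.\<close>

definition para_J ::
  "'n::finite minkowski \<times> 'n minkowski \<Rightarrow> 'n minkowski \<times> 'n minkowski
     \<Rightarrow> 'n minkowski \<times> 'n minkowski" where
  "para_J a \<xi> = (let (c, w, u) = components a \<xi> in ver_lift w + hor_lift u)"

lemma components_eq:
  assumes "a \<in> unit_tangent" "w \<in> orth_space a" "u \<in> orth_space a"
  shows "components a (c *\<^sub>R chi a + hor_lift w + ver_lift u) = (c, w, u)"
proof -
  obtain x v where a: "a = (x, v)" by (cases a)
  have v: "mink v v = 1" using assms(1) by (simp add: a unit_tangent_def)
  have lin: "mink v (r *\<^sub>R v + w') = r * mink v v + mink v w'" for r w'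
    by (simp add: mink_def sum.distrib sum_distrib_left algebra_simps)
  have "c' = c \<and> w' = w \<and> u' = u"
    if "w' \<in> orth_space a"
      and eq: "c *\<^sub>R chi a + hor_lift w + ver_lift u = c' *\<^sub>R chi a + hor_lift w' + ver_lift u'"
    for c' w' u'
  proof -
    from eq have 1: "c *\<^sub>R v + w = c' *\<^sub>R v + w'" and 2: "c *\<^sub>R x + u = c' *\<^sub>R x + u'"
      by (auto simp: a chi_def hor_lift_def ver_lift_def)
    have "mink v (c *\<^sub>R v + w) = c" "mink v (c' *\<^sub>R v + w') = c'"
      using assms(2) that(1) by (simp_all add: lin v a orth_space_def)
    with 1 have "c' = c" by simp
    with 1 2 show ?thesis by simp
  qed
  then show ?thesis
    unfolding components_def using assms(2,3)
    by (intro the_equality) (fastforce split: prod.splits)+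
qed

section \<open>The space of oriented geodesics\<close>

text \<open>A maximal oriented unparametrized geodesic is encoded as the set of its unit velocity
  vectors, which is an orbit of the geodesic flow.\<close>

type_synonym 'n geodesic = "('n minkowski \<times> 'n minkowski) set"

definition geod :: "'n::finite minkowski \<times> 'n minkowski \<Rightarrow> 'n geodesic" where
  "geod a = range (\<lambda>t. flow t a)"

definition geodesics :: "'n::finite geodesic set" where
  "geodesics = geod ` unit_tangent"

text \<open>The quotient topology and smooth structure: since \<open>geod\<close> is a principal bundle
  projection, a function of geodesics is smooth iff its pullback to the unit tangent bundle is.\<close>

definition geod_smooth_at :: "'n::finite geodesic \<Rightarrow> ('n geodesic \<Rightarrow> real) set" where
  "geod_smooth_at q = {h. \<exists>V\<subseteq>geodesics. q \<in> V \<and>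
     openin (top_of_set unit_tangent) {a \<in> unit_tangent. geod a \<in> V} \<and>
     smooth_on_subset {a \<in> unit_tangent. geod a \<in> V} (h \<circ> geod)}"

text \<open>The differential of \<open>geod\<close> at \<open>a\<close>. The derivative within \<open>unit_tangent\<close> is not
  unique as a linear map on the ambient space, but its value on a tangent vector \<open>\<xi>\<close> is.\<close>

definition dgeod ::
  "'n::finite minkowski \<times> 'n minkowski \<Rightarrow> 'n minkowski \<times> 'n minkowski
     \<Rightarrow> (('n geodesic \<Rightarrow> real) \<Rightarrow> real)" where
  "dgeod a \<xi> = (\<lambda>h. if h \<in> geod_smooth_at (geod a)
     then (THE d. \<exists>D. ((h \<circ> geod) has_derivative D) (at a within unit_tangent) \<and> d = D \<xi>)
     else 0)"

definition geod_metric ::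
  "'n::finite geodesic \<Rightarrow> (('n geodesic \<Rightarrow> real) \<Rightarrow> real) \<Rightarrow> (('n geodesic \<Rightarrow> real) \<Rightarrow> real) \<Rightarrow> real"
  where
  "geod_metric q X Y = (THE r. \<exists>a\<in>unit_tangent. geod a = q \<and>
     (\<exists>\<xi>\<in>chi_perp a. \<exists>\<eta>\<in>chi_perp a. dgeod a \<xi> = X \<and> dgeod a \<eta> = Y \<and> r = para_sasaki a \<xi> \<eta>))"

definition geod_J ::
  "'n::finite geodesic \<Rightarrow> (('n geodesic \<Rightarrow> real) \<Rightarrow> real) \<Rightarrow> (('n geodesic \<Rightarrow> real) \<Rightarrow> real)" where
  "geod_J q X = (THE Y. \<exists>a\<in>unit_tangent. geod a = q \<and>
     (\<exists>\<xi>\<in>chi_perp a. dgeod a \<xi> = X \<and> Y = dgeod a (para_J a \<xi>)))"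

section \<open>Immersed hypersurfaces\<close>

definition immersion ::
  "'m topology \<Rightarrow> ('m, real ^ 'n) atlas \<Rightarrow> ('m \<Rightarrow> 'n::finite minkowski) \<Rightarrow> bool" where
  "immersion X A \<sigma> \<longleftrightarrow> smooth_map A \<sigma> \<and> \<sigma> ` topspace X \<subseteq> hyperbolic_space \<and>
     (\<forall>p\<in>topspace X. inj_on (differential \<sigma>) (tangent_space (smooth_at A) p))"

text \<open>For a chart \<open>\<phi>\<close> at \<open>p\<close>, the matrix with columns \<open>\<partial>\<^sub>1\<sigma>, \<dots>, \<partial>\<^sub>n\<sigma>, \<nu>, \<sigma>\<close>. Rows and columns
  have the same index type, so the sign of the determinant needs no ordering of \<open>'n\<close>.\<close>

definition adapted_frame ::
  "'m set \<times> ('m \<Rightarrow> real ^ 'n) \<Rightarrow> ('m \<Rightarrow> 'n::finite minkowski) \<Rightarrow> ('m \<Rightarrow> 'n minkowski) \<Rightarrow> 'm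
     \<Rightarrow> real ^ ('n option option) ^ ('n option option)" where
  "adapted_frame = (\<lambda>(U, \<phi>) \<sigma> \<nu> p. (\<chi> r c. (case c of
       None \<Rightarrow> \<sigma> p
     | Some None \<Rightarrow> \<nu> p
     | Some (Some i) \<Rightarrow> frechet_derivative (\<sigma> \<circ> inv_into U \<phi>) (at (\<phi> p)) (axis i 1)) $ r))"

text \<open>The sign \<open>\<delta>\<close> encodes both the orientation of hyperbolic space and the convention for
  compatibility of a unit normal with the orientations: a basis \<open>w\<^sub>1, \<dots>, w\<^sub>n, \<nu>\<close> of
  \<open>T\<^sub>x\<H>\<close> with \<open>w\<^sub>1, \<dots>, w\<^sub>n\<close> positive in \<open>M\<close> is admissible iff
  \<open>\<delta> det (w\<^sub>1, \<dots>, w\<^sub>n, \<nu>, x) > 0\<close>.\<close>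

definition unit_normal_field ::
  "'m topology \<Rightarrow> ('m, real ^ 'n) atlas \<Rightarrow> real \<Rightarrow> ('m \<Rightarrow> 'n::finite minkowski)
     \<Rightarrow> ('m \<Rightarrow> 'n minkowski) \<Rightarrow> bool" where
  "unit_normal_field X A \<delta> \<sigma> \<nu> \<longleftrightarrow> smooth_map A \<nu> \<and>
     (\<forall>p\<in>topspace X. mink (\<sigma> p) (\<nu> p) = 0 \<and> mink (\<nu> p) (\<nu> p) = 1 \<and>
        (\<forall>W\<in>tangent_space (smooth_at A) p. mink (differential \<sigma> W) (\<nu> p) = 0) \<and>
        (\<forall>(U, \<phi>)\<in>A. p \<in> U \<longrightarrow> \<delta> * det (adapted_frame (U, \<phi>) \<sigma> \<nu> p) > 0))"

text \<open>The Levi-Civita derivative \<open>D\<^sub>W\<nu>\<close> of hyperbolic space along \<open>\<sigma>\<close>: the orthogonal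
  projection of the flat derivative to \<open>T\<^bsub>\<sigma>(p)\<^esub>\<H>\<close>, where \<open>\<langle>\<sigma>(p), \<sigma>(p)\<rangle> = -1\<close>.\<close>

definition cov_deriv ::
  "('m \<Rightarrow> 'n::finite minkowski) \<Rightarrow> ('m \<Rightarrow> 'n minkowski) \<Rightarrow> 'm \<Rightarrow> (('m \<Rightarrow> real) \<Rightarrow> real)
     \<Rightarrow> 'n minkowski" where
  "cov_deriv \<sigma> \<nu> p W = differential \<nu> W + mink (differential \<nu> W) (\<sigma> p) *\<^sub>R \<sigma> p"

definition shape_operator ::
  "('m, real ^ 'n) atlas \<Rightarrow> ('m \<Rightarrow> 'n::finite minkowski) \<Rightarrow> ('m \<Rightarrow> 'n minkowski) \<Rightarrow> 'm
     \<Rightarrow> (('m \<Rightarrow> real) \<Rightarrow> real) \<Rightarrow> (('m \<Rightarrow> real) \<Rightarrow> real)" where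
  "shape_operator A \<sigma> \<nu> p W =
     (THE V. V \<in> tangent_space (smooth_at A) p \<and> differential \<sigma> V = - cov_deriv \<sigma> \<nu> p W)"

definition small_principal_curvatures ::
  "'m topology \<Rightarrow> ('m, real ^ 'n) atlas \<Rightarrow> ('m \<Rightarrow> 'n::finite minkowski)
     \<Rightarrow> ('m \<Rightarrow> 'n minkowski) \<Rightarrow> bool" where
  "small_principal_curvatures X A \<sigma> \<nu> \<longleftrightarrow>
     (\<forall>p\<in>topspace X. \<forall>k. \<forall>W\<in>tangent_space (smooth_at A) p.
        W \<noteq> (\<lambda>h. 0) \<and> shape_operator A \<sigma> \<nu> p W = (\<lambda>h. k * W h) \<longrightarrow> -1 < k \<and> k < 1)"

definition lift ::
  "('m \<Rightarrow> 'n::finite minkowski) \<Rightarrow> ('m \<Rightarrow> 'n minkowski) \<Rightarrow> 'm \<Rightarrow> 'n minkowski \<times> 'n minkowski" where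
  "lift \<sigma> \<nu> p = (\<sigma> p, \<nu> p)"

definition gauss_map ::
  "('m \<Rightarrow> 'n::finite minkowski) \<Rightarrow> ('m \<Rightarrow> 'n minkowski) \<Rightarrow> 'm \<Rightarrow> 'n geodesic" where
  "gauss_map \<sigma> \<nu> = geod \<circ> lift \<sigma> \<nu>"

definition dgauss ::
  "('m \<Rightarrow> 'n::finite minkowski) \<Rightarrow> ('m \<Rightarrow> 'n minkowski) \<Rightarrow> 'm \<Rightarrow> (('m \<Rightarrow> real) \<Rightarrow> real)
     \<Rightarrow> (('n geodesic \<Rightarrow> real) \<Rightarrow> real)" where
  "dgauss \<sigma> \<nu> = pushforward geod_smooth_at (gauss_map \<sigma> \<nu>)"

definition gauss_metric ::
  "('m \<Rightarrow> 'n::finite minkowski) \<Rightarrow> ('m \<Rightarrow> 'n minkowski) \<Rightarrow> 'm \<Rightarrow> (('m \<Rightarrow> real) \<Rightarrow> real)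
     \<Rightarrow> (('m \<Rightarrow> real) \<Rightarrow> real) \<Rightarrow> real" where
  "gauss_metric \<sigma> \<nu> p V W =
     geod_metric (gauss_map \<sigma> \<nu> p) (dgauss \<sigma> \<nu> p V) (dgauss \<sigma> \<nu> p W)"

text \<open>The gradient of \<open>f\<close> with respect to \<open>gauss_metric\<close>; note \<open>df(W) = W f\<close>.\<close>

definition gauss_gradient ::
  "('m, real ^ 'n) atlas \<Rightarrow> ('m \<Rightarrow> 'n::finite minkowski) \<Rightarrow> ('m \<Rightarrow> 'n minkowski)
     \<Rightarrow> ('m \<Rightarrow> real) \<Rightarrow> 'm \<Rightarrow> (('m \<Rightarrow> real) \<Rightarrow> real)" where
  "gauss_gradient A \<sigma> \<nu> f p =
     (THE V. V \<in> tangent_space (smooth_at A) p \<and>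
        (\<forall>W\<in>tangent_space (smooth_at A) p. gauss_metric \<sigma> \<nu> p V W = W f))"

end

theory Submission
  imports Defs
begin

text \<open>
  Since \<open>d\<sigma>\<close> is injective on derivations and maps the coordinate derivations onto
  \<open>{\<sigma>, \<nu>}\<^sup>\<bottom>\<close> (the frame determinant is nonzero), every tangent vector of \<open>M\<close> is a coordinate
  derivation, and everything can be computed on \<open>\<real>\<^sup>n\<close>: \<open>d\<zeta>(W) = (d\<sigma>(W), -d\<sigma>(BW))\<close>, which gives
  \<open>\<I>(V, W) = \<langle>d\<sigma>(V), d\<sigma>(W)\<rangle> - \<langle>d\<sigma>(BV), d\<sigma>(BW)\<rangle>\<close> for the first fundamental form of the Gauss
  map. As \<open>B\<close> is self-adjoint and does not have the eigenvalues \<open>1\<close> and \<open>-1\<close>, this form is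
  nondegenerate and the gradient exists.

  Differentiating \<open>\<langle>\<nu>, \<nu>\<rangle> = 1\<close>, \<open>\<langle>\<sigma>, \<nu>\<rangle> = 0\<close> and \<open>\<langle>d\<sigma>(W), \<nu>\<rangle> = 0\<close> in \<open>t\<close>, and exchanging the mixed
  derivatives of \<open>\<sigma>\<close>, determines \<open>d\<nu>/dt\<close> and hence \<open>d\<zeta>/dt\<close>. The normal
  is not assumed to be smooth in \<open>t\<close>; it is differentiable because it is a normalized vector of cofactors of the frame, with the
  sign given by the orientation. The formula for the Gauss map follows by applying the differential
  of the projection to the space of geodesics, which is injective on \<open>\<chi>\<^sup>\<bottom>\<close> and kills \<open>\<chi>\<close>.
\<close>

section \<open>Calculus of smooth maps\<close>

text \<open>The formula for the lift is a rewriting of the classical d\<nu>/dt = -grad f + f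
  \<sigma>, with grad f taken for the induced metric <d\<sigma>, d\<sigma>>. Self-adjointness of B
  turns the first fundamental form of the Gauss map into <d\<sigma>((1 - B^2) V), d\<sigma>(W)>, so
  grad f = (1 - B^2) g, where g is the gradient of the statement. As d\<nu> = -d\<sigma> B, the
  horizontal parts of -d\<zeta>(B g) and -J(d\<zeta>(g)) are -d\<sigma>(B g) and d\<sigma>(B g) and
  cancel, while the vertical parts d\<sigma>(B^2 g) and -d\<sigma>(g) add up to -d\<sigma>(grad f).
  The term f \<chi> is (f \<nu>, f \<sigma>) and supplies the rest. The metric and the structure
  tensor on geodesics, the shape operator and the gradient are given by definite descriptions, so
  each needs existence and uniqueness of its value. On geodesics this means independence of the
  representative on the orbit, by flow invariance, and injectivity of the differential of the
  projection on \<open>chi_perp\<close>. For the latter enough smooth functions of geodesics must be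
  at hand: these are Pluecker coordinates of the plane spanned by \<open>x\<close> and
  \<open>v\<close>.\<close>

lemma Ck_on_subset: "Ck_on k S f \<Longrightarrow> T \<subseteq> S \<Longrightarrow> Ck_on k T f"
  by (induction k arbitrary: f) (auto intro: continuous_on_subset)

lemma Ck_on_cong:
  assumes "open S" "\<And>x. x \<in> S \<Longrightarrow> f x = g x" "Ck_on k S f"
  shows "Ck_on k S g"
  using assms(2,3)
proof (induction k arbitrary: f g)
  case 0
  then show ?case by (metis Ck_on.simps(1) continuous_on_cong)
next
  case (Suc k)
  have d: "(g has_derivative frechet_derivative f (at x)) (at x)" if "x \<in> S" for x
  proof -
    have "(f has_derivative frechet_derivative f (at x)) (at x)"
      using Suc.prems(2) that frechet_derivative_works by auto
    then show ?thesis
      using has_derivative_transform_within_open[OF _ assms(1) that] Suc.prems(1) by blast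
  qed
  then have "frechet_derivative g (at x) = frechet_derivative f (at x)" if "x \<in> S" for x
    using frechet_derivative_at[symmetric] that by blast
  then have "Ck_on k S (\<lambda>x. frechet_derivative g (at x) v)" for v
    using Suc.IH[of "\<lambda>x. frechet_derivative f (at x) v" "\<lambda>x. frechet_derivative g (at x) v"]
      Suc.prems(2) by simp
  with d show ?case by (auto simp: differentiable_def)
qed

text \<open>Derivatives at a point of an open set are unique, so any explicit \<open>D\<close> may
  stand in for the chosen \<open>frechet_derivative\<close>. The closure rules below rest on
  this.\<close>

lemma Ck_on_SucI:
  assumes "open S" "\<And>x. x \<in> S \<Longrightarrow> (f has_derivative D x) (at x)"
    and "\<And>v. Ck_on k S (\<lambda>x. D x v)"
  shows "Ck_on (Suc k) S f"
proof -
  have "D x = frechet_derivative f (at x)" if "x \<in> S" for x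
    using frechet_derivative_at assms(2) that by blast
  then have "Ck_on k S (\<lambda>x. frechet_derivative f (at x) v)" for v
    by (intro Ck_on_cong[OF assms(1) _ assms(3)]) simp
  then show ?thesis using assms(2) by (auto simp: differentiable_def)
qed

lemma Ck_on_Suc_imp: "Ck_on (Suc k) S f \<Longrightarrow> Ck_on k S f"
proof (induction k arbitrary: f)
  case 0
  then show ?case
    by (auto intro!: continuous_at_imp_continuous_on differentiable_imp_continuous_within)
next
  case (Suc k)
  then show ?case by (metis Ck_on.simps(2))
qed

lemma Ck_on_has_derivative:
  "Ck_on (Suc k) S f \<Longrightarrow> x \<in> S \<Longrightarrow> (f has_derivative frechet_derivative f (at x)) (at x)"
  using frechet_derivative_works by auto

lemma Ck_on_derivative: "Ck_on (Suc k) S f \<Longrightarrow> Ck_on k S (\<lambda>x. frechet_derivative f (at x) v)"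
  unfolding Ck_on.simps by blast

lemma Ck_on_const: "open S \<Longrightarrow> Ck_on k S (\<lambda>x. c)"
proof (induction k arbitrary: c)
  case (Suc k)
  then show ?case by (intro Ck_on_SucI[where D="\<lambda>_ _. 0"]) auto
qed auto

lemma Ck_on_bounded_linear:
  assumes "open S" "bounded_linear L" "Ck_on k S f"
  shows "Ck_on k S (\<lambda>x. L (f x))"
  using assms(3)
proof (induction k arbitrary: f)
  case 0
  then show ?case using assms(2) by (simp add: linear_continuous_on_compose bounded_linear.continuous_on)
next
  case (Suc k)
  show ?case
  proof (rule Ck_on_SucI[OF assms(1)])
    show "((\<lambda>x. L (f x)) has_derivative (\<lambda>v. L (frechet_derivative f (at x) v))) (at x)"
      if "x \<in> S" for x
      using bounded_linear.has_derivative[OF assms(2)] Ck_on_has_derivative Suc.prems that by blast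
    show "Ck_on k S (\<lambda>x. L (frechet_derivative f (at x) v))" for v
      by (intro Suc.IH Ck_on_derivative Suc.prems)
  qed
qed

lemma Ck_on_linear:
  assumes "open S" "bounded_linear L"
  shows "Ck_on k S L"
proof (cases k)
  case 0
  then show ?thesis using assms(2) by (simp add: linear_continuous_on)
next
  case (Suc j)
  show ?thesis unfolding Suc
    by (rule Ck_on_SucI[OF assms(1), where D="\<lambda>_. L"])
       (auto intro: bounded_linear_imp_has_derivative assms Ck_on_const)
qed

lemma Ck_on_add:
  assumes "open S" "Ck_on k S f" "Ck_on k S g"
  shows "Ck_on k S (\<lambda>x. f x + g x)"
  using assms(2,3)
proof (induction k arbitrary: f g)
  case 0
  then show ?case by (simp add: continuous_on_add)
next
  case (Suc k)
  show ?case
  proof (rule Ck_on_SucI[OF assms(1)])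
    show "((\<lambda>x. f x + g x) has_derivative
        (\<lambda>v. frechet_derivative f (at x) v + frechet_derivative g (at x) v)) (at x)" if "x \<in> S" for x
      using has_derivative_add Ck_on_has_derivative Suc.prems that by blast
    show "Ck_on k S (\<lambda>x. frechet_derivative f (at x) v + frechet_derivative g (at x) v)" for v
      by (intro Suc.IH Ck_on_derivative Suc.prems)
  qed
qed

lemma Ck_on_scaleR:
  fixes f :: "'a::real_normed_vector \<Rightarrow> real"
  assumes "open S" "Ck_on k S f" "Ck_on k S g"
  shows "Ck_on k S (\<lambda>x. f x *\<^sub>R g x)"
  using assms(2,3)
proof (induction k arbitrary: f g)
  case 0
  then show ?case by (simp add: continuous_on_scaleR)
next
  case (Suc k)
  show ?case
  proof (rule Ck_on_SucI[OF assms(1)])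
    show "((\<lambda>x. f x *\<^sub>R g x) has_derivative
        (\<lambda>v. f x *\<^sub>R frechet_derivative g (at x) v + frechet_derivative f (at x) v *\<^sub>R g x)) (at x)"
      if "x \<in> S" for x
      by (rule has_derivative_scaleR[OF Ck_on_has_derivative[OF Suc.prems(1) that]
            Ck_on_has_derivative[OF Suc.prems(2) that]])
    show "Ck_on k S (\<lambda>x. f x *\<^sub>R frechet_derivative g (at x) v
        + frechet_derivative f (at x) v *\<^sub>R g x)" for v
      by (intro Ck_on_add assms(1) Suc.IH Ck_on_derivative Suc.prems
          Ck_on_Suc_imp[OF Suc.prems(1)] Ck_on_Suc_imp[OF Suc.prems(2)])
  qed
qed

lemma Ck_on_sum:
  assumes "open S" "\<And>i. i \<in> I \<Longrightarrow> Ck_on k S (f i)"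
  shows "Ck_on k S (\<lambda>x. \<Sum>i\<in>I. f i x)"
  using assms(2)
  by (induction I rule: infinite_finite_induct) (auto intro!: Ck_on_const Ck_on_add assms(1))

text \<open>The chain rule applies the derivative of \<open>g\<close> to a direction that varies
  with \<open>x\<close>, whereas \<open>Ck_on\<close> speaks of fixed directions. Expanding that
  direction in \<open>Basis\<close> leaves a finite sum of products, to which the induction
  hypothesis and the rules for sums and products apply.\<close>

lemma Ck_on_compose:
  fixes f :: "'a::real_normed_vector \<Rightarrow> 'b::euclidean_space"
  assumes "open S" "open T" "f ` S \<subseteq> T" "Ck_on k S f" "Ck_on k T g"
  shows "Ck_on k S (\<lambda>x. g (f x))"
  using assms(4,5)
proof (induction k arbitrary: g)
  case 0
  then show ?case using assms(3) by (simp add: continuous_on_compose2)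
next
  case (Suc k)
  have lin: "linear (frechet_derivative g (at (f x)))" if "x \<in> S" for x
    using Ck_on_has_derivative[OF Suc.prems(2), of "f x"] assms(3) that has_derivative_linear by blast
  show ?case
  proof (rule Ck_on_SucI[OF assms(1)])
    fix x assume x: "x \<in> S"
    show "((\<lambda>x. g (f x)) has_derivative
        (\<lambda>v. \<Sum>b\<in>Basis. (frechet_derivative f (at x) v \<bullet> b) *\<^sub>R frechet_derivative g (at (f x)) b)) (at x)"
    proof -
      have der: "((\<lambda>x. g (f x)) has_derivative
        (\<lambda>v. frechet_derivative g (at (f x)) (frechet_derivative f (at x) v))) (at x)"
        using has_derivative_compose[OF Ck_on_has_derivative[OF Suc.prems(1) x]]
          Ck_on_has_derivative[OF Suc.prems(2), of "f x"] assms(3) x by blast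
      have eq: "frechet_derivative g (at (f x)) w =
          (\<Sum>b\<in>Basis. (w \<bullet> b) *\<^sub>R frechet_derivative g (at (f x)) b)" for w
      proof -
        have "frechet_derivative g (at (f x)) w
            = frechet_derivative g (at (f x)) (\<Sum>b\<in>Basis. (w \<bullet> b) *\<^sub>R b)"
          by (simp add: euclidean_representation)
        also have "\<dots> = (\<Sum>b\<in>Basis. (w \<bullet> b) *\<^sub>R frechet_derivative g (at (f x)) b)"
          by (simp add: linear_sum[OF lin[OF x]] linear_scale[OF lin[OF x]])
        finally show ?thesis .
      qed
      have eq2: "(\<lambda>v. frechet_derivative g (at (f x)) (frechet_derivative f (at x) v)) =
          (\<lambda>v. \<Sum>b\<in>Basis. (frechet_derivative f (at x) v \<bullet> b) *\<^sub>R frechet_derivative g (at (f x)) b)"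
        by (rule ext) (rule eq)
      from der show ?thesis unfolding eq2 .
    qed
  next
    fix v
    show "Ck_on k S (\<lambda>x. \<Sum>b\<in>Basis.
        (frechet_derivative f (at x) v \<bullet> b) *\<^sub>R frechet_derivative g (at (f x)) b)"
    proof (intro Ck_on_sum Ck_on_scaleR assms(1))
      fix b :: 'b assume "b \<in> Basis"
      show "Ck_on k S (\<lambda>x. frechet_derivative f (at x) v \<bullet> b)"
        by (intro Ck_on_bounded_linear[OF assms(1) bounded_linear_inner_left] Ck_on_derivative Suc.prems)
      show "Ck_on k S (\<lambda>x. frechet_derivative g (at (f x)) b)"
        by (intro Suc.IH Ck_on_Suc_imp[OF Suc.prems(1)] Ck_on_derivative Suc.prems(2))
    qed
  qed
qed

lemma smooth_on_mono: "smooth_on S f \<Longrightarrow> T \<subseteq> S \<Longrightarrow> smooth_on T f"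
  unfolding smooth_on_def using Ck_on_subset by blast

lemma smooth_on_cong:
  "open S \<Longrightarrow> (\<And>x. x \<in> S \<Longrightarrow> f x = g x) \<Longrightarrow> smooth_on S f \<Longrightarrow> smooth_on S g"
  unfolding smooth_on_def using Ck_on_cong by blast

lemma smooth_on_const: "open S \<Longrightarrow> smooth_on S (\<lambda>x. c)"
  by (simp add: smooth_on_def Ck_on_const)

lemma smooth_on_linear: "open S \<Longrightarrow> bounded_linear L \<Longrightarrow> smooth_on S L"
  by (simp add: smooth_on_def Ck_on_linear)

lemma smooth_on_bounded_linear:
  "open S \<Longrightarrow> bounded_linear L \<Longrightarrow> smooth_on S f \<Longrightarrow> smooth_on S (\<lambda>x. L (f x))"
  by (simp add: smooth_on_def Ck_on_bounded_linear)

lemma smooth_on_add: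
  "open S \<Longrightarrow> smooth_on S f \<Longrightarrow> smooth_on S g \<Longrightarrow> smooth_on S (\<lambda>x. f x + g x)"
  by (simp add: smooth_on_def Ck_on_add)

lemma smooth_on_mult:
  fixes f g :: "'a::real_normed_vector \<Rightarrow> real"
  shows "open S \<Longrightarrow> smooth_on S f \<Longrightarrow> smooth_on S g \<Longrightarrow> smooth_on S (\<lambda>x. f x * g x)"
  using Ck_on_scaleR[of S _ f g] by (simp add: smooth_on_def)

lemma smooth_on_compose:
  fixes f :: "'a::real_normed_vector \<Rightarrow> 'b::euclidean_space"
  shows "open S \<Longrightarrow> open T \<Longrightarrow> f ` S \<subseteq> T \<Longrightarrow> smooth_on S f \<Longrightarrow> smooth_on T g
    \<Longrightarrow> smooth_on S (\<lambda>x. g (f x))"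
  unfolding smooth_on_def using Ck_on_compose by blast

lemma smooth_on_has_derivative:
  "smooth_on S f \<Longrightarrow> x \<in> S \<Longrightarrow> (f has_derivative frechet_derivative f (at x)) (at x)"
  unfolding smooth_on_def using Ck_on_has_derivative by blast

lemma smooth_on_derivative:
  "smooth_on S f \<Longrightarrow> smooth_on S (\<lambda>x. frechet_derivative f (at x) v)"
  unfolding smooth_on_def using Ck_on.simps(2) by blast

lemma smooth_on_continuous_on: "smooth_on S f \<Longrightarrow> continuous_on S f"
  unfolding smooth_on_def using Ck_on.simps(1) by blast

lemma smooth_on_Pair:
  fixes f :: "'a::real_normed_vector \<Rightarrow> 'b::real_normed_vector"
    and g :: "'a \<Rightarrow> 'c::real_normed_vector"
  assumes "open S" "smooth_on S f" "smooth_on S g"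
  shows "smooth_on S (\<lambda>x. (f x, g x))"
proof -
  have "bounded_linear (\<lambda>y::'b. (y, 0::'c))" "bounded_linear (\<lambda>z::'c. (0::'b, z))"
    by (auto intro: bounded_linear_Pair bounded_linear_ident bounded_linear_zero)
  then have "smooth_on S (\<lambda>x. (f x, 0) + (0, g x))"
    using assms smooth_on_bounded_linear[OF assms(1) _ assms(2)]
      smooth_on_bounded_linear[OF assms(1) _ assms(3)] by (intro smooth_on_add) blast+
  then show ?thesis by simp
qed

section \<open>Symmetry of second derivatives\<close>

lemma has_real_derivative_along:
  fixes g :: "'a::real_normed_vector \<Rightarrow> real"
  assumes "(g has_derivative D) (at (a + r *\<^sub>R u))"
  shows "((\<lambda>r. g (a + r *\<^sub>R u)) has_real_derivative D u) (at r)"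
proof -
  have "((\<lambda>r. a + r *\<^sub>R u) has_derivative (\<lambda>h. h *\<^sub>R u)) (at r)"
    by (auto intro!: derivative_eq_intros)
  from has_derivative_compose[OF this assms]
  have "((\<lambda>r. g (a + r *\<^sub>R u)) has_derivative (\<lambda>h. D (h *\<^sub>R u))) (at r)" .
  moreover have "D (h *\<^sub>R u) = D u * h" for h
    using linear_scale[OF has_derivative_linear[OF assms]] by simp
  ultimately show ?thesis by (simp add: has_field_derivative_def)
qed

text \<open>Two applications of the mean value theorem over a parallelogram: along \<open>u\<close>
  to the increment of \<open>g\<close> by \<open>s *\<^sub>R v\<close>, then along \<open>v\<close>
  to the derivative of \<open>g\<close> in the direction \<open>u\<close>.\<close>

lemma second_difference:
  fixes g :: "'a::real_normed_vector \<Rightarrow> real"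
  assumes sm: "Ck_on 2 S g" and s: "s > 0"
    and in_S: "\<And>r r'. 0 \<le> r \<Longrightarrow> r \<le> s \<Longrightarrow> 0 \<le> r' \<Longrightarrow> r' \<le> s \<Longrightarrow> x + r *\<^sub>R u + r' *\<^sub>R v \<in> S"
  obtains r r' where "0 \<le> r" "r \<le> s" "0 \<le> r'" "r' \<le> s"
    "g (x + s *\<^sub>R u + s *\<^sub>R v) - g (x + s *\<^sub>R u) - g (x + s *\<^sub>R v) + g x
     = s * (s * frechet_derivative (\<lambda>z. frechet_derivative g (at z) u) (at (x + r *\<^sub>R u + r' *\<^sub>R v)) v)"
proof -
  define g' where "g' z = frechet_derivative g (at z) u" for z
  have g: "(g has_derivative frechet_derivative g (at z)) (at z)"
    "(g' has_derivative frechet_derivative g' (at z)) (at z)" if "z \<in> S" for z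
    using sm that by (auto simp: numeral_2_eq_2 g'_def[abs_def] frechet_derivative_works)
  define \<phi> where "\<phi> r = g ((x + s *\<^sub>R v) + r *\<^sub>R u) - g (x + r *\<^sub>R u)" for r
  have \<phi>: "(\<phi> has_real_derivative g' ((x + s *\<^sub>R v) + r *\<^sub>R u) - g' (x + r *\<^sub>R u)) (at r)"
    if "0 \<le> r" "r \<le> s" for r
    unfolding \<phi>_def g'_def
    using in_S[OF that, of s] in_S[OF that, of 0] s
    by (intro DERIV_diff has_real_derivative_along g) (auto simp: algebra_simps)
  have "\<exists>r>0. r < s \<and> \<phi> s - \<phi> 0 = (s - 0) * (g' ((x + s *\<^sub>R v) + r *\<^sub>R u) - g' (x + r *\<^sub>R u))"
    by (rule MVT2[OF s]) (rule \<phi>)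
  then obtain r where r: "0 < r" "r < s"
    "\<phi> s - \<phi> 0 = s * (g' ((x + s *\<^sub>R v) + r *\<^sub>R u) - g' (x + r *\<^sub>R u))"
    by auto
  have \<psi>: "((\<lambda>q. g' ((x + r *\<^sub>R u) + q *\<^sub>R v)) has_real_derivative
      frechet_derivative g' (at ((x + r *\<^sub>R u) + q *\<^sub>R v)) v) (at q)" if "0 \<le> q" "q \<le> s" for q
    using in_S[of r q] r that by (intro has_real_derivative_along g) auto
  have "\<exists>q>0. q < s \<and> g' ((x + r *\<^sub>R u) + s *\<^sub>R v) - g' ((x + r *\<^sub>R u) + 0 *\<^sub>R v)
      = (s - 0) * frechet_derivative g' (at ((x + r *\<^sub>R u) + q *\<^sub>R v)) v"
    by (rule MVT2[OF s]) (rule \<psi>)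
  then obtain q where q: "0 < q" "q < s" "g' (x + r *\<^sub>R u + s *\<^sub>R v) - g' (x + r *\<^sub>R u)
      = s * frechet_derivative g' (at (x + r *\<^sub>R u + q *\<^sub>R v)) v"
    by auto
  have "g (x + s *\<^sub>R u + s *\<^sub>R v) - g (x + s *\<^sub>R u) - g (x + s *\<^sub>R v) + g x = \<phi> s - \<phi> 0"
    by (simp add: \<phi>_def algebra_simps)
  also have "\<dots> = s * (g' (x + r *\<^sub>R u + s *\<^sub>R v) - g' (x + r *\<^sub>R u))"
    unfolding r(3) by (simp add: algebra_simps)
  finally show thesis
    using r q by (intro that[of r q]) (simp_all add: g'_def[abs_def])
qed

text \<open>The second difference does not change when \<open>u\<close> and \<open>v\<close> are
  exchanged, so after division by \<open>s * s\<close> the two mixed derivatives agree at a pair of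
  points near \<open>x\<close>; continuity carries the equality to \<open>x\<close>.\<close>

lemma symmetric_second_derivative_real:
  fixes g :: "'a::real_normed_vector \<Rightarrow> real"
  assumes S: "open S" "x \<in> S" and sm: "smooth_on S g"
  shows "frechet_derivative (\<lambda>z. frechet_derivative g (at z) u) (at x) v
       = frechet_derivative (\<lambda>z. frechet_derivative g (at z) v) (at x) u"
proof -
  define A where "A z = frechet_derivative (\<lambda>z. frechet_derivative g (at z) u) (at z) v" for z
  define B where "B z = frechet_derivative (\<lambda>z. frechet_derivative g (at z) v) (at z) u" for z
  have ck: "Ck_on 2 S g" using sm by (simp add: smooth_on_def)
  have cont: "continuous_on S A" "continuous_on S B"
    unfolding A_def B_def
    by (intro smooth_on_continuous_on smooth_on_derivative sm)+
  have "dist (A x) (B x) < 2 * e" if e: "e > 0" for e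
  proof -
    obtain d1 where d1: "d1 > 0" "ball x d1 \<subseteq> S" using S openE by blast
    obtain d2 where d2: "d2 > 0" "\<And>z. z \<in> S \<Longrightarrow> dist z x < d2 \<Longrightarrow> dist (A z) (A x) < e"
      using cont(1) S(2) e unfolding continuous_on_iff by meson
    obtain d3 where d3: "d3 > 0" "\<And>z. z \<in> S \<Longrightarrow> dist z x < d3 \<Longrightarrow> dist (B z) (B x) < e"
      using cont(2) S(2) e unfolding continuous_on_iff by meson
    define d where "d = min d1 (min d2 d3)"
    have d: "d > 0" "d \<le> d1" "d \<le> d2" "d \<le> d3" using d1 d2 d3 by (auto simp: d_def)
    \<comment> \<open>The summand 1 keeps \<open>m\<close> positive when \<open>u\<close> and
      \<open>v\<close> vanish; \<open>s * m = d / 2\<close> then keeps the whole parallelogram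
      within distance \<open>d\<close> of \<open>x\<close>.\<close>
    define m where "m = norm u + norm v + 1"
    define s where "s = d / m / 2"
    have m: "m > 0" unfolding m_def by (simp add: add_nonneg_pos)
    have s: "s > 0" unfolding s_def using d(1) m by simp
    have near: "dist (x + r *\<^sub>R u + r' *\<^sub>R v) x < d" if "0 \<le> r" "r \<le> s" "0 \<le> r'" "r' \<le> s" for r r'
    proof -
      have "dist (x + r *\<^sub>R u + r' *\<^sub>R v) x = norm (r *\<^sub>R u + r' *\<^sub>R v)"
        by (simp add: dist_norm)
      also have "\<dots> \<le> r * norm u + r' * norm v"
        using norm_triangle_ineq[of "r *\<^sub>R u" "r' *\<^sub>R v"] that by simp
      also have "\<dots> \<le> s * norm u + s * norm v"
        using that by (intro add_mono mult_right_mono) auto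
      also have "\<dots> \<le> s * m" using s by (simp add: m_def algebra_simps)
      also have "\<dots> = d / 2" unfolding s_def using m by simp
      also have "\<dots> < d" using d(1) by simp
      finally show ?thesis .
    qed
    have in_S: "x + r *\<^sub>R u + r' *\<^sub>R v \<in> S" if "0 \<le> r" "r \<le> s" "0 \<le> r'" "r' \<le> s" for r r'
      using near[OF that] d(2) d1(2) by (auto simp: dist_commute subset_iff)
    have in_S': "x + r *\<^sub>R v + r' *\<^sub>R u \<in> S" if "0 \<le> r" "r \<le> s" "0 \<le> r'" "r' \<le> s" for r r'
      using in_S[OF that(3,4,1,2)] by (simp add: algebra_simps)
    obtain r r' where r: "0 \<le> r" "r \<le> s" "0 \<le> r'" "r' \<le> s" and
      1: "g (x + s *\<^sub>R u + s *\<^sub>R v) - g (x + s *\<^sub>R u) - g (x + s *\<^sub>R v) + g x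
         = s * (s * A (x + r *\<^sub>R u + r' *\<^sub>R v))"
      by (rule second_difference[OF ck s in_S, folded A_def]) blast
    obtain q q' where q: "0 \<le> q" "q \<le> s" "0 \<le> q'" "q' \<le> s" and
      2: "g (x + s *\<^sub>R v + s *\<^sub>R u) - g (x + s *\<^sub>R v) - g (x + s *\<^sub>R u) + g x
         = s * (s * B (x + q *\<^sub>R v + q' *\<^sub>R u))"
      by (rule second_difference[OF ck s in_S', folded B_def]) blast
    from 1 2 have "s * (s * A (x + r *\<^sub>R u + r' *\<^sub>R v)) = s * (s * B (x + q *\<^sub>R v + q' *\<^sub>R u))"
      by (simp add: algebra_simps)
    then have "A (x + r *\<^sub>R u + r' *\<^sub>R v) = B (x + q *\<^sub>R v + q' *\<^sub>R u)" using s by simp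
    moreover have "dist (A (x + r *\<^sub>R u + r' *\<^sub>R v)) (A x) < e"
      using d2(2)[OF in_S[OF r]] near[OF r] d by simp
    moreover have "dist (B (x + q *\<^sub>R v + q' *\<^sub>R u)) (B x) < e"
      using d3(2)[OF in_S'[OF q]] near[OF q(3,4,1,2)] d by (simp add: algebra_simps)
    ultimately show ?thesis
      using dist_triangle3[of "A x" "B x" "A (x + r *\<^sub>R u + r' *\<^sub>R v)"] by simp
  qed
  then have "dist (A x) (B x) \<le> 0 + e" if "e > 0" for e
    using that by (metis add_0 field_sum_of_halves half_gt_zero less_imp_le mult_2)
  then have "dist (A x) (B x) \<le> 0" by (rule field_le_epsilon)
  then show ?thesis by (simp add: A_def B_def)
qed

lemma symmetric_second_derivative:
  fixes g :: "'a::real_normed_vector \<Rightarrow> 'b::euclidean_space"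
  assumes S: "open S" "x \<in> S" and sm: "smooth_on S g"
  shows "frechet_derivative (\<lambda>z. frechet_derivative g (at z) u) (at x) v
       = frechet_derivative (\<lambda>z. frechet_derivative g (at z) v) (at x) u"
proof (rule euclidean_eqI)
  fix b :: 'b
  have 1: "frechet_derivative (\<lambda>z. g z \<bullet> b) (at z) w = frechet_derivative g (at z) w \<bullet> b"
    if "z \<in> S" "smooth_on S g" for g :: "'a \<Rightarrow> 'b" and z w
    using frechet_derivative_at[OF has_derivative_inner_left[OF smooth_on_has_derivative[OF that(2,1)]]]
    by metis
  have 2: "frechet_derivative (\<lambda>z. frechet_derivative (\<lambda>z. g z \<bullet> b) (at z) w) (at x) w'
      = frechet_derivative (\<lambda>z. frechet_derivative g (at z) w) (at x) w' \<bullet> b" for w w'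
  proof -
    have sm': "smooth_on S (\<lambda>z. frechet_derivative g (at z) w)"
      by (rule smooth_on_derivative[OF sm])
    have "((\<lambda>z. frechet_derivative g (at z) w \<bullet> b) has_derivative
        (\<lambda>w'. frechet_derivative (\<lambda>z. frechet_derivative g (at z) w) (at x) w' \<bullet> b)) (at x)"
      by (rule has_derivative_inner_left[OF smooth_on_has_derivative[OF sm' S(2)]])
    then have "((\<lambda>z. frechet_derivative (\<lambda>z. g z \<bullet> b) (at z) w) has_derivative
        (\<lambda>w'. frechet_derivative (\<lambda>z. frechet_derivative g (at z) w) (at x) w' \<bullet> b)) (at x)"
      by (rule has_derivative_transform_within_open[OF _ S]) (simp add: 1 sm)
    then show ?thesis by (metis frechet_derivative_at)
  qed
  have "smooth_on S (\<lambda>z. g z \<bullet> b)"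
    by (rule smooth_on_bounded_linear[OF S(1) bounded_linear_inner_left sm])
  from symmetric_second_derivative_real[OF S this, of u v]
  show "frechet_derivative (\<lambda>z. frechet_derivative g (at z) u) (at x) v \<bullet> b
     = frechet_derivative (\<lambda>z. frechet_derivative g (at z) v) (at x) u \<bullet> b"
    by (simp add: 2)
qed

section \<open>The Minkowski form and the geodesic flow\<close>

lemma bilinear_mink: "bilinear (mink :: 'n::finite minkowski \<Rightarrow> _)"
  unfolding bilinear_def linear_iff mink_def
  by (simp add: sum.distrib sum_distrib_left algebra_simps)

lemma bounded_bilinear_mink: "bounded_bilinear (mink :: 'n::finite minkowski \<Rightarrow> _)"
  using bilinear_mink bilinear_conv_bounded_bilinear by blast

interpretation mink: bounded_bilinear "mink :: 'n::finite minkowski \<Rightarrow> _"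
  by (rule bounded_bilinear_mink)

lemmas mink_simps = mink.add_left mink.add_right mink.diff_left mink.diff_right
  mink.scaleR_left mink.scaleR_right mink.minus_left mink.minus_right
  mink.zero_left mink.zero_right

lemma mink_commute: "mink x y = mink y x"
  by (simp add: mink_def mult.commute)

lemma mink_nondegenerate:
  fixes w :: "'n::finite minkowski"
  assumes "\<And>z. mink w z = 0"
  shows "w = 0"
proof -
  have "w $ Some i = 0" for i
  proof -
    have "mink w (axis (Some i) 1) = (\<Sum>j\<in>UNIV. if j = i then w $ Some j else 0)"
      by (simp add: mink_def axis_def if_distrib cong: if_cong)
    then show ?thesis using assms by simp
  qed
  moreover have "w $ None = 0"
  proof -
    have "mink w (axis None 1) = - w $ None"
      by (simp add: mink_def axis_def)
    then show ?thesis using assms by (metis neg_equal_0_iff_equal)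
  qed
  ultimately show ?thesis by (metis option.exhaust vec_eq_iff zero_index)
qed

lemma unit_tangentD:
  assumes "(x, v) \<in> unit_tangent"
  shows "mink x x = -1" "x $ None > 0" "mink x v = 0" "mink v x = 0" "mink v v = 1"
  using assms mink_commute[of v x] by (auto simp: unit_tangent_def hyperbolic_space_def)

lemma orth_space_nondegenerate:
  assumes "(x, v) \<in> unit_tangent" "w \<in> orth_space (x, v)"
    and "\<And>w'. w' \<in> orth_space (x, v) \<Longrightarrow> mink w w' = 0"
  shows "w = 0"
proof (rule mink_nondegenerate)
  fix z
  note [simp] = unit_tangentD[OF assms(1)]
  \<comment> \<open>The orthogonal projection of \<open>z\<close>, with signs from
    \<open>mink x x = -1\<close> and \<open>mink v v = 1\<close>. A vector \<open>w\<close> of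
    \<open>orth_space (x, v)\<close> pairs with \<open>z\<close> as it does with this
    projection.\<close>
  have "z + mink x z *\<^sub>R x - mink v z *\<^sub>R v \<in> orth_space (x, v)"
    by (simp add: orth_space_def mink_simps)
  from assms(3)[OF this] assms(2) show "mink w z = 0"
    by (simp add: orth_space_def mink_simps mink_commute[of w])
qed

text \<open>The coefficient of \<open>chi a\<close> is the para-Sasaki product with
  \<open>chi a\<close>. Tangent vectors in \<open>chi_perp\<close> thus become plain pairs, on which
  the metric is a difference of two products and \<open>para_J\<close> exchanges the
  entries.\<close>

lemma chi_perp_eq:
  assumes "a \<in> unit_tangent"
  shows "chi_perp a = {(w, u). w \<in> orth_space a \<and> u \<in> orth_space a}"
proof -
  have 0: "0 \<in> orth_space a" by (cases a) (simp add: orth_space_def mink_simps)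
  have z: "components a (chi a) = (1, 0, 0)"
    using components_eq[OF assms 0 0, of 1] by (simp add: hor_lift_def ver_lift_def flip: zero_prod_def)
  have 1: "para_sasaki a (c *\<^sub>R chi a + hor_lift w + ver_lift u) (chi a) = c"
    if "w \<in> orth_space a" "u \<in> orth_space a" for c w u
    by (simp add: para_sasaki_def components_eq[OF assms that] z mink_simps)
  show ?thesis
  proof (intro set_eqI iffI)
    fix \<xi> assume "\<xi> \<in> chi_perp a"
    then obtain c w u where \<xi>: "w \<in> orth_space a" "u \<in> orth_space a"
      "\<xi> = c *\<^sub>R chi a + hor_lift w + ver_lift u" "para_sasaki a \<xi> (chi a) = 0"
      unfolding chi_perp_def unit_tangent_tangent_def by blast
    with 1 have "c = 0" by metis
    then show "\<xi> \<in> {(w, u). w \<in> orth_space a \<and> u \<in> orth_space a}"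
      using \<xi> by (simp add: hor_lift_def ver_lift_def)
  next
    fix \<xi> assume "\<xi> \<in> {(w, u). w \<in> orth_space a \<and> u \<in> orth_space a}"
    then obtain w u where \<xi>: "w \<in> orth_space a" "u \<in> orth_space a" "\<xi> = (w, u)" by auto
    then have e: "\<xi> = 0 *\<^sub>R chi a + hor_lift w + ver_lift u"
      by (simp add: hor_lift_def ver_lift_def)
    then have "\<xi> \<in> unit_tangent_tangent a"
      unfolding unit_tangent_tangent_def using \<xi>(1,2) by blast
    moreover have "para_sasaki a \<xi> (chi a) = 0" unfolding e by (rule 1[OF \<xi>(1,2)])
    ultimately show "\<xi> \<in> chi_perp a" by (simp add: chi_perp_def)
  qed
qed

lemma components_chi_perp:
  assumes "a \<in> unit_tangent" "w \<in> orth_space a" "u \<in> orth_space a"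
  shows "components a (w, u) = (0, w, u)"
  using components_eq[OF assms, of 0] by (simp add: hor_lift_def ver_lift_def)

lemma para_sasaki_chi_perp:
  assumes "a \<in> unit_tangent" "w \<in> orth_space a" "u \<in> orth_space a"
    "w' \<in> orth_space a" "u' \<in> orth_space a"
  shows "para_sasaki a (w, u) (w', u') = mink w w' - mink u u'"
  using assms by (simp add: para_sasaki_def components_chi_perp)

lemma para_J_chi_perp:
  assumes "a \<in> unit_tangent" "w \<in> orth_space a" "u \<in> orth_space a"
  shows "para_J a (w, u) = (u, w)"
  using assms by (simp add: para_J_def components_chi_perp hor_lift_def ver_lift_def)

text \<open>Cauchy-Schwarz for the spatial parts, whose products are known from the constraints. The
  bound keeps the flow on the upper sheet.\<close>

lemma unit_tangent_time_component:
  assumes "(x, v) \<in> unit_tangent"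
  shows "\<bar>v $ None\<bar> < x $ None"
proof -
  define X V where "X = (\<chi> i. x $ Some i)" and "V = (\<chi> i. v $ Some i)"
  have m: "X \<bullet> X = (x $ None)\<^sup>2 - 1" "X \<bullet> V = x $ None * v $ None" "V \<bullet> V = (v $ None)\<^sup>2 + 1"
    using unit_tangentD(1,3,5)[OF assms]
    by (simp_all add: X_def V_def mink_def inner_vec_def power2_eq_square)
  have "(X \<bullet> V)\<^sup>2 \<le> (X \<bullet> X) * (V \<bullet> V)" by (rule Cauchy_Schwarz_ineq)
  then have "(v $ None)\<^sup>2 < (x $ None)\<^sup>2"
    unfolding m by (simp add: power2_eq_square algebra_simps)
  then have "\<bar>v $ None\<bar> < \<bar>x $ None\<bar>" by (metis abs_le_square_iff not_le)
  then show ?thesis using unit_tangentD(2)[OF assms] by simp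
qed

section \<open>The geodesic flow and its invariants\<close>

lemma flow_Pair:
  "flow t (x, v) = (cosh t *\<^sub>R x + sinh t *\<^sub>R v, sinh t *\<^sub>R x + cosh t *\<^sub>R v)"
  by (simp add: flow_def)

lemma cosh_sinh_real: "cosh t * cosh t = sinh t * sinh t + (1::real)"
  using cosh_square_eq[of t] by (simp add: power2_eq_square)

text \<open>The quadratic conditions follow from cosh^2 - sinh^2 = 1. The delicate one is positivity
  of the time component, where \<open>\<bar>sinh t\<bar> < cosh t\<close> is combined with
  \<open>\<bar>v $ None\<bar> < x $ None\<close>.\<close>

lemma flow_in_unit_tangent:
  assumes "a \<in> unit_tangent"
  shows "flow t a \<in> unit_tangent"
proof -
  obtain x v where a: "a = (x, v)" by (cases a)
  note s = unit_tangentD[OF assms[unfolded a]]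
  have "\<bar>sinh t * v $ None\<bar> < cosh t * x $ None"
    unfolding abs_mult using unit_tangent_time_component[OF assms[unfolded a]] s(2)
    by (intro mult_strict_mono') (use sinh_less_cosh_real[of t] sinh_less_cosh_real[of "-t"] in \<open>auto simp: abs_less_iff\<close>)
  then have "cosh t * x $ None + sinh t * v $ None > 0" by linarith
  then show ?thesis unfolding a flow_Pair
    by (simp add: unit_tangent_def hyperbolic_space_def mink_simps s cosh_sinh_real algebra_simps)
qed

lemma flow_0: "flow 0 a = a"
  by (cases a) (simp add: flow_Pair)

lemma flow_flow: "flow s (flow t a) = flow (s + t) a"
  by (cases a) (simp add: flow_Pair sinh_add cosh_add algebra_simps)

lemma bounded_linear_flow: "bounded_linear (flow t :: 'n::finite minkowski \<times> 'n minkowski \<Rightarrow> _)"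
proof -
  have "flow t = (\<lambda>a :: 'n minkowski \<times> 'n minkowski.
      (cosh t *\<^sub>R fst a + sinh t *\<^sub>R snd a, sinh t *\<^sub>R fst a + cosh t *\<^sub>R snd a))"
    by (simp add: flow_def case_prod_beta')
  moreover have "bounded_linear (\<lambda>a :: 'n minkowski \<times> 'n minkowski.
      (cosh t *\<^sub>R fst a + sinh t *\<^sub>R snd a, sinh t *\<^sub>R fst a + cosh t *\<^sub>R snd a))"
    by (intro bounded_linear_Pair bounded_linear_add bounded_linear_fst bounded_linear_snd
        bounded_linear_compose[OF bounded_linear_scaleR_right])
  ultimately show ?thesis by simp
qed

text \<open>The flow replaces \<open>x\<close> and \<open>v\<close> by another basis of the plane
  that they span; the two identities inside invert the base change.\<close>

lemma orth_space_flow: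
  "orth_space (flow t a) = orth_space a"
proof -
  obtain x v where a: "a = (x, v)" by (cases a)
  have "mink x w = 0 \<and> mink v w = 0"
    if "cosh t * mink x w + sinh t * mink v w = 0" "sinh t * mink x w + cosh t * mink v w = 0" for w
  proof -
    have "(cosh t * cosh t - sinh t * sinh t) * mink x w = cosh t * (cosh t * mink x w + sinh t * mink v w)
        - sinh t * (sinh t * mink x w + cosh t * mink v w)"
      "(cosh t * cosh t - sinh t * sinh t) * mink v w = cosh t * (sinh t * mink x w + cosh t * mink v w)
        - sinh t * (cosh t * mink x w + sinh t * mink v w)"
      by (simp_all add: algebra_simps)
    with that show ?thesis by (simp add: cosh_sinh_real)
  qed
  then show ?thesis
    by (auto simp: a flow_Pair orth_space_def mink_simps)
qed

lemma orth_space_scale: "w \<in> orth_space a \<Longrightarrow> c *\<^sub>R w \<in> orth_space a"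
  by (cases a) (simp add: orth_space_def mink_simps)

lemma orth_space_add: "w \<in> orth_space a \<Longrightarrow> u \<in> orth_space a \<Longrightarrow> w + u \<in> orth_space a"
  by (cases a) (simp add: orth_space_def mink_simps)

lemma orth_space_minus: "w \<in> orth_space a \<Longrightarrow> - w \<in> orth_space a"
  by (cases a) (simp add: orth_space_def mink_simps)

lemma orth_space_diff: "w \<in> orth_space a \<Longrightarrow> u \<in> orth_space a \<Longrightarrow> w - u \<in> orth_space a"
  by (cases a) (simp add: orth_space_def mink_simps)

text \<open>\<open>flow t\<close> is linear on the ambient space and so is its own differential:
  \<open>flow t \<xi>\<close> is the transported tangent vector.\<close>

lemma flow_chi_perp:
  assumes "a \<in> unit_tangent" "\<xi> \<in> chi_perp a"
  shows "flow t \<xi> \<in> chi_perp (flow t a)"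
  using assms
  by (auto simp: chi_perp_eq flow_in_unit_tangent orth_space_flow flow_Pair
      intro!: orth_space_add orth_space_scale)

text \<open>The flow acts on the pair of horizontal and vertical parts by a hyperbolic rotation,
  which multiplies \<open>mink w w' - mink u u'\<close> by cosh^2 - sinh^2 = 1.\<close>

lemma para_sasaki_flow:
  assumes "a \<in> unit_tangent" "\<xi> \<in> chi_perp a" "\<eta> \<in> chi_perp a"
  shows "para_sasaki (flow t a) (flow t \<xi>) (flow t \<eta>) = para_sasaki a \<xi> \<eta>"
proof -
  obtain w u w' u' where [simp]: "\<xi> = (w, u)" "\<eta> = (w', u')" by (cases \<xi>, cases \<eta>)
  have o: "w \<in> orth_space a" "u \<in> orth_space a" "w' \<in> orth_space a" "u' \<in> orth_space a"
    using assms by (auto simp: chi_perp_eq)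
  have "para_sasaki (flow t a) (flow t \<xi>) (flow t \<eta>)
      = mink (cosh t *\<^sub>R w + sinh t *\<^sub>R u) (cosh t *\<^sub>R w' + sinh t *\<^sub>R u')
      - mink (sinh t *\<^sub>R w + cosh t *\<^sub>R u) (sinh t *\<^sub>R w' + cosh t *\<^sub>R u')"
    unfolding \<open>\<xi> = _\<close> \<open>\<eta> = _\<close> flow_Pair[of t w] flow_Pair[of t w']
    by (intro para_sasaki_chi_perp flow_in_unit_tangent assms)
       (auto simp: orth_space_flow intro!: orth_space_add orth_space_scale o)
  also have "\<dots> = (cosh t * cosh t - sinh t * sinh t) * (mink w w' - mink u u')"
    by (simp add: mink_simps algebra_simps)
  also have "\<dots> = para_sasaki a \<xi> \<eta>"
    using o assms(1) by (simp add: cosh_sinh_real para_sasaki_chi_perp)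
  finally show ?thesis .
qed

lemma para_J_flow:
  assumes "a \<in> unit_tangent" "\<xi> \<in> chi_perp a"
  shows "para_J (flow t a) (flow t \<xi>) = flow t (para_J a \<xi>)"
proof -
  obtain w u where [simp]: "\<xi> = (w, u)" by (cases \<xi>)
  have o: "w \<in> orth_space a" "u \<in> orth_space a"
    using assms by (auto simp: chi_perp_eq)
  have "para_J (flow t a) (flow t \<xi>)
      = (sinh t *\<^sub>R w + cosh t *\<^sub>R u, cosh t *\<^sub>R w + sinh t *\<^sub>R u)"
    unfolding \<open>\<xi> = _\<close> flow_Pair[of t w]
    by (intro para_J_chi_perp flow_in_unit_tangent assms)
       (auto simp: orth_space_flow intro!: orth_space_add orth_space_scale o)
  then show ?thesis
    using o assms(1) by (simp add: para_J_chi_perp flow_Pair add.commute)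
qed

section \<open>The space of geodesics\<close>

lemma geod_eq_iff: "geod a = geod b \<longleftrightarrow> (\<exists>t. b = flow t a)"
proof
  assume "geod a = geod b"
  moreover have "b \<in> geod b" unfolding geod_def by (metis flow_0 rangeI)
  ultimately show "\<exists>t. b = flow t a" by (auto simp: geod_def)
next
  assume "\<exists>t. b = flow t a"
  then obtain t where b: "b = flow t a" ..
  have "flow s b = flow (s + t) a" "flow s a = flow (s - t) b" for s by (simp_all add: b flow_flow)
  then show "geod a = geod b" unfolding geod_def by (metis image_subsetI rangeI subset_antisym)
qed

lemma geod_flow: "geod (flow t a) = geod a"
  using geod_eq_iff by metis

text \<open>Replaces smoothness on a subset of the ambient space by calculus on an open set, where
  Frechet derivatives are unique.\<close>

lemma geod_smooth_at_extension:
  assumes "h \<in> geod_smooth_at (geod a)" "a \<in> unit_tangent"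
  obtains W F where "open W" "a \<in> W" "smooth_on W F" "\<And>b. b \<in> unit_tangent \<inter> W \<Longrightarrow> F b = h (geod b)"
proof -
  obtain V where V: "geod a \<in> V" "openin (top_of_set unit_tangent) {b \<in> unit_tangent. geod b \<in> V}"
    "smooth_on_subset {b \<in> unit_tangent. geod b \<in> V} (h \<circ> geod)"
    using assms(1) unfolding geod_smooth_at_def by blast
  obtain U where U: "open U" "{b \<in> unit_tangent. geod b \<in> V} = unit_tangent \<inter> U"
    using V(2) unfolding openin_open by blast
  have "a \<in> {b \<in> unit_tangent. geod b \<in> V}" using V(1) assms(2) by simp
  then obtain W F where W: "open W" "a \<in> W" "smooth_on W F"
    "\<forall>b \<in> {b \<in> unit_tangent. geod b \<in> V} \<inter> W. F b = (h \<circ> geod) b"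
    using V(3) unfolding smooth_on_subset_def by blast
  show thesis
  \<comment> \<open>After intersecting with \<open>U\<close>, every unit tangent vector in the set
    projects into \<open>V\<close>, which is where \<open>F\<close> agrees with the pullback of
    \<open>h\<close>.\<close>
  proof (rule that[of "W \<inter> U" F])
    show "a \<in> W \<inter> U" using W(2) U(2) V(1) assms(2) by blast
    show "F b = h (geod b)" if "b \<in> unit_tangent \<inter> (W \<inter> U)" for b
      using W(4) that unfolding U(2) by simp
    show "smooth_on (W \<inter> U) F" using W(3) by (rule smooth_on_mono) blast
  qed (use W U in blast)
qed

text \<open>The operation is a parameter so that sums and products are covered by one
  argument.\<close>

lemma geod_smooth_at_combine:
  fixes op :: "real \<Rightarrow> real \<Rightarrow> real"
  assumes op: "\<And>W F G. open (W :: ('n::finite minkowski \<times> 'n minkowski) set) \<Longrightarrow> smooth_on W F \<Longrightarrow>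
      smooth_on W G \<Longrightarrow> smooth_on W (\<lambda>b. op (F b) (G b))"
    and "h \<in> geod_smooth_at q" "k \<in> geod_smooth_at (q :: 'n geodesic)"
  shows "(\<lambda>q. op (h q) (k q)) \<in> geod_smooth_at q"
proof -
  obtain V where V: "V \<subseteq> geodesics" "q \<in> V"
    "openin (top_of_set unit_tangent) {b \<in> unit_tangent. geod b \<in> V}"
    "smooth_on_subset {b \<in> unit_tangent. geod b \<in> V} (h \<circ> geod)"
    using assms(2) unfolding geod_smooth_at_def by blast
  obtain V' where V': "q \<in> V'"
    "openin (top_of_set unit_tangent) {b \<in> unit_tangent. geod b \<in> V'}"
    "smooth_on_subset {b \<in> unit_tangent. geod b \<in> V'} (k \<circ> geod)"
    using assms(3) unfolding geod_smooth_at_def by blast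
  have e: "{b \<in> unit_tangent. geod b \<in> V \<inter> V'} =
      {b \<in> unit_tangent. geod b \<in> V} \<inter> {b \<in> unit_tangent. geod b \<in> V'}" by blast
  have "smooth_on_subset {b \<in> unit_tangent. geod b \<in> V \<inter> V'} ((\<lambda>q. op (h q) (k q)) \<circ> geod)"
    unfolding smooth_on_subset_def
  proof
    fix a assume a: "a \<in> {b \<in> unit_tangent. geod b \<in> V \<inter> V'}"
    obtain W F where W: "open W" "a \<in> W" "smooth_on W F"
      "\<forall>b \<in> {b \<in> unit_tangent. geod b \<in> V} \<inter> W. F b = (h \<circ> geod) b"
      using V(4) a unfolding smooth_on_subset_def e by blast
    obtain W' F' where W': "open W'" "a \<in> W'" "smooth_on W' F'"
      "\<forall>b \<in> {b \<in> unit_tangent. geod b \<in> V'} \<inter> W'. F' b = (k \<circ> geod) b"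
      using V'(3) a unfolding smooth_on_subset_def e by blast
    have "smooth_on (W \<inter> W') (\<lambda>b. op (F b) (F' b))"
      by (intro op open_Int W(1) W'(1) smooth_on_mono[OF W(3)] smooth_on_mono[OF W'(3)]) auto
    moreover have "\<forall>b\<in>{b \<in> unit_tangent. geod b \<in> V \<inter> V'} \<inter> (W \<inter> W').
        op (F b) (F' b) = ((\<lambda>q. op (h q) (k q)) \<circ> geod) b"
      using W(4) W'(4) by auto
    moreover have "open (W \<inter> W')" "a \<in> W \<inter> W'" using W(1,2) W'(1,2) by auto
    ultimately show "\<exists>W F. open W \<and> a \<in> W \<and> smooth_on W F \<and>
        (\<forall>b\<in>{b \<in> unit_tangent. geod b \<in> V \<inter> V'} \<inter> W. F b = ((\<lambda>q. op (h q) (k q)) \<circ> geod) b)"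
      by (intro exI conjI)
  qed
  moreover have "openin (top_of_set unit_tangent) {b \<in> unit_tangent. geod b \<in> V \<inter> V'}"
    unfolding e using V(3) V'(2) by (rule openin_Int)
  moreover have "V \<inter> V' \<subseteq> geodesics" "q \<in> V \<inter> V'" using V(1,2) V'(1) by auto
  ultimately show ?thesis unfolding geod_smooth_at_def by blast
qed

lemma geod_smooth_atI:
  assumes "a \<in> unit_tangent" "smooth_on UNIV F" "\<And>b. b \<in> unit_tangent \<Longrightarrow> h (geod b) = F b"
  shows "h \<in> geod_smooth_at (geod a)"
proof -
  have e: "{b \<in> unit_tangent. geod b \<in> geodesics} = unit_tangent" by (auto simp: geodesics_def)
  have "smooth_on_subset unit_tangent (h \<circ> geod)"
    unfolding smooth_on_subset_def using assms(2,3)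
    by (intro ballI exI[of _ UNIV] exI[of _ F]) auto
  moreover have "geod a \<in> geodesics" using assms(1) by (simp add: geodesics_def)
  ultimately show ?thesis
    unfolding geod_smooth_at_def
    by (intro CollectI exI[of _ geodesics]) (simp add: e)
qed

section \<open>The differential of the projection to geodesics\<close>

lemma has_real_derivative_along_curve:
  fixes H :: "'a::real_normed_vector \<Rightarrow> real"
  assumes "(H has_derivative D) (at (\<gamma> t) within S)" "(\<gamma> has_vector_derivative \<xi>) (at t)"
    and "open T" "t \<in> T" "\<And>s. s \<in> T \<Longrightarrow> \<gamma> s \<in> S"
  shows "((\<lambda>s. H (\<gamma> s)) has_real_derivative D \<xi>) (at t)"
proof -
  have \<gamma>: "(\<gamma> has_derivative (\<lambda>h. h *\<^sub>R \<xi>)) (at t within T)"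
    using assms(2) has_derivative_at_withinI unfolding has_vector_derivative_def by blast
  have "\<gamma> ` T \<subseteq> S" using assms(5) by blast
  then have "(H has_derivative D) (at (\<gamma> t) within \<gamma> ` T)"
    by (rule has_derivative_subset[OF assms(1)])
  from has_derivative_in_compose[OF \<gamma> this]
  have "((\<lambda>s. H (\<gamma> s)) has_derivative (\<lambda>h. D (h *\<^sub>R \<xi>))) (at t within T)" .
  moreover have "(\<lambda>h. D (h *\<^sub>R \<xi>)) = (*) (D \<xi>)"
    using linear_scale[OF has_derivative_linear[OF assms(1)]] by (auto simp: fun_eq_iff)
  ultimately show ?thesis
    unfolding has_field_derivative_def at_within_open[OF assms(4,3)] by simp
qed

lemma has_vector_derivative_flow: "((\<lambda>s. flow s a) has_vector_derivative chi a) (at 0)"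
proof -
  obtain x v where a: "a = (x, v)" by (cases a)
  have "((\<lambda>s. (cosh s *\<^sub>R x + sinh s *\<^sub>R v, sinh s *\<^sub>R x + cosh s *\<^sub>R v)) has_derivative
      (\<lambda>h. (h *\<^sub>R v, h *\<^sub>R x))) (at 0)"
    by (auto intro!: derivative_eq_intros has_derivative_Pair)
  then show ?thesis by (simp add: has_vector_derivative_def a flow_Pair chi_def)
qed

text \<open>The scalar factor is even in \<open>s\<close>, so its derivative at 0 vanishes:
  rescaling a line to keep it on a quadric does not change its initial velocity.\<close>

lemma has_vector_derivative_normalized_line:
  fixes x w :: "'a::real_normed_vector"
  shows "((\<lambda>s. (1 / sqrt (1 + s\<^sup>2 * c)) *\<^sub>R (x + s *\<^sub>R w)) has_vector_derivative w) (at 0)"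
proof -
  have "((\<lambda>s. 1 / sqrt (1 + s\<^sup>2 * c)) has_real_derivative 0) (at 0)"
    by (auto intro!: derivative_eq_intros)
  moreover have "((\<lambda>s. x + s *\<^sub>R w) has_vector_derivative w) (at 0)"
    by (auto intro!: derivative_eq_intros)
  ultimately show ?thesis
    using has_vector_derivative_scaleR by fastforce
qed

lemma has_vector_derivative_prod:
  assumes "(f has_vector_derivative f') (at t)" "(g has_vector_derivative g') (at t)"
  shows "((\<lambda>s. (f s, g s)) has_vector_derivative (f', g')) (at t)"
  using has_derivative_Pair assms unfolding has_vector_derivative_def by fastforce

text \<open>On the velocity of a curve inside \<open>unit_tangent\<close>, the chain rule determines
  the value of any derivative within that set. A flow line realises \<open>chi a\<close>, and
  normalised lines in the first or the second entry realise \<open>(w, 0)\<close> and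
  \<open>(0, u)\<close>; linearity does the rest.\<close>

lemma unit_tangent_derivative_unique:
  fixes H :: "'n::finite minkowski \<times> 'n minkowski \<Rightarrow> real"
  assumes a: "a \<in> unit_tangent" and \<xi>: "\<xi> \<in> unit_tangent_tangent a"
    and D: "(H has_derivative D1) (at a within unit_tangent)"
      "(H has_derivative D2) (at a within unit_tangent)"
  shows "D1 \<xi> = D2 \<xi>"
proof -
  obtain x v where xv: "a = (x, v)" by (cases a)
  note m = unit_tangentD[OF a[unfolded xv]]
  have curve: "D1 \<eta> = D2 \<eta>"
    if "(\<gamma> has_vector_derivative \<eta>) (at 0)" "open T" "0 \<in> T"
      "\<And>s. s \<in> T \<Longrightarrow> \<gamma> s \<in> unit_tangent" "\<gamma> 0 = a" for \<gamma> T \<eta>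
    using has_real_derivative_along_curve[OF D(1)[folded that(5)] that(1-4)]
      has_real_derivative_along_curve[OF D(2)[folded that(5)] that(1-4)]
    by (rule DERIV_unique)
  have 1: "D1 (chi a) = D2 (chi a)"
    by (rule curve[OF has_vector_derivative_flow, of UNIV]) (auto simp: flow_in_unit_tangent a flow_0)
  have 2: "D1 (w, 0) = D2 (w, 0)" if w: "w \<in> orth_space a" for w
  proof -
    \<comment> \<open>With this \<open>c\<close> the square of \<open>x + s *\<^sub>R w\<close> is
      \<open>- (1 + s\<^sup>2 * c)\<close>, so the factor
      \<open>1 / sqrt (1 + s\<^sup>2 * c)\<close> brings the line back to the hyperboloid.
      \<open>T\<close> keeps the radicand and the time component positive.\<close>
    define c where "c = - mink w w"
    have w': "mink x w = 0" "mink v w = 0" "mink w x = 0" "mink w v = 0"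
      using w mink_commute[of w] by (auto simp: xv orth_space_def)
    define T where "T = {s. 0 < 1 + s\<^sup>2 * c} \<inter> {s. 0 < x $ None + s * w $ None}"
    have "open T" unfolding T_def
      by (intro open_Int open_Collect_less continuous_intros)
    moreover have "((1 / sqrt (1 + s\<^sup>2 * c)) *\<^sub>R (x + s *\<^sub>R w), v) \<in> unit_tangent" if "s \<in> T" for s
    proof -
      have s: "0 < 1 + s\<^sup>2 * c" "0 < x $ None + s * w $ None" using that by (auto simp: T_def)
      have "mink (x + s *\<^sub>R w) (x + s *\<^sub>R w) = - (1 + s\<^sup>2 * c)"
        by (simp add: mink_simps m w' c_def power2_eq_square)
      then show ?thesis using s
        by (simp add: unit_tangent_def hyperbolic_space_def mink_simps(5,6) mink_simps(1) m w'
            power2_eq_square[symmetric] divide_simps)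
    qed
    ultimately show ?thesis
      by (intro curve[OF has_vector_derivative_prod[OF has_vector_derivative_normalized_line
          has_vector_derivative_const], of T]) (auto simp: T_def xv m)
  qed
  have 3: "D1 (0, u) = D2 (0, u)" if u: "u \<in> orth_space a" for u
  proof -
    \<comment> \<open>The sign is opposite to the horizontal case because \<open>v\<close> is
      spacelike and \<open>x\<close> timelike.\<close>
    define c where "c = mink u u"
    have u': "mink x u = 0" "mink v u = 0" "mink u x = 0" "mink u v = 0"
      using u mink_commute[of u] by (auto simp: xv orth_space_def)
    define T where "T = {s. 0 < 1 + s\<^sup>2 * c}"
    have "open T" unfolding T_def by (intro open_Collect_less continuous_intros)
    moreover have "(x, (1 / sqrt (1 + s\<^sup>2 * c)) *\<^sub>R (v + s *\<^sub>R u)) \<in> unit_tangent" if "s \<in> T" for s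
    proof -
      have s: "0 < 1 + s\<^sup>2 * c" using that by (auto simp: T_def)
      have "mink (v + s *\<^sub>R u) (v + s *\<^sub>R u) = 1 + s\<^sup>2 * c"
        by (simp add: mink_simps m u' c_def power2_eq_square)
      then show ?thesis using s
        by (simp add: unit_tangent_def hyperbolic_space_def mink_simps(5,6) mink_simps(2) m u'
            power2_eq_square[symmetric] divide_simps)
    qed
    ultimately show ?thesis
      by (intro curve[OF has_vector_derivative_prod[OF has_vector_derivative_const
          has_vector_derivative_normalized_line], of T]) (auto simp: T_def xv m)
  qed
  obtain c w u where e: "w \<in> orth_space a" "u \<in> orth_space a" "\<xi> = c *\<^sub>R chi a + (w, 0) + (0, u)"
    using \<xi> unfolding unit_tangent_tangent_def hor_lift_def ver_lift_def by blast
  note l = has_derivative_linear[OF D(1)] has_derivative_linear[OF D(2)]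
  show ?thesis
    unfolding e(3) linear_add[OF l(1)] linear_add[OF l(2)] linear_scale[OF l(1)] linear_scale[OF l(2)]
    by (simp add: 1 2[OF e(1)] 3[OF e(2)])
qed

text \<open>Evaluates the description in \<open>dgeod\<close> with whichever derivative within
  \<open>unit_tangent\<close> is at hand.\<close>

lemma dgeod_eq:
  assumes "a \<in> unit_tangent" "\<xi> \<in> unit_tangent_tangent a" "h \<in> geod_smooth_at (geod a)"
    and "((h \<circ> geod) has_derivative D) (at a within unit_tangent)"
  shows "dgeod a \<xi> h = D \<xi>"
proof -
  have "(THE d. \<exists>D. ((h \<circ> geod) has_derivative D) (at a within unit_tangent) \<and> d = D \<xi>) = D \<xi>"
    using assms(4) unit_tangent_derivative_unique[OF assms(1,2)] by (intro the_equality) blast+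
  then show ?thesis using assms(3) by (simp add: dgeod_def)
qed

lemma has_derivative_extension:
  assumes "open W" "a \<in> W" "smooth_on W F" "a \<in> unit_tangent"
    and "\<And>b. b \<in> unit_tangent \<inter> W \<Longrightarrow> F b = h (geod b)"
  shows "((h \<circ> geod) has_derivative frechet_derivative F (at a)) (at a within unit_tangent)"
proof (rule has_derivative_transform_eventually)
  show "(F has_derivative frechet_derivative F (at a)) (at a within unit_tangent)"
    by (rule has_derivative_at_withinI[OF smooth_on_has_derivative[OF assms(3,2)]])
  show "eventually (\<lambda>b. F b = (h \<circ> geod) b) (at a within unit_tangent)"
    unfolding eventually_at_topological using assms(1,2,5) by (intro exI[of _ W]) auto
  show "F a = (h \<circ> geod) a" using assms(2,4,5) by auto
qed (rule assms(4))

lemma geod_smooth_at_differentiable: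
  assumes "h \<in> geod_smooth_at (geod a)" "a \<in> unit_tangent"
  obtains D where "((h \<circ> geod) has_derivative D) (at a within unit_tangent)"
  using geod_smooth_at_extension[OF assms] has_derivative_extension[OF _ _ _ assms(2)] by metis

lemma dgeod_outside: "h \<notin> geod_smooth_at (geod a) \<Longrightarrow> dgeod a \<xi> h = 0"
  by (simp add: dgeod_def)

lemma unit_tangent_tangent_linear:
  assumes "\<xi> \<in> unit_tangent_tangent a" "\<eta> \<in> unit_tangent_tangent a"
  shows "r *\<^sub>R \<xi> + s *\<^sub>R \<eta> \<in> unit_tangent_tangent a"
proof -
  obtain c w u c' w' u' where e:
    "w \<in> orth_space a" "u \<in> orth_space a" "\<xi> = c *\<^sub>R chi a + hor_lift w + ver_lift u"
    "w' \<in> orth_space a" "u' \<in> orth_space a" "\<eta> = c' *\<^sub>R chi a + hor_lift w' + ver_lift u'"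
    using assms unfolding unit_tangent_tangent_def by blast
  have "r *\<^sub>R \<xi> + s *\<^sub>R \<eta> = (r * c + s * c') *\<^sub>R chi a + hor_lift (r *\<^sub>R w + s *\<^sub>R w')
      + ver_lift (r *\<^sub>R u + s *\<^sub>R u')"
    by (cases "chi a") (simp add: e hor_lift_def ver_lift_def algebra_simps)
  moreover have "r *\<^sub>R w + s *\<^sub>R w' \<in> orth_space a" "r *\<^sub>R u + s *\<^sub>R u' \<in> orth_space a"
    by (intro orth_space_add orth_space_scale e)+
  ultimately show ?thesis unfolding unit_tangent_tangent_def by blast
qed

lemma chi_tangent: "chi a \<in> unit_tangent_tangent a"
proof -
  have "0 \<in> orth_space a" by (cases a) (simp add: orth_space_def mink_simps)
  moreover have "chi a = 1 *\<^sub>R chi a + hor_lift 0 + ver_lift 0"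
    by (simp add: hor_lift_def ver_lift_def flip: zero_prod_def)
  ultimately show ?thesis unfolding unit_tangent_tangent_def by blast
qed

lemma chi_perp_tangent: "\<xi> \<in> chi_perp a \<Longrightarrow> \<xi> \<in> unit_tangent_tangent a"
  by (simp add: chi_perp_def)

lemma dgeod_linear:
  assumes "a \<in> unit_tangent" "\<xi> \<in> unit_tangent_tangent a" "\<eta> \<in> unit_tangent_tangent a"
  shows "dgeod a (r *\<^sub>R \<xi> + s *\<^sub>R \<eta>) h = r * dgeod a \<xi> h + s * dgeod a \<eta> h"
proof (cases "h \<in> geod_smooth_at (geod a)")
  case True
  obtain D where D: "((h \<circ> geod) has_derivative D) (at a within unit_tangent)"
    using geod_smooth_at_differentiable[OF True assms(1)] .
  note l = has_derivative_linear[OF D]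
  show ?thesis
    by (simp add: dgeod_eq[OF assms(1) _ True D] unit_tangent_tangent_linear assms
        linear_add[OF l] linear_scale[OF l])
qed (simp add: dgeod_outside)

text \<open>\<open>h \<circ> geod\<close> is constant along flow lines.\<close>

lemma dgeod_chi:
  assumes a: "a \<in> unit_tangent"
  shows "dgeod a (chi a) h = 0"
proof (cases "h \<in> geod_smooth_at (geod a)")
  case True
  obtain D where D: "((h \<circ> geod) has_derivative D) (at (flow 0 a) within unit_tangent)"
    using geod_smooth_at_differentiable[OF True a] unfolding flow_0 .
  have "((\<lambda>s. (h \<circ> geod) (flow s a)) has_real_derivative D (chi a)) (at 0)"
    by (rule has_real_derivative_along_curve[OF D has_vector_derivative_flow, of UNIV])
       (auto simp: flow_in_unit_tangent a)
  then have "((\<lambda>s. h (geod a)) has_real_derivative D (chi a)) (at 0)"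
    by (simp add: geod_flow)
  then have "D (chi a) = 0" using DERIV_const DERIV_unique by blast
  then show ?thesis using dgeod_eq[OF a chi_tangent True] D by (simp add: flow_0)
qed (simp add: dgeod_outside)

text \<open>The chain rule for the identity between \<open>geod\<close> and its composition with
  \<open>flow t\<close>.\<close>

lemma dgeod_flow:
  assumes a: "a \<in> unit_tangent" and \<xi>: "\<xi> \<in> chi_perp a"
  shows "dgeod (flow t a) (flow t \<xi>) = dgeod a \<xi>"
proof
  fix h
  show "dgeod (flow t a) (flow t \<xi>) h = dgeod a \<xi> h"
  proof (cases "h \<in> geod_smooth_at (geod a)")
    case True
    have True': "h \<in> geod_smooth_at (geod (flow t a))" using True by (simp add: geod_flow)
    note fa = flow_in_unit_tangent[OF a, of t]
    obtain D where D: "((h \<circ> geod) has_derivative D) (at (flow t a) within unit_tangent)"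
      using geod_smooth_at_differentiable[OF True' fa] .
    have "flow t ` unit_tangent \<subseteq> unit_tangent" using flow_in_unit_tangent by blast
    then have "((h \<circ> geod) has_derivative D) (at (flow t a) within flow t ` unit_tangent)"
      by (rule has_derivative_subset[OF D])
    from has_derivative_in_compose[OF bounded_linear_imp_has_derivative[OF bounded_linear_flow] this]
    have "((\<lambda>b. (h \<circ> geod) (flow t b)) has_derivative (\<lambda>\<eta>. D (flow t \<eta>))) (at a within unit_tangent)" .
    then have "((h \<circ> geod) has_derivative (\<lambda>\<eta>. D (flow t \<eta>))) (at a within unit_tangent)"
      by (simp add: geod_flow comp_def)
    then have "dgeod a \<xi> h = D (flow t \<xi>)"
      by (rule dgeod_eq[OF a chi_perp_tangent[OF \<xi>] True])
    moreover have "dgeod (flow t a) (flow t \<xi>) h = D (flow t \<xi>)"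
      by (rule dgeod_eq[OF fa chi_perp_tangent[OF flow_chi_perp[OF a \<xi>]] True' D])
    ultimately show ?thesis by simp
  qed (simp add: dgeod_outside geod_flow)
qed

text \<open>The bivector \<open>x \<and> v\<close> contracted with \<open>z\<close> and \<open>b\<close>. It is flow invariant, and these
  functions separate the tangent vectors of the space of geodesics.\<close>

definition wedge ::
  "'n::finite minkowski \<Rightarrow> 'n minkowski \<Rightarrow> 'n minkowski \<times> 'n minkowski \<Rightarrow> real" where
  "wedge z b a = mink (snd a) z * (fst a \<bullet> b) - mink (fst a) z * (snd a \<bullet> b)"

text \<open>The expression is alternating in the pair, and the flow acts on the pair by a matrix of
  determinant cosh^2 - sinh^2 = 1.\<close>

lemma wedge_flow: "wedge z b (flow t a) = wedge z b a"
proof -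
  obtain x v where a: "a = (x, v)" by (cases a)
  have "wedge z b (flow t a) = (cosh t * cosh t - sinh t * sinh t) * wedge z b a"
    by (simp add: a wedge_def flow_Pair mink_simps inner_simps algebra_simps)
  then show ?thesis by (simp add: cosh_sinh_real)
qed

lemma bounded_linear_mink_fst: "bounded_linear (\<lambda>a :: 'n::finite minkowski \<times> 'n minkowski. mink (fst a) z)"
  by (rule bounded_linear_compose[OF mink.bounded_linear_left bounded_linear_fst])

lemma bounded_linear_mink_snd: "bounded_linear (\<lambda>a :: 'n::finite minkowski \<times> 'n minkowski. mink (snd a) z)"
  by (rule bounded_linear_compose[OF mink.bounded_linear_left bounded_linear_snd])

lemma smooth_on_wedge: "smooth_on UNIV (wedge z b)"
proof -
  have "smooth_on UNIV (\<lambda>a. mink (snd a) z * (fst a \<bullet> b) + (- mink (fst a) z) * (snd a \<bullet> b))"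
    by (intro smooth_on_add smooth_on_mult smooth_on_linear open_UNIV bounded_linear_minus
        bounded_linear_mink_fst bounded_linear_mink_snd
        bounded_linear_compose[OF bounded_linear_inner_left bounded_linear_fst]
        bounded_linear_compose[OF bounded_linear_inner_left bounded_linear_snd])
  then show ?thesis by (simp add: wedge_def[abs_def])
qed

lemma has_derivative_wedge:
  "(wedge z b has_derivative (\<lambda>\<xi>. (mink (snd \<xi>) z *\<^sub>R x + mink v z *\<^sub>R fst \<xi>
      - mink (fst \<xi>) z *\<^sub>R v - mink x z *\<^sub>R snd \<xi>) \<bullet> b)) (at (x, v) within S)"
  unfolding wedge_def[abs_def]
  by (rule has_derivative_eq_rhs, (rule derivative_intros
      bounded_linear_imp_has_derivative bounded_linear_mink_fst bounded_linear_mink_snd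
      bounded_linear_compose[OF bounded_linear_inner_left bounded_linear_fst]
      bounded_linear_compose[OF bounded_linear_inner_left bounded_linear_snd])+)
     (simp add: fun_eq_iff inner_simps algebra_simps)

text \<open>The derivatives of the functions \<open>wedge z b\<close> for varying \<open>b\<close>
  are the coordinates of the vector \<open>\<Phi> z \<xi>\<close>. For \<open>z = x\<close> this
  vector is the vertical part of \<xi> and for \<open>z = v\<close> the horizontal part, as the
  other products that occur vanish.\<close>

lemma dgeod_inject:
  assumes a: "a \<in> unit_tangent" and \<xi>: "\<xi> \<in> chi_perp a" and \<eta>: "\<eta> \<in> chi_perp a"
    and eq: "dgeod a \<xi> = dgeod a \<eta>"
  shows "\<xi> = \<eta>"
proof -
  obtain x v where xv: "a = (x, v)" by (cases a)
  note m = unit_tangentD[OF a[unfolded xv]]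
  obtain w u w' u' where p: "\<xi> = (w, u)" "\<eta> = (w', u')" by (cases \<xi>, cases \<eta>)
  have o: "w \<in> orth_space a" "u \<in> orth_space a" "w' \<in> orth_space a" "u' \<in> orth_space a"
    using \<xi> \<eta> a by (auto simp: chi_perp_eq p)
  have o': "mink w x = 0" "mink w v = 0" "mink u x = 0" "mink u v = 0"
    "mink w' x = 0" "mink w' v = 0" "mink u' x = 0" "mink u' v = 0"
    using o by (auto simp: xv orth_space_def mink_commute)
  define \<Phi> where "\<Phi> z \<xi> = mink (snd \<xi>) z *\<^sub>R x + mink v z *\<^sub>R fst \<xi>
      - mink (fst \<xi>) z *\<^sub>R v - mink x z *\<^sub>R snd \<xi>" for z \<xi>
  have "\<Phi> z \<xi> \<bullet> b = \<Phi> z \<eta> \<bullet> b" for z b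
  proof -
    \<comment> \<open>\<open>wedge z b\<close> descended to geodesics through an arbitrary
      representative; flow invariance makes the choice immaterial.\<close>
    define h where "h q = wedge z b (SOME c. geod c = q)" for q
    have h: "h (geod c) = wedge z b c" for c
    proof -
      have "geod (SOME d. geod d = geod c) = geod c" by (rule someI) simp
      then obtain t where "c = flow t (SOME d. geod d = geod c)" using geod_eq_iff by metis
      then show ?thesis unfolding h_def by (metis wedge_flow)
    qed
    have in_C: "h \<in> geod_smooth_at (geod a)"
      by (rule geod_smooth_atI[OF a smooth_on_wedge h])
    have "h \<circ> geod = wedge z b" using h by (simp add: fun_eq_iff)
    then have D: "((h \<circ> geod) has_derivative (\<lambda>\<xi>. \<Phi> z \<xi> \<bullet> b)) (at a within unit_tangent)"
      unfolding xv \<Phi>_def by (simp add: has_derivative_wedge)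
    show ?thesis
      using dgeod_eq[OF a chi_perp_tangent[OF \<xi>] in_C D]
        dgeod_eq[OF a chi_perp_tangent[OF \<eta>] in_C D] eq by simp
  qed
  then have "\<Phi> z \<xi> = \<Phi> z \<eta>" for z by (rule euclidean_eqI)
  from this[of x] this[of v] show ?thesis
    by (simp add: \<Phi>_def p o' m)
qed

text \<open>Two representatives of a geodesic differ by one flow time, and injectivity on
  \<open>chi_perp\<close> forces vectors with the same image to correspond under that same flow map.
  Hence \<open>geod_metric\<close> and \<open>geod_J\<close> are well defined.\<close>

lemma dgeod_eqD:
  assumes a: "a \<in> unit_tangent" and a': "a' \<in> unit_tangent" "geod a' = geod a"
  obtains t where "a' = flow t a"
    "\<And>\<xi> \<xi>'. \<xi> \<in> chi_perp a \<Longrightarrow> \<xi>' \<in> chi_perp a' \<Longrightarrow> dgeod a' \<xi>' = dgeod a \<xi> \<Longrightarrow> \<xi>' = flow t \<xi>"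
proof -
  obtain t where t: "a' = flow t a" using a'(2) geod_eq_iff by metis
  have "\<xi>' = flow t \<xi>" if "\<xi> \<in> chi_perp a" "\<xi>' \<in> chi_perp a'" "dgeod a' \<xi>' = dgeod a \<xi>" for \<xi> \<xi>'
    using that flow_chi_perp[OF a that(1), of t] dgeod_flow[OF a that(1), of t]
    by (intro dgeod_inject[OF a'(1)]) (simp_all add: t)
  with t show thesis by (rule that)
qed

lemma geod_metric_eq:
  assumes a: "a \<in> unit_tangent" and \<xi>: "\<xi> \<in> chi_perp a" and \<eta>: "\<eta> \<in> chi_perp a"
  shows "geod_metric (geod a) (dgeod a \<xi>) (dgeod a \<eta>) = para_sasaki a \<xi> \<eta>"
  unfolding geod_metric_def
proof (rule the_equality)
  fix r
  assume "\<exists>a'\<in>unit_tangent. geod a' = geod a \<and> (\<exists>\<xi>'\<in>chi_perp a'. \<exists>\<eta>'\<in>chi_perp a'.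
      dgeod a' \<xi>' = dgeod a \<xi> \<and> dgeod a' \<eta>' = dgeod a \<eta> \<and> r = para_sasaki a' \<xi>' \<eta>')"
  then obtain a' \<xi>' \<eta>' where a': "a' \<in> unit_tangent" "geod a' = geod a" "\<xi>' \<in> chi_perp a'"
    "\<eta>' \<in> chi_perp a'" "dgeod a' \<xi>' = dgeod a \<xi>" "dgeod a' \<eta>' = dgeod a \<eta>"
    and r: "r = para_sasaki a' \<xi>' \<eta>'" by blast
  obtain t where "a' = flow t a" "\<xi>' = flow t \<xi>" "\<eta>' = flow t \<eta>"
    using dgeod_eqD[OF a a'(1,2)] \<xi> \<eta> a'(3-6) by metis
  with r show "r = para_sasaki a \<xi> \<eta>" using para_sasaki_flow[OF a \<xi> \<eta>] by simp
qed (use assms in blast)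

lemma geod_J_eq:
  assumes a: "a \<in> unit_tangent" and \<xi>: "\<xi> \<in> chi_perp a"
  shows "geod_J (geod a) (dgeod a \<xi>) = dgeod a (para_J a \<xi>)"
  unfolding geod_J_def
proof (rule the_equality)
  fix Y
  assume "\<exists>a'\<in>unit_tangent. geod a' = geod a \<and> (\<exists>\<xi>'\<in>chi_perp a'.
      dgeod a' \<xi>' = dgeod a \<xi> \<and> Y = dgeod a' (para_J a' \<xi>'))"
  then obtain a' \<xi>' where a': "a' \<in> unit_tangent" "geod a' = geod a" "\<xi>' \<in> chi_perp a'"
    "dgeod a' \<xi>' = dgeod a \<xi>" and Y: "Y = dgeod a' (para_J a' \<xi>')" by blast
  obtain t where "a' = flow t a" "\<xi>' = flow t \<xi>"
    using dgeod_eqD[OF a a'(1,2)] \<xi> a'(3,4) by metis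
  moreover have "para_J a \<xi> \<in> chi_perp a"
    using \<xi> a by (auto simp: chi_perp_eq para_J_chi_perp)
  ultimately show "Y = dgeod a (para_J a \<xi>)"
    using Y para_J_flow[OF a \<xi>] dgeod_flow[OF a] by simp
qed (use assms in blast)

lemma dgeod_in_tangent_space:
  assumes a: "a \<in> unit_tangent" and \<xi>: "\<xi> \<in> unit_tangent_tangent a"
  shows "dgeod a \<xi> \<in> tangent_space geod_smooth_at (geod a)"
proof -
  let ?C = "geod_smooth_at (geod a)"
  have const: "(\<lambda>q. c) \<in> ?C" for c
    by (rule geod_smooth_atI[OF a smooth_on_const[OF open_UNIV]]) simp
  have add: "(\<lambda>q. h q + k q) \<in> ?C" and mult: "(\<lambda>q. h q * k q) \<in> ?C" if "h \<in> ?C" "k \<in> ?C" for h k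
    using that by (auto intro: geod_smooth_at_combine[where op="(+)"]
        geod_smooth_at_combine[where op="(*)"] smooth_on_add smooth_on_mult)
  have "dgeod a \<xi> (\<lambda>q. h q + k q) = dgeod a \<xi> h + dgeod a \<xi> k \<and>
      dgeod a \<xi> (\<lambda>q. h q * k q) = dgeod a \<xi> h * k (geod a) + h (geod a) * dgeod a \<xi> k"
    if h: "h \<in> ?C" and k: "k \<in> ?C" for h k
  proof -
    obtain D where D: "((h \<circ> geod) has_derivative D) (at a within unit_tangent)"
      using geod_smooth_at_differentiable[OF h a] .
    obtain E where E: "((k \<circ> geod) has_derivative E) (at a within unit_tangent)"
      using geod_smooth_at_differentiable[OF k a] .
    have "(((\<lambda>q. h q + k q) \<circ> geod) has_derivative (\<lambda>\<xi>. D \<xi> + E \<xi>)) (at a within unit_tangent)"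
      using has_derivative_add[OF D E] by (simp add: comp_def)
    moreover have "(((\<lambda>q. h q * k q) \<circ> geod) has_derivative
        (\<lambda>\<xi>. h (geod a) * E \<xi> + D \<xi> * k (geod a))) (at a within unit_tangent)"
      using has_derivative_mult[OF D E] by (simp add: comp_def)
    ultimately show ?thesis
      using dgeod_eq[OF a \<xi> add[OF h k]] dgeod_eq[OF a \<xi> mult[OF h k]]
        dgeod_eq[OF a \<xi> h D] dgeod_eq[OF a \<xi> k E] by simp
  qed
  moreover have "dgeod a \<xi> (\<lambda>q. c * h q) = c * dgeod a \<xi> h" if h: "h \<in> ?C" for h c
  proof -
    obtain D where D: "((h \<circ> geod) has_derivative D) (at a within unit_tangent)"
      using geod_smooth_at_differentiable[OF h a] .
    have "(((\<lambda>q. c * h q) \<circ> geod) has_derivative (\<lambda>\<xi>. c * D \<xi>)) (at a within unit_tangent)"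
      using has_derivative_mult_right[OF D] by (simp add: comp_def)
    then show ?thesis
      using dgeod_eq[OF a \<xi> mult[OF const h]] dgeod_eq[OF a \<xi> h D] by simp
  qed
  ultimately show ?thesis
    unfolding tangent_space_def using dgeod_outside by blast
qed

text \<open>For a curve that stays in \<open>unit_tangent\<close>, a derivative of
  \<open>h \<circ> geod\<close> within that set is enough for the chain rule.\<close>

lemma has_velocity_geod:
  assumes \<gamma>: "(\<gamma> has_vector_derivative \<xi>) (at t)" "open T" "t \<in> T"
      "\<And>s. s \<in> T \<Longrightarrow> \<gamma> s \<in> unit_tangent"
    and \<xi>: "\<xi> \<in> unit_tangent_tangent (\<gamma> t)"
  shows "has_velocity geod_smooth_at (\<lambda>s. geod (\<gamma> s)) (dgeod (\<gamma> t) \<xi>) t"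
  unfolding has_velocity_def
proof (intro conjI ballI)
  have a: "\<gamma> t \<in> unit_tangent" using \<gamma>(3,4) by blast
  show "dgeod (\<gamma> t) \<xi> \<in> tangent_space geod_smooth_at (geod (\<gamma> t))"
    by (rule dgeod_in_tangent_space[OF a \<xi>])
  fix h assume h: "h \<in> geod_smooth_at (geod (\<gamma> t))"
  obtain D where D: "((h \<circ> geod) has_derivative D) (at (\<gamma> t) within unit_tangent)"
    using geod_smooth_at_differentiable[OF h a] .
  have "((\<lambda>s. (h \<circ> geod) (\<gamma> s)) has_real_derivative D \<xi>) (at t)"
    by (rule has_real_derivative_along_curve[OF D \<gamma>])
  then show "((\<lambda>s. h (geod (\<gamma> s))) has_real_derivative dgeod (\<gamma> t) \<xi> h) (at t)"
    by (simp add: dgeod_eq[OF a \<xi> h D])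
qed

section \<open>Tangent vectors of manifolds in a chart\<close>

lemma smooth_manifold_chart:
  assumes "smooth_manifold X A" "(U, \<phi>) \<in> A"
  shows "openin X U" "open (\<phi> ` U)" "homeomorphic_map (subtopology X U) (top_of_set (\<phi> ` U)) \<phi>"
    "inj_on \<phi> U" "U \<subseteq> topspace X"
proof -
  show 1: "openin X U" "open (\<phi> ` U)" "homeomorphic_map (subtopology X U) (top_of_set (\<phi> ` U)) \<phi>"
    using assms unfolding smooth_manifold_def by blast+
  show 2: "U \<subseteq> topspace X" using 1(1) by (rule openin_subset)
  show "inj_on \<phi> U"
    using homeomorphic_imp_injective_map[OF 1(3)] 2 by (simp add: inf.absorb2)
qed

lemma smooth_manifold_chart_exists:
  assumes "smooth_manifold X A" "p \<in> topspace X"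
  obtains U \<phi> where "(U, \<phi>) \<in> A" "p \<in> U"
  using assms unfolding smooth_manifold_def by blast

text \<open>\<open>smooth_at\<close> provides smoothness in some chart \<psi> at \<open>p\<close>;
  the transition map \<tau> carries it to the prescribed chart, on the preimage of \<open>W\<close>
  under \<tau>.\<close>

lemma smooth_at_chart:
  assumes M: "smooth_manifold X A" and U: "(U, \<phi>) \<in> A" "p \<in> U" and h: "h \<in> smooth_at A p"
  obtains W where "open W" "\<phi> p \<in> W" "W \<subseteq> \<phi> ` U" "smooth_on W (h \<circ> inv_into U \<phi>)"
proof -
  obtain V \<psi> W where V: "(V, \<psi>) \<in> A" "p \<in> V" and W: "open W" "\<psi> p \<in> W" "W \<subseteq> \<psi> ` V"
    "smooth_on W (h \<circ> inv_into V \<psi>)"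
    using h unfolding smooth_at_def by blast
  note cU = smooth_manifold_chart[OF M U(1)] and cV = smooth_manifold_chart[OF M V(1)]
  define \<tau> where "\<tau> = \<psi> \<circ> inv_into U \<phi>"
  have \<tau>: "smooth_on (\<phi> ` (U \<inter> V)) \<tau>"
    using M U(1) V(1) unfolding smooth_manifold_def \<tau>_def by blast
  have "openin (subtopology X U) (U \<inter> V)"
    using cV(1) by (metis inf_commute openin_subtopology_Int)
  then have "openin (top_of_set (\<phi> ` U)) (\<phi> ` (U \<inter> V))"
    using homeomorphic_map_openness_eq[OF cU(3)] by blast
  then have o: "open (\<phi> ` (U \<inter> V))" using cU(2) openin_open_eq by blast
  define W' where "W' = \<phi> ` (U \<inter> V) \<inter> \<tau> -` W"
  have "open W'" unfolding W'_def
    using continuous_open_preimage[OF smooth_on_continuous_on[OF \<tau>] o W(1)] .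
  moreover have "\<phi> p \<in> W'"
    using U(2) V(2) W(2) cU(4) by (simp add: W'_def \<tau>_def)
  moreover have "W' \<subseteq> \<phi> ` U" by (auto simp: W'_def)
  moreover have "smooth_on W' (h \<circ> inv_into U \<phi>)"
  proof (rule smooth_on_cong)
    show "smooth_on W' (\<lambda>y. (h \<circ> inv_into V \<psi>) (\<tau> y))"
      by (rule smooth_on_compose[OF \<open>open W'\<close> W(1) _ smooth_on_mono[OF \<tau>] W(4)])
         (auto simp: W'_def)
    show "(h \<circ> inv_into V \<psi>) (\<tau> y) = (h \<circ> inv_into U \<phi>) y" if "y \<in> W'" for y
      using that cU(4) cV(4) by (auto simp: W'_def \<tau>_def)
  qed (rule \<open>open W'\<close>)
  ultimately show thesis by (rule that)
qed

lemma smooth_atI: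
  assumes "(U, \<phi>) \<in> A" "p \<in> U" "open W" "\<phi> p \<in> W" "W \<subseteq> \<phi> ` U" "smooth_on W (h \<circ> inv_into U \<phi>)"
  shows "h \<in> smooth_at A p"
  using assms unfolding smooth_at_def by blast

lemma smooth_at_combine:
  fixes op :: "real \<Rightarrow> real \<Rightarrow> real" and A :: "('m, 'e::euclidean_space) atlas"
  assumes M: "smooth_manifold X A" and p: "p \<in> topspace X"
    and op: "\<And>W F G. open (W :: 'e set) \<Longrightarrow> smooth_on W F \<Longrightarrow> smooth_on W G
      \<Longrightarrow> smooth_on W (\<lambda>b. op (F b) (G b))"
    and h: "h \<in> smooth_at A p" and k: "k \<in> smooth_at A p"
  shows "(\<lambda>q. op (h q) (k q)) \<in> smooth_at A p"
proof -
  obtain U \<phi> where U: "(U, \<phi>) \<in> A" "p \<in> U"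
    using smooth_manifold_chart_exists[OF M p] .
  obtain W where W: "open W" "\<phi> p \<in> W" "W \<subseteq> \<phi> ` U" "smooth_on W (h \<circ> inv_into U \<phi>)"
    using smooth_at_chart[OF M U h] .
  obtain W' where W': "open W'" "\<phi> p \<in> W'" "W' \<subseteq> \<phi> ` U" "smooth_on W' (k \<circ> inv_into U \<phi>)"
    using smooth_at_chart[OF M U k] .
  have "smooth_on (W \<inter> W') (\<lambda>y. op ((h \<circ> inv_into U \<phi>) y) ((k \<circ> inv_into U \<phi>) y))"
    by (intro op open_Int W(1) W'(1) smooth_on_mono[OF W(4)] smooth_on_mono[OF W'(4)]) auto
  then show ?thesis
    by (intro smooth_atI[OF U, of "W \<inter> W'"]) (use W W' in \<open>auto simp: comp_def\<close>)
qed

lemma smooth_at_const: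
  assumes M: "smooth_manifold X A" and p: "p \<in> topspace X"
  shows "(\<lambda>q. c) \<in> smooth_at A p"
proof -
  obtain U \<phi> where U: "(U, \<phi>) \<in> A" "p \<in> U"
    using smooth_manifold_chart_exists[OF M p] .
  show ?thesis
    by (intro smooth_atI[OF U smooth_manifold_chart(2)[OF M U(1)]])
       (use U smooth_on_const[OF smooth_manifold_chart(2)[OF M U(1)]] in \<open>auto simp: comp_def\<close>)
qed

lemma smooth_at_add:
  assumes "smooth_manifold X A" "p \<in> topspace X" "h \<in> smooth_at A p" "k \<in> smooth_at A p"
  shows "(\<lambda>q. h q + k q) \<in> smooth_at A p"
  by (rule smooth_at_combine[where op="(+)", OF assms(1,2) _ assms(3,4)]) (rule smooth_on_add)

lemma smooth_at_mult:
  assumes "smooth_manifold X A" "p \<in> topspace X" "h \<in> smooth_at A p" "k \<in> smooth_at A p"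
  shows "(\<lambda>q. h q * k q) \<in> smooth_at A p"
  by (rule smooth_at_combine[where op="(*)", OF assms(1,2) _ assms(3,4)]) (rule smooth_on_mult)

lemma smooth_map_smooth_at:
  assumes M: "smooth_manifold X A" and p: "p \<in> topspace X" and F: "smooth_map A F"
    and L: "bounded_linear L"
  shows "(\<lambda>q. L (F q)) \<in> smooth_at A p"
proof -
  obtain U \<phi> where U: "(U, \<phi>) \<in> A" "p \<in> U"
    using smooth_manifold_chart_exists[OF M p] .
  note o = smooth_manifold_chart(2)[OF M U(1)]
  have "smooth_on (\<phi> ` U) (\<lambda>y. L ((F \<circ> inv_into U \<phi>) y))"
    using F U(1) unfolding smooth_map_def by (intro smooth_on_bounded_linear[OF o L]) blast
  then show ?thesis
    by (intro smooth_atI[OF U o]) (use U in \<open>auto simp: comp_def\<close>)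
qed

subsection \<open>Derivations\<close>

lemma tangent_space_simps:
  assumes "D \<in> tangent_space C p"
  shows "h \<notin> C p \<Longrightarrow> D h = 0"
    "h \<in> C p \<Longrightarrow> k \<in> C p \<Longrightarrow> D (\<lambda>q. h q + k q) = D h + D k"
    "h \<in> C p \<Longrightarrow> D (\<lambda>q. c * h q) = c * D h"
    "h \<in> C p \<Longrightarrow> k \<in> C p \<Longrightarrow> D (\<lambda>q. h q * k q) = D h * k p + h p * D k"
  using assms unfolding tangent_space_def by blast+

text \<open>Since \<open>h\<close> is arbitrary outside \<open>topspace X\<close>, the usual
  argument for constants is run with the indicator \<open>e\<close> of \<open>topspace X\<close>:
  \<open>e * e = e\<close> gives \<open>D e = 0\<close>, and then \<open>h * e = c * e\<close> gives
  \<open>D h = 0\<close>.\<close>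

lemma tangent_space_germ:
  assumes M: "smooth_manifold X A" and p: "p \<in> topspace X"
    and D: "D \<in> tangent_space (smooth_at A) p"
    and h: "h \<in> smooth_at A p" and eq: "\<And>q. q \<in> topspace X \<Longrightarrow> h q = c"
  shows "D h = 0"
proof -
  note const = smooth_at_const[OF M p] and mult = smooth_at_mult[OF M p] and ts = tangent_space_simps[OF D]
  define e where "e q = (if q \<in> topspace X then 1 else 0 :: real)" for q
  obtain U \<phi> where U: "(U, \<phi>) \<in> A" "p \<in> U"
    using smooth_manifold_chart_exists[OF M p] .
  note cU = smooth_manifold_chart[OF M U(1)]
  have "smooth_on (\<phi> ` U) (e \<circ> inv_into U \<phi>)"
    by (rule smooth_on_cong[OF cU(2) _ smooth_on_const[OF cU(2), of 1]])
       (use cU(4,5) in \<open>auto simp: e_def\<close>)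
  then have e: "e \<in> smooth_at A p"
    by (intro smooth_atI[OF U cU(2)]) (use U in auto)
  have 0: "D (\<lambda>q. c' * e q) = c' * D e" "D (\<lambda>q. h q * e q) = D h * e p + h p * D e" for c'
    using ts e h by blast+
  have "(\<lambda>q. h q * e q) = (\<lambda>q. c * e q)" using eq by (auto simp: e_def)
  with 0 have 1: "D h * e p + h p * D e = c * D e" by metis
  have "D (\<lambda>q. e q * e q) = D e * e p + e p * D e" by (rule ts(4)[OF e e])
  moreover have "(\<lambda>q. e q * e q) = e" by (auto simp: e_def)
  ultimately have "D e = 0" using p by (simp add: e_def)
  with 1 p show ?thesis by (simp add: e_def)
qed

lemma tangent_space_sum:
  assumes M: "smooth_manifold X A" and p: "p \<in> topspace X"
    and D: "D \<in> tangent_space (smooth_at A) p" and "finite I"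
    and h: "\<And>i. i \<in> I \<Longrightarrow> h i \<in> smooth_at A p"
  shows "(\<lambda>q. \<Sum>i\<in>I. h i q) \<in> smooth_at A p \<and> D (\<lambda>q. \<Sum>i\<in>I. h i q) = (\<Sum>i\<in>I. D (h i))"
  using assms(4) h
proof (induction I rule: finite_induct)
  case empty
  show ?case
    using smooth_at_const[OF M p, of 0] tangent_space_simps(3)[OF D, of "\<lambda>q. 0" 0] by simp
next
  case (insert i I)
  then have "h i \<in> smooth_at A p" "(\<lambda>q. \<Sum>i\<in>I. h i q) \<in> smooth_at A p"
    "D (\<lambda>q. \<Sum>i\<in>I. h i q) = (\<Sum>i\<in>I. D (h i))" by auto
  with insert.hyps show ?case
    using smooth_at_add[OF M p, of "h i" "\<lambda>q. \<Sum>i\<in>I. h i q"]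
      tangent_space_simps(2)[OF D, of "h i" "\<lambda>q. \<Sum>i\<in>I. h i q"] by simp
qed

lemma differential_nth:
  fixes F :: "'m \<Rightarrow> real ^ 'k"
  shows "differential F D $ i = D (\<lambda>q. F q $ i)"
proof -
  have "differential F D $ i = (\<Sum>b\<in>Basis. D (\<lambda>q. F q \<bullet> b) * (if b = axis i 1 then 1 else 0))"
    unfolding differential_def
    by (auto simp: Basis_vec_def axis_def intro!: sum.cong)
       (metis axis_eq_axis axis_def zero_neq_one)
  also have "\<dots> = (\<Sum>b\<in>{axis i 1}. D (\<lambda>q. F q \<bullet> b))"
    by (intro sum.mono_neutral_cong_right) (auto simp: axis_in_Basis_iff)
  finally show ?thesis by (simp add: inner_axis)
qed

lemma tangent_space_mink:
  fixes F :: "'m \<Rightarrow> 'n::finite minkowski"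
  assumes M: "smooth_manifold X A" and p: "p \<in> topspace X"
    and D: "D \<in> tangent_space (smooth_at A) p" and F: "smooth_map A F"
    and c: "\<And>q. q \<in> topspace X \<Longrightarrow> mink (F q) (F q) = c"
  shows "mink (F p) (differential F D) = 0"
proof -
  have Fi: "(\<lambda>q. F q $ i) \<in> smooth_at A p" for i
    by (rule smooth_map_smooth_at[OF M p F bounded_linear_vec_nth])
  \<comment> \<open>The signs of the form, which turn it into a single sum over all
    coordinates.\<close>
  define s :: "'n option option \<Rightarrow> real" where "s i = (if i = None then -1 else 1)" for i
  have m: "mink x y = (\<Sum>i\<in>UNIV. s i * (x $ i * y $ i))" for x y :: "'n minkowski"
  proof -
    have "(\<Sum>i\<in>UNIV. s i * (x $ i * y $ i))
        = (\<Sum>i\<in>insert None (range Some). s i * (x $ i * y $ i))"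
      by (simp only: UNIV_option_conv)
    also have "\<dots> = mink x y"
      by (subst sum.insert) (auto simp: mink_def s_def sum.reindex)
    finally show ?thesis by simp
  qed
  have sq: "(\<lambda>q. s i * (F q $ i * F q $ i)) \<in> smooth_at A p"
    "D (\<lambda>q. s i * (F q $ i * F q $ i)) = 2 * (s i * (F p $ i * differential F D $ i))" for i
  proof -
    have sq: "(\<lambda>q. F q $ i * F q $ i) \<in> smooth_at A p"
      by (rule smooth_at_mult[OF M p Fi Fi])
    show "(\<lambda>q. s i * (F q $ i * F q $ i)) \<in> smooth_at A p"
      by (rule smooth_at_mult[OF M p smooth_at_const[OF M p] sq])
    have "D (\<lambda>q. s i * (F q $ i * F q $ i)) = s i * D (\<lambda>q. F q $ i * F q $ i)"
      by (rule tangent_space_simps(3)[where C="smooth_at A", OF D sq])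
    also have "D (\<lambda>q. F q $ i * F q $ i) = D (\<lambda>q. F q $ i) * F p $ i + F p $ i * D (\<lambda>q. F q $ i)"
      by (rule tangent_space_simps(4)[where C="smooth_at A", OF D Fi Fi])
    finally show "D (\<lambda>q. s i * (F q $ i * F q $ i)) = 2 * (s i * (F p $ i * differential F D $ i))"
      by (simp add: differential_nth)
  qed
  have "(\<lambda>q. mink (F q) (F q)) \<in> smooth_at A p \<and>
      D (\<lambda>q. mink (F q) (F q)) = (\<Sum>i\<in>UNIV. 2 * (s i * (F p $ i * differential F D $ i)))"
    unfolding m sq(2)[symmetric] by (rule tangent_space_sum[OF M p D]) (simp_all add: sq(1))
  then have "D (\<lambda>q. mink (F q) (F q)) = 2 * mink (F p) (differential F D)"
    and "(\<lambda>q. mink (F q) (F q)) \<in> smooth_at A p"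
    unfolding m[of "F p" "differential F D"] sum_distrib_left by auto
  with tangent_space_germ[OF M p D _ c] show ?thesis by simp
qed

subsection \<open>Coordinate derivations\<close>

text \<open>The value 0 off \<open>smooth_at A p\<close> matches the normalisation in
  \<open>tangent_space\<close>, where equality of tangent vectors is equality of functions.\<close>

definition chart_deriv ::
  "('m, 'e::euclidean_space) atlas \<Rightarrow> 'm set \<Rightarrow> ('m \<Rightarrow> 'e) \<Rightarrow> 'm \<Rightarrow> 'e \<Rightarrow> ('m \<Rightarrow> real) \<Rightarrow> real" where
  "chart_deriv A U \<phi> p c h =
     (if h \<in> smooth_at A p then frechet_derivative (h \<circ> inv_into U \<phi>) (at (\<phi> p)) c else 0)"

lemma smooth_at_has_derivative:
  assumes "smooth_manifold X A" "(U, \<phi>) \<in> A" "p \<in> U" "h \<in> smooth_at A p"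
  shows "((h \<circ> inv_into U \<phi>) has_derivative (\<lambda>c. chart_deriv A U \<phi> p c h)) (at (\<phi> p))"
proof -
  obtain W where W: "open W" "\<phi> p \<in> W" "W \<subseteq> \<phi> ` U" "smooth_on W (h \<circ> inv_into U \<phi>)"
    using smooth_at_chart[OF assms] .
  then show ?thesis
    using smooth_on_has_derivative[OF W(4,2)] assms(4) by (simp add: chart_deriv_def[abs_def])
qed

lemma chart_deriv_eq:
  assumes "((h \<circ> inv_into U \<phi>) has_derivative D) (at (\<phi> p))" "h \<in> smooth_at A p"
  shows "chart_deriv A U \<phi> p c h = D c"
  using frechet_derivative_at[OF assms(1)] assms(2) by (simp add: chart_deriv_def)

lemma chart_deriv_in_tangent_space:
  assumes M: "smooth_manifold X A" and U: "(U, \<phi>) \<in> A" "p \<in> U"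
  shows "chart_deriv A U \<phi> p c \<in> tangent_space (smooth_at A) p"
proof -
  have p: "p \<in> topspace X" using smooth_manifold_chart(5)[OF M U(1)] U(2) by blast
  have ip: "inv_into U \<phi> (\<phi> p) = p" using smooth_manifold_chart(4)[OF M U(1)] U(2) by simp
  note der = smooth_at_has_derivative[OF M U]
  let ?C = "smooth_at A p"
  have "chart_deriv A U \<phi> p c (\<lambda>q. h q + k q) = chart_deriv A U \<phi> p c h + chart_deriv A U \<phi> p c k"
    if h: "h \<in> ?C" and k: "k \<in> ?C" for h k
    using has_derivative_add[OF der[OF h] der[OF k]] smooth_at_add[OF M p h k]
    by (intro chart_deriv_eq) (simp_all add: comp_def)
  moreover have "chart_deriv A U \<phi> p c (\<lambda>q. r * h q) = r * chart_deriv A U \<phi> p c h"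
    if h: "h \<in> ?C" for h r
    using has_derivative_mult_right[OF der[OF h], of r]
      smooth_at_mult[OF M p smooth_at_const[OF M p, of r] h]
    by (intro chart_deriv_eq) (simp_all add: comp_def)
  moreover have "chart_deriv A U \<phi> p c (\<lambda>q. h q * k q)
      = chart_deriv A U \<phi> p c h * k p + h p * chart_deriv A U \<phi> p c k"
    if h: "h \<in> ?C" and k: "k \<in> ?C" for h k
  proof -
    have "chart_deriv A U \<phi> p c (\<lambda>q. h q * k q)
        = h p * chart_deriv A U \<phi> p c k + chart_deriv A U \<phi> p c h * k p"
      using has_derivative_mult[OF der[OF h] der[OF k]] smooth_at_mult[OF M p h k]
      by (intro chart_deriv_eq) (simp_all add: comp_def ip)
    then show ?thesis by simp
  qed
  moreover have "chart_deriv A U \<phi> p c h = 0" if "h \<notin> ?C" for h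
    using that by (simp add: chart_deriv_def)
  ultimately show ?thesis unfolding tangent_space_def by blast
qed

lemma differential_chart_deriv:
  assumes M: "smooth_manifold X A" and U: "(U, \<phi>) \<in> A" "p \<in> U" and F: "smooth_map A F"
  shows "differential F (chart_deriv A U \<phi> p c) = frechet_derivative (F \<circ> inv_into U \<phi>) (at (\<phi> p)) c"
proof -
  have p: "p \<in> topspace X" using smooth_manifold_chart(5)[OF M U(1)] U(2) by blast
  have "smooth_on (\<phi> ` U) (F \<circ> inv_into U \<phi>)" using F U(1) unfolding smooth_map_def by blast
  then have der: "((F \<circ> inv_into U \<phi>) has_derivative frechet_derivative (F \<circ> inv_into U \<phi>) (at (\<phi> p))) (at (\<phi> p))"
    using U(2) by (intro smooth_on_has_derivative) auto
  have "chart_deriv A U \<phi> p c (\<lambda>q. F q \<bullet> b) = frechet_derivative (F \<circ> inv_into U \<phi>) (at (\<phi> p)) c \<bullet> b" for b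
    using has_derivative_inner_left[OF der, of b]
      smooth_map_smooth_at[OF M p F bounded_linear_inner_left]
    by (intro chart_deriv_eq) (simp_all add: comp_def)
  then show ?thesis
    by (simp add: differential_def euclidean_representation)
qed

lemma linear_chart_deriv:
  assumes "smooth_manifold X A" "(U, \<phi>) \<in> A" "p \<in> U"
  shows "linear (\<lambda>c. chart_deriv A U \<phi> p c h)"
proof (cases "h \<in> smooth_at A p")
  case True
  then show ?thesis using has_derivative_linear[OF smooth_at_has_derivative[OF assms]] by simp
next
  case False
  then show ?thesis by (simp add: chart_deriv_def[abs_def] linear_zero)
qed

section \<open>Linear algebra of adapted frames\<close>

text \<open>The transposed frame, so that linearity of \<open>det\<close> in a row applies. Row
  \<open>Some None\<close> is the slot of the normal, which the cofactor construction leaves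
  variable.\<close>

definition frame_rows ::
  "'n::finite minkowski \<Rightarrow> 'n minkowski \<Rightarrow> ('n \<Rightarrow> 'n minkowski)
     \<Rightarrow> real ^ ('n option option) ^ ('n option option)" where
  "frame_rows x y e = (\<chi> r. case r of None \<Rightarrow> x | Some None \<Rightarrow> y | Some (Some i) \<Rightarrow> e i)"

lemma det_adapted_frame:
  "det (adapted_frame (U, \<phi>) \<sigma> \<nu> p) = det (frame_rows (\<sigma> p) (\<nu> p)
     (\<lambda>i. frechet_derivative (\<sigma> \<circ> inv_into U \<phi>) (at (\<phi> p)) (axis i 1)))"
proof -
  have "adapted_frame (U, \<phi>) \<sigma> \<nu> p = transpose (frame_rows (\<sigma> p) (\<nu> p)
     (\<lambda>i. frechet_derivative (\<sigma> \<circ> inv_into U \<phi>) (at (\<phi> p)) (axis i 1)))"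
    by (simp add: adapted_frame_def frame_rows_def transpose_def vec_eq_iff split: option.split)
  then show ?thesis by (simp add: det_transpose)
qed

lemma sum_UNIV_option:
  fixes g :: "'a::finite option \<Rightarrow> 'b::comm_monoid_add"
  shows "(\<Sum>r\<in>UNIV. g r) = g None + (\<Sum>i\<in>UNIV. g (Some i))"
  unfolding UNIV_option_conv by (subst sum.insert) (auto simp: sum.reindex)

lemma linear_sum_axis:
  fixes S :: "real ^ 'n \<Rightarrow> 'b::real_vector"
  assumes "linear S"
  shows "S c = (\<Sum>i\<in>UNIV. c $ i *\<^sub>R S (axis i 1))"
proof -
  have "S c = S (\<Sum>i\<in>UNIV. c $ i *\<^sub>R axis i 1)"
    by (simp add: scalar_mult_eq_scaleR[symmetric] basis_expansion)
  then show ?thesis by (simp add: linear_sum[OF assms] linear_scale[OF assms])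
qed

text \<open>\<open>M\<close> times a coordinate vector is the corresponding combination of frame
  vectors, so invertibility of \<open>M\<close> gives both independence and spanning.\<close>

lemma frame_span:
  fixes S :: "real ^ 'n \<Rightarrow> 'n::finite minkowski"
  assumes S: "linear S" and det: "det (frame_rows x v (\<lambda>i. S (axis i 1))) \<noteq> 0"
  shows "inj S" "\<exists>c \<beta> \<gamma>. z = S c + \<beta> *\<^sub>R v + \<gamma> *\<^sub>R x"
proof -
  define M where "M = transpose (frame_rows x v (\<lambda>i. S (axis i 1)))"
  have M: "M *v y = S (\<chi> i. y $ Some (Some i)) + y $ Some None *\<^sub>R v + y $ None *\<^sub>R x" for y
    unfolding M_def matrix_mult_sum sum_UNIV_option linear_sum_axis[OF S, of "\<chi> i. y $ Some (Some i)"]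
    by (simp add: column_def transpose_def frame_rows_def scalar_mult_eq_scaleR algebra_simps)
  have inv: "invertible M" using det by (simp add: invertible_det_nz M_def det_transpose)
  show "\<exists>c \<beta> \<gamma>. z = S c + \<beta> *\<^sub>R v + \<gamma> *\<^sub>R x"
  proof -
    obtain N where "M ** N = mat 1" using inv unfolding invertible_def by blast
    then have "z = M *v (N *v z)" by (simp add: matrix_vector_mul_assoc)
    then show ?thesis unfolding M by blast
  qed
  show "inj S"
  proof (rule linear_injective_0[OF S, THEN iffD2], intro allI impI)
    fix c assume "S c = 0"
    define y :: "real ^ 'n option option" where
      "y = (\<chi> r. case r of Some (Some i) \<Rightarrow> c $ i | _ \<Rightarrow> 0)"
    have "M *v y = 0" using \<open>S c = 0\<close> by (simp add: M y_def)
    moreover obtain N where "N ** M = mat 1" using inv unfolding invertible_def by blast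
    ultimately have "y = 0" by (metis matrix_vector_mul_assoc matrix_vector_mul_lid matrix_vector_mult_0_right)
    then have "y $ Some (Some i) = 0" for i by simp
    then show "c = 0" by (simp add: y_def vec_eq_iff)
  qed
qed

text \<open>Pairing a combination of frame vectors with \<open>v\<close> and \<open>x\<close>
  isolates, up to sign, the coefficients of \<open>v\<close> and \<open>x\<close>; both vanish for a
  vector of \<open>orth_space (x, v)\<close>.\<close>

lemma frame_orth_space:
  fixes S :: "real ^ 'n \<Rightarrow> 'n::finite minkowski"
  assumes S: "linear S" and det: "det (frame_rows x v (\<lambda>i. S (axis i 1))) \<noteq> 0"
    and a: "(x, v) \<in> unit_tangent" and o: "\<And>c. S c \<in> orth_space (x, v)"
  shows "range S = orth_space (x, v)"
proof
  show "orth_space (x, v) \<subseteq> range S"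
  proof
    fix z assume z: "z \<in> orth_space (x, v)"
    obtain c \<beta> \<gamma> where e: "z = S c + \<beta> *\<^sub>R v + \<gamma> *\<^sub>R x"
      using frame_span(2)[OF S det] by blast
    have "mink v z = \<beta>" "mink x z = - \<gamma>"
      using o[of c] unit_tangentD[OF a] by (simp_all add: e orth_space_def mink_simps)
    then show "z \<in> range S" using z e by (simp add: orth_space_def)
  qed
qed (use o in blast)

text \<open>Linear algebra at one point: \<open>S\<close> and \<open>N\<close> stand for the
  differentials of \<sigma> and \<nu> in coordinates. In \<open>small\<close> the eigenvalue
  equation of the shape operator is expressed through its defining relation, before the operator
  itself is introduced.\<close>

locale shape_data =
  fixes x v :: "'n::finite minkowski" and S N :: "real ^ 'n \<Rightarrow> 'n minkowski"
  assumes a: "(x, v) \<in> unit_tangent"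
    and S: "linear S" and N: "linear N"
    and inj_S: "inj S" and range_S: "range S = orth_space (x, v)"
    and N_orth: "\<And>c. N c \<in> orth_space (x, v)"
    and sym: "\<And>c d. mink (N c) (S d) = mink (N d) (S c)"
    and small: "\<And>k c. c \<noteq> 0 \<Longrightarrow> N c = - (k *\<^sub>R S c) \<Longrightarrow> -1 < k \<and> k < 1"
begin

definition B :: "real ^ 'n \<Rightarrow> real ^ 'n" where "B c = inv S (- N c)"

definition I :: "real ^ 'n \<Rightarrow> real ^ 'n \<Rightarrow> real" where
  "I c d = mink (S c) (S d) - mink (N c) (N d)"

lemma S_orth: "S c \<in> orth_space (x, v)"
  using range_S by blast

lemma S_B: "S (B c) = - N c"
proof -
  have "- N c \<in> range S" unfolding range_S by (rule orth_space_minus[OF N_orth])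
  then show ?thesis unfolding B_def by (rule f_inv_into_f)
qed

text \<open>\<open>sym\<close> makes \<open>B\<close> self-adjoint for the induced metric; moving
  one \<open>B\<close> to the other side shows that \<open>I\<close> is the induced metric composed
  with 1 - B^2.\<close>

lemma I_B: "I c d = mink (S c - S (B (B c))) (S d)"
proof -
  have N: "N e = - S (B e)" for e by (simp add: S_B)
  have "mink (N c) (N d) = - mink (N d) (S (B c))"
    by (simp add: N[of c] mink_simps mink_commute[of "N d"])
  also have "\<dots> = mink (S (B (B c))) (S d)"
    using sym[of d "B c"] by (simp add: N[of "B c"] mink_simps)
  finally show ?thesis by (simp add: I_def mink_simps)
qed

lemma orth_eqI:
  assumes "w \<in> orth_space (x, v)" "u \<in> orth_space (x, v)" "\<And>d. mink w (S d) = mink u (S d)"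
  shows "w = u"
proof -
  have "w - u = 0"
  proof (rule orth_space_nondegenerate[OF a orth_space_diff[OF assms(1,2)]])
    fix w' assume "w' \<in> orth_space (x, v)"
    then obtain d where "w' = S d" using range_S by blast
    then show "mink (w - u) w' = 0" using assms(3) by (simp add: mink_simps)
  qed
  then show ?thesis by simp
qed

text \<open>If \<open>c\<close> is in the kernel then \<open>B\<^sup>2 c = c\<close>, so \<open>c + B c\<close> and \<open>c\<close> would be eigenvectors
  of \<open>B\<close> for the eigenvalues \<open>1\<close> and \<open>-1\<close>.\<close>

lemma I_nondegenerate:
  assumes "\<And>d. I c d = 0"
  shows "c = 0"
proof -
  have "S c = S (B (B c))"
    using assms by (intro orth_eqI S_orth) (simp add: I_B mink_simps)
  then have BB: "B (B c) = c" using inj_S by (simp add: inj_eq)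
  have lin: "S (c + B c) = S c + S (B c)" "N (c + B c) = N c + N (B c)"
    by (rule linear_add[OF S], rule linear_add[OF N])
  have 1: "N c = - S (B c)" "N (B c) = - S c"
    using S_B[of c] S_B[of "B c"] BB by simp_all
  then have "N (c + B c) = - (1 *\<^sub>R S (c + B c))" unfolding lin by simp
  with small[of "c + B c" 1] have e: "c + B c = 0" by auto
  then have "B c = - c" by (simp add: add_eq_0_iff)
  with 1(1) have "N c = - ((-1) *\<^sub>R S c)" by (simp add: linear_neg[OF S])
  with small[of c "-1"] show ?thesis by auto
qed

lemma linear_I: "linear (I c)" "linear (\<lambda>c. I c d)"
  unfolding linear_iff I_def
  by (simp_all add: mink_simps linear_add[OF S] linear_add[OF N] linear_scale[OF S] linear_scale[OF N]
      algebra_simps)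

text \<open>\<open>T\<close> is the Gram map of \<open>I\<close>: injective by nondegeneracy, hence
  surjective by finite dimension. A preimage of the coefficient vector of \<open>L\<close>
  represents \<open>L\<close>.\<close>

lemma I_represents:
  assumes L: "linear L"
  obtains g where "\<And>d. I g d = L d"
proof -
  define T where "T c = (\<Sum>b\<in>Basis. I c b *\<^sub>R b)" for c
  have I_eq: "I c = L'" if "\<And>b. b \<in> Basis \<Longrightarrow> I c b = L' b" "linear L'" for c L'
    using linear_eq_stdbasis[OF linear_I(1) that(2)] that(1) by blast
  have T: "linear T"
    unfolding T_def using linear_I(2)
    by (intro linear_compose_sum ballI) (auto simp: linear_iff algebra_simps)
  have Tb: "T c \<bullet> b = I c b" if "b \<in> Basis" for c b
    using that by (simp add: T_def)
  have "inj T"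
  proof (rule linear_injective_0[OF T, THEN iffD2], intro allI impI)
    fix c assume "T c = 0"
    then have "I c b = 0" if "b \<in> Basis" for b using Tb[OF that, of c] by simp
    then have "I c = (\<lambda>d. 0)" by (intro I_eq linear_zero) auto
    then show "c = 0" by (intro I_nondegenerate) simp
  qed
  then have "surj T" by (rule linear_inj_imp_surj[OF T])
  then obtain g where g: "T g = (\<Sum>b\<in>Basis. L b *\<^sub>R b)" by (metis surjD)
  have "I g b = L b" if "b \<in> Basis" for b
    using Tb[OF that, of g] that by (simp add: g)
  then have "I g = L" by (intro I_eq L)
  then show thesis by (intro that[of g]) simp
qed

lemma I_inject:
  assumes "\<And>d. I c d = I e d"
  shows "c = e"
proof -
  have "I (c - e) d = 0" for d
    using linear_diff[OF linear_I(2)] assms by simp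
  then show ?thesis using I_nondegenerate[of "c - e"] by simp
qed

text \<open>The vectors \<open>v\<close>, \<open>x\<close> and \<open>S d\<close> span, so their
  products with \<open>P\<close> determine it. The coefficient of \<open>x\<close> is
  \<open>r\<close> because \<open>mink x x = -1\<close>; the tangential part is read off from
  \<open>I_B\<close>.\<close>

lemma normal_velocity:
  assumes P: "mink P v = 0" "mink P x = - r" "\<And>d. mink P (S d) = - I g d"
  shows "P = S (B (B g)) - S g + r *\<^sub>R x"
proof -
  note m = unit_tangentD[OF a]
  have o: "P - r *\<^sub>R x \<in> orth_space (x, v)"
    using P(1,2) m by (simp add: orth_space_def mink_simps mink_commute[of _ P])
  have "mink x (S d) = 0" for d using S_orth[of d] by (simp add: orth_space_def)
  then have "P - r *\<^sub>R x = S (B (B g)) - S g"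
    using P(3) by (intro orth_eqI[OF o orth_space_diff[OF S_orth S_orth]]) (simp add: I_B mink_simps)
  then show ?thesis by (simp add: algebra_simps)
qed

end

section \<open>The unit normal as a cofactor vector\<close>

lemma linear_det_frame_rows:
  fixes x :: "'n::finite minkowski"
  shows "linear (\<lambda>y. det (frame_rows x y e))"
proof -
  define C where "C = frame_rows x 0 e"
  have r: "frame_rows x y e = (\<chi> i. if i = Some None then y else C $ i)" for y
    by (auto simp: frame_rows_def C_def vec_eq_iff split: option.split)
  show ?thesis
    unfolding linear_iff r
    using det_row_add[where k="Some None" and a="\<lambda>_. y" and b="\<lambda>_. z" and c="\<lambda>i. C $ i" for y z :: "'n minkowski"]
      det_row_mul[where k="Some None" and a="\<lambda>_. y" and b="\<lambda>i. C $ i" for y :: "'n minkowski",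
        unfolded scalar_mult_eq_scaleR] by simp
qed

text \<open>The generalised cross product of \<open>x\<close> and the \<open>e i\<close>: it
  represents the linear form \<open>\<lambda>y. det (frame_rows x y e)\<close> with respect to
  \<open>mink\<close>, whence the sign of the time coordinate.\<close>

definition cofactor_vector ::
  "'n::finite minkowski \<Rightarrow> ('n \<Rightarrow> 'n minkowski) \<Rightarrow> 'n minkowski" where
  "cofactor_vector x e = (\<chi> r. (if r = None then -1 else 1) * det (frame_rows x (axis r 1) e))"

lemma mink_cofactor_vector: "mink (cofactor_vector x e) y = det (frame_rows x y e)"
proof -
  have "det (frame_rows x y e) = (\<Sum>r\<in>UNIV. y $ r *\<^sub>R det (frame_rows x (axis r 1) e))"
    by (rule linear_sum_axis[OF linear_det_frame_rows])
  also have "\<dots> = mink (cofactor_vector x e) y"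
    by (simp add: sum_UNIV_option mink_def cofactor_vector_def algebra_simps)
  finally show ?thesis by simp
qed

text \<open>Pairing \<open>n\<close> with \<open>x\<close> or with a frame vector
  \<open>S (axis i 1)\<close> gives a determinant with two equal rows, so \<open>n\<close> is
  orthogonal to them and equals \<open>l\<close> times \<open>v\<close>, where \<open>l\<close> is
  the frame determinant. The right side contains no normal: \<nu> is recovered from \<sigma> and its
  first derivatives.\<close>

lemma unit_normal_eq_cofactor:
  fixes S :: "real ^ 'n \<Rightarrow> 'n::finite minkowski"
  assumes S: "linear S" and \<delta>: "\<delta> \<in> {-1, 1}" and pos: "\<delta> * det (frame_rows x v (\<lambda>i. S (axis i 1))) > 0"
    and a: "(x, v) \<in> unit_tangent" and o: "\<And>c. S c \<in> orth_space (x, v)"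
  defines "n \<equiv> cofactor_vector x (\<lambda>i. S (axis i 1))"
  shows "mink n n > 0" "v = (\<delta> / sqrt (mink n n)) *\<^sub>R n"
proof -
  note m = unit_tangentD[OF a]
  define l where "l = det (frame_rows x v (\<lambda>i. S (axis i 1)))"
  have l: "l \<noteq> 0" "\<delta> * l > 0" using pos by (auto simp: l_def)
  have nx: "mink n x = 0"
    unfolding n_def mink_cofactor_vector
    by (rule det_identical_rows[of None "Some None"])
       (auto simp: row_def frame_rows_def vec_eq_iff)
  have "mink n (S (axis i 1)) = 0" for i
    unfolding n_def mink_cofactor_vector
    by (rule det_identical_rows[of "Some (Some i)" "Some None"])
       (auto simp: row_def frame_rows_def vec_eq_iff)
  then have nS: "mink n (S c) = 0" for c
    unfolding linear_sum_axis[OF S, of c] by (simp add: mink.sum_right mink_simps)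
  have nv: "mink n v = l" by (simp add: n_def mink_cofactor_vector l_def)
  have "n - l *\<^sub>R v = 0"
  proof (rule mink_nondegenerate)
    fix z
    obtain c \<beta> \<gamma> where "z = S c + \<beta> *\<^sub>R v + \<gamma> *\<^sub>R x"
      using frame_span(2)[OF S] l(1) unfolding l_def by blast
    then show "mink (n - l *\<^sub>R v) z = 0"
      using o[of c] by (simp add: mink_simps nx nS nv m orth_space_def)
  qed
  then have n: "n = l *\<^sub>R v" by simp
  then have q: "mink n n = l\<^sup>2" by (simp add: mink_simps m power2_eq_square)
  then show "mink n n > 0" using l(1) by simp
  \<comment> \<open>\<delta> is the sign of \<open>l\<close>, which is where the orientation selects
    one of the two unit normals.\<close>
  have c: "\<delta> / \<bar>l\<bar> * l = 1" using \<delta> l by (auto simp: abs_if zero_less_mult_iff)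
  show "v = (\<delta> / sqrt (mink n n)) *\<^sub>R n"
    unfolding q unfolding n scaleR_scaleR real_sqrt_abs c by simp
qed

lemma differentiable_prod_real:
  fixes g :: "'i \<Rightarrow> real \<Rightarrow> real"
  assumes "\<And>i. i \<in> J \<Longrightarrow> g i differentiable at t"
  shows "(\<lambda>s. \<Prod>i\<in>J. g i s) differentiable at t"
  using assms by (induction J rule: infinite_finite_induct) auto

lemma differentiable_det:
  fixes M :: "real \<Rightarrow> real ^ 'k ^ 'k"
  assumes "\<And>i j. (\<lambda>s. M s $ i $ j) differentiable at t"
  shows "(\<lambda>s. det (M s)) differentiable at t"
  unfolding det_def
  by (intro differentiable_sum ballI differentiable_mult differentiable_const
      differentiable_prod_real assms) (simp add: finite_permutations)

lemma differentiable_vecI: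
  fixes F :: "real \<Rightarrow> real ^ 'k"
  assumes "\<And>i. (\<lambda>s. F s $ i) differentiable at t"
  shows "F differentiable at t"
proof -
  have "(\<lambda>s. \<Sum>i\<in>UNIV. F s $ i *\<^sub>R axis i (1::real)) differentiable at t"
    by (intro differentiable_sum ballI differentiable_scaleR assms differentiable_const) simp
  then show ?thesis by (simp add: scalar_mult_eq_scaleR[symmetric] basis_expansion)
qed

lemma differentiable_vec_nth:
  fixes F :: "real \<Rightarrow> real ^ 'k"
  shows "F differentiable at t \<Longrightarrow> (\<lambda>s. F s $ i) differentiable at t"
  unfolding differentiable_def using bounded_linear.has_derivative[OF bounded_linear_vec_nth] by blast

lemma differentiable_cofactor_vector:
  fixes x :: "real \<Rightarrow> 'n::finite minkowski"
  assumes "x differentiable at t" "\<And>i. (\<lambda>s. e s i) differentiable at t"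
  shows "(\<lambda>s. cofactor_vector (x s) (e s)) differentiable at t"
proof (rule differentiable_vecI)
  fix r
  have "(\<lambda>s. frame_rows (x s) (axis r 1) (e s) $ i $ j) differentiable at t" for i j
  proof (cases i)
    case None
    then show ?thesis using assms(1) by (simp add: frame_rows_def differentiable_vec_nth)
  next
    case (Some k)
    then show ?thesis using assms(2)
      by (cases k) (simp_all add: frame_rows_def differentiable_vec_nth)
  qed
  then show "(\<lambda>s. cofactor_vector (x s) (e s) $ r) differentiable at t"
    unfolding cofactor_vector_def vec_lambda_beta
    by (intro differentiable_mult differentiable_const differentiable_det)
qed

section \<open>Hypersurfaces in a chart\<close>

lemma mink_const_derivative:
  fixes F G :: "'a::real_normed_vector \<Rightarrow> 'n::finite minkowski"
  assumes F: "(F has_derivative F') (at y)" and G: "(G has_derivative G') (at y)"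
    and O: "open O'" "y \<in> O'" "\<And>z. z \<in> O' \<Longrightarrow> mink (F z) (G z) = k"
  shows "mink (F y) (G' c) + mink (F' c) (G y) = 0"
proof -
  have "((\<lambda>z. k) has_derivative (\<lambda>c. mink (F y) (G' c) + mink (F' c) (G y))) (at y)"
    by (rule has_derivative_transform_within_open[OF mink.FDERIV[OF F G] O])
  from has_derivative_unique[OF this has_derivative_const] show ?thesis by meson
qed

lemma mink_const_vector_derivative:
  fixes F G :: "real \<Rightarrow> 'n::finite minkowski"
  assumes "(F has_vector_derivative F') (at t)" "(G has_vector_derivative G') (at t)"
    and "open T" "t \<in> T" "\<And>s. s \<in> T \<Longrightarrow> mink (F s) (G s) = k"
  shows "mink (F t) G' + mink F' (G t) = 0"
  using mink_const_derivative[OF assms(1,2)[unfolded has_vector_derivative_def] assms(3-5), of 1]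
  by simp

locale hypersurface_chart =
  fixes X :: "'m topology" and A :: "('m, real ^ 'n) atlas"
    and \<sigma> \<nu> :: "'m \<Rightarrow> 'n::finite minkowski" and \<delta> :: real
    and U :: "'m set" and \<phi> :: "'m \<Rightarrow> real ^ 'n" and p :: 'm
  assumes M: "smooth_manifold X A" and UA: "(U, \<phi>) \<in> A" and pU: "p \<in> U"
    and immersion: "immersion X A \<sigma>" and normal: "unit_normal_field X A \<delta> \<sigma> \<nu>"
    and curvatures: "small_principal_curvatures X A \<sigma> \<nu>"
begin

definition S :: "real ^ 'n \<Rightarrow> 'n minkowski" where
  "S c = frechet_derivative (\<sigma> \<circ> inv_into U \<phi>) (at (\<phi> p)) c"

definition N :: "real ^ 'n \<Rightarrow> 'n minkowski" where
  "N c = frechet_derivative (\<nu> \<circ> inv_into U \<phi>) (at (\<phi> p)) c"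

abbreviation D :: "real ^ 'n \<Rightarrow> ('m \<Rightarrow> real) \<Rightarrow> real" where
  "D \<equiv> chart_deriv A U \<phi> p"

abbreviation T :: "(('m \<Rightarrow> real) \<Rightarrow> real) set" where
  "T \<equiv> tangent_space (smooth_at A) p"

lemmas chart = smooth_manifold_chart[OF M UA]

lemma p_in: "p \<in> topspace X"
  using chart(5) pU by blast

lemma inv_chart: "q \<in> U \<Longrightarrow> inv_into U \<phi> (\<phi> q) = q"
  using chart(4) by simp

lemma point_in_chart: "\<phi> p \<in> \<phi> ` U"
  using pU by blast

lemma smooth_map_\<sigma>: "smooth_map A \<sigma>" and smooth_map_\<nu>: "smooth_map A \<nu>"
  using immersion normal unfolding immersion_def unit_normal_field_def by blast+

lemma smooth_\<sigma>: "smooth_on (\<phi> ` U) (\<sigma> \<circ> inv_into U \<phi>)"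
  and smooth_\<nu>: "smooth_on (\<phi> ` U) (\<nu> \<circ> inv_into U \<phi>)"
  using smooth_map_\<sigma> smooth_map_\<nu> UA unfolding smooth_map_def by blast+

lemma derivative_\<sigma>: "((\<sigma> \<circ> inv_into U \<phi>) has_derivative S) (at (\<phi> p))"
  using smooth_on_has_derivative[OF smooth_\<sigma> point_in_chart] by (simp add: S_def[abs_def])

lemma derivative_\<nu>: "((\<nu> \<circ> inv_into U \<phi>) has_derivative N) (at (\<phi> p))"
  using smooth_on_has_derivative[OF smooth_\<nu> point_in_chart] by (simp add: N_def[abs_def])

lemma linear_S: "linear S" and linear_N: "linear N"
  using derivative_\<sigma> derivative_\<nu> has_derivative_linear by blast+

lemma lift_in_unit_tangent: "q \<in> topspace X \<Longrightarrow> (\<sigma> q, \<nu> q) \<in> unit_tangent"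
  using immersion normal unfolding immersion_def unit_normal_field_def unit_tangent_def by blast

lemma base: "(\<sigma> p, \<nu> p) \<in> unit_tangent"
  by (rule lift_in_unit_tangent[OF p_in])

lemma inv_in: "y \<in> \<phi> ` U \<Longrightarrow> inv_into U \<phi> y \<in> topspace X"
  by (rule subsetD[OF chart(5) inv_into_into])

text \<open>Holding on the whole image of the chart, and not only at \<open>p\<close>, the relation
  can be differentiated in space.\<close>

lemma mink_tangent_normal:
  assumes "y \<in> \<phi> ` U"
  shows "mink (frechet_derivative (\<sigma> \<circ> inv_into U \<phi>) (at y) c) (\<nu> (inv_into U \<phi> y)) = 0"
proof -
  obtain q where q: "q \<in> U" "y = \<phi> q" using assms by blast
  have "mink (differential \<sigma> (chart_deriv A U \<phi> q c)) (\<nu> q) = 0"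
    using normal chart(5) q(1) chart_deriv_in_tangent_space[OF M UA q(1)]
    unfolding unit_normal_field_def by blast
  then show ?thesis
    by (simp add: differential_chart_deriv[OF M UA q(1) smooth_map_\<sigma>] q inv_chart)
qed

lemma differential_\<sigma>: "differential \<sigma> (D c) = S c"
  by (simp add: differential_chart_deriv[OF M UA pU smooth_map_\<sigma>] S_def)

lemma differential_\<nu>: "differential \<nu> (D c) = N c"
  by (simp add: differential_chart_deriv[OF M UA pU smooth_map_\<nu>] N_def)

lemma D_in: "D c \<in> T"
  by (rule chart_deriv_in_tangent_space[OF M UA pU])

text \<open>Stated for arbitrary derivations, since the identification of these with coordinate
  derivations rests on it.\<close>

lemma tangent_orth: "W \<in> T \<Longrightarrow> differential \<sigma> W \<in> orth_space (\<sigma> p, \<nu> p)"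
  using tangent_space_mink[OF M p_in _ smooth_map_\<sigma>, of W "-1"] lift_in_unit_tangent
    unit_tangentD(1) normal p_in mink_commute[of "\<nu> p" "differential \<sigma> W"]
  unfolding unit_normal_field_def orth_space_def by auto

lemma S_in_orth: "S c \<in> orth_space (\<sigma> p, \<nu> p)"
  using tangent_orth[OF D_in] by (simp add: differential_\<sigma>)

text \<open>Obtained by differentiating <\<nu>, \<nu>> = 1 and <\<sigma>, \<nu>> = 0 in the chart.
  As a consequence the correction term in \<open>cov_deriv\<close> vanishes, and the shape operator
  is given by the flat derivative of \<nu>.\<close>

lemma N_in_orth: "N c \<in> orth_space (\<sigma> p, \<nu> p)"
proof -
  have m: "mink ((\<nu> \<circ> inv_into U \<phi>) y) ((\<nu> \<circ> inv_into U \<phi>) y) = 1"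
    "mink ((\<sigma> \<circ> inv_into U \<phi>) y) ((\<nu> \<circ> inv_into U \<phi>) y) = 0" if "y \<in> \<phi> ` U" for y
    using unit_tangentD[OF lift_in_unit_tangent[OF inv_in[OF that]]] by simp_all
  have "mink (\<nu> p) (N c) + mink (N c) (\<nu> p) = 0"
    using mink_const_derivative[OF derivative_\<nu> derivative_\<nu> chart(2) point_in_chart m(1), of c]
    by (simp add: inv_chart pU)
  moreover have "mink (\<sigma> p) (N c) + mink (S c) (\<nu> p) = 0"
    using mink_const_derivative[OF derivative_\<sigma> derivative_\<nu> chart(2) point_in_chart m(2), of c]
    by (simp add: inv_chart pU)
  ultimately show ?thesis
    using S_in_orth[of c] by (simp add: orth_space_def mink_commute[of _ "\<nu> p"])
qed

text \<open>Differentiating <\<nu>, d\<sigma>(d)> = 0 in the direction \<open>c\<close> expresses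
  the left side through the second derivative of \<sigma>, which is symmetric in \<open>c\<close>
  and \<open>d\<close>.\<close>

lemma second_fundamental_form_symmetric: "mink (N c) (S d) = mink (N d) (S c)"
proof -
  let ?h = "\<lambda>d y. frechet_derivative (\<sigma> \<circ> inv_into U \<phi>) (at y) d"
  have h: "(?h d has_derivative frechet_derivative (?h d) (at (\<phi> p))) (at (\<phi> p))" for d
    by (rule smooth_on_has_derivative[OF smooth_on_derivative[OF smooth_\<sigma>] point_in_chart])
  have "mink (\<nu> p) (frechet_derivative (?h d) (at (\<phi> p)) c) + mink (N c) (S d) = 0" for c d
  proof -
    have "mink ((\<nu> \<circ> inv_into U \<phi>) y) (?h d y) = 0" if "y \<in> \<phi> ` U" for y
      using mink_tangent_normal[OF that, of d] by (simp add: mink_commute)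
    from mink_const_derivative[OF derivative_\<nu> h[of d] chart(2) point_in_chart this, of c]
    show ?thesis by (simp add: inv_chart pU S_def)
  qed
  from this[of d c] this[of c d]
  show ?thesis
    using symmetric_second_derivative[OF chart(2) point_in_chart smooth_\<sigma>, of d c] by simp
qed

lemma det_frame: "\<delta> * det (frame_rows (\<sigma> p) (\<nu> p) (\<lambda>i. S (axis i 1))) > 0"
  using normal p_in UA pU unfolding unit_normal_field_def S_def det_adapted_frame[symmetric] by blast

lemma det_frame_nonzero: "det (frame_rows (\<sigma> p) (\<nu> p) (\<lambda>i. S (axis i 1))) \<noteq> 0"
  using det_frame by auto

lemmas range_S = frame_orth_space[OF linear_S det_frame_nonzero base S_in_orth]

lemma differential_inject:
  "V \<in> T \<Longrightarrow> W \<in> T \<Longrightarrow> differential \<sigma> V = differential \<sigma> W \<Longrightarrow> V = W"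
  using immersion p_in unfolding immersion_def by (meson inj_onD)

lemma tangent_space_eq: "T = range D"
proof -
  have "W \<in> range D" if W: "W \<in> T" for W
  proof -
    obtain c where "differential \<sigma> W = S c"
      using tangent_orth[OF W] range_S by blast
    then have "W = D c" by (intro differential_inject W D_in) (simp add: differential_\<sigma>)
    then show ?thesis by blast
  qed
  then show ?thesis using D_in by blast
qed

lemma shape_operator_eqI:
  assumes "S b = - N c"
  shows "shape_operator A \<sigma> \<nu> p (D c) = D b"
proof -
  have "cov_deriv \<sigma> \<nu> p (D c) = N c"
    using N_in_orth[of c] by (simp add: cov_deriv_def differential_\<nu> orth_space_def mink_commute[of "N c"])
  then show ?thesis
    unfolding shape_operator_def
    by (intro the_equality conjI D_in differential_inject) (auto simp: differential_\<sigma> assms)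
qed

lemma small_eigenvalues:
  assumes "c \<noteq> 0" "N c = - (k *\<^sub>R S c)"
  shows "-1 < k \<and> k < 1"
proof -
  have "shape_operator A \<sigma> \<nu> p (D c) = D (k *\<^sub>R c)"
    by (rule shape_operator_eqI) (simp add: linear_scale[OF linear_S] assms)
  also have "\<dots> = (\<lambda>h. k * D c h)"
    using linear_scale[OF linear_chart_deriv[OF M UA pU]] by (simp add: fun_eq_iff)
  finally have "shape_operator A \<sigma> \<nu> p (D c) = (\<lambda>h. k * D c h)" .
  moreover have "D c \<noteq> (\<lambda>h. 0)"
  proof
    assume "D c = (\<lambda>h. 0)"
    then have "S c = 0" using differential_\<sigma>[of c] by (simp add: differential_def)
    then show False
      using frame_span(1)[OF linear_S det_frame_nonzero] assms(1) linear_0[OF linear_S]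
      by (metis injD)
  qed
  ultimately show ?thesis
    using curvatures p_in D_in unfolding small_principal_curvatures_def by blast
qed

sublocale shape_data "\<sigma> p" "\<nu> p" S N
  by (rule shape_data.intro)
    (fact base linear_S linear_N frame_span(1)[OF linear_S det_frame_nonzero] range_S N_in_orth
      second_fundamental_form_symmetric small_eigenvalues)+

lemma shape_operator_eq: "shape_operator A \<sigma> \<nu> p (D c) = D (B c)"
  by (rule shape_operator_eqI[OF S_B])

section \<open>The lift, the Gauss map and the gradient in a chart\<close>

lemma smooth_map_lift: "smooth_map A (lift \<sigma> \<nu>)"
  unfolding smooth_map_def
proof (clarify)
  fix V \<psi> assume V: "(V, \<psi>) \<in> A"
  have "smooth_on (\<psi> ` V) (\<lambda>y. ((\<sigma> \<circ> inv_into V \<psi>) y, (\<nu> \<circ> inv_into V \<psi>) y))"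
    using smooth_map_\<sigma> smooth_map_\<nu> V unfolding smooth_map_def
    by (intro smooth_on_Pair smooth_manifold_chart(2)[OF M V]) blast+
  then show "smooth_on (\<psi> ` V) (lift \<sigma> \<nu> \<circ> inv_into V \<psi>)"
    by (simp add: lift_def[abs_def] comp_def)
qed

lemma derivative_lift: "((lift \<sigma> \<nu> \<circ> inv_into U \<phi>) has_derivative (\<lambda>c. (S c, N c))) (at (\<phi> p))"
  using has_derivative_Pair[OF derivative_\<sigma> derivative_\<nu>] by (simp add: lift_def[abs_def] comp_def)

lemma differential_lift: "differential (lift \<sigma> \<nu>) (D c) = (S c, N c)"
  unfolding differential_chart_deriv[OF M UA pU smooth_map_lift]
  using frechet_derivative_at[OF derivative_lift] by metis

lemma lift_chi_perp: "(S c, N c) \<in> chi_perp (\<sigma> p, \<nu> p)"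
  unfolding chi_perp_eq[OF base] using S_in_orth N_in_orth by blast

text \<open>Both sides differentiate \<open>F (l y)\<close>, where \<open>F\<close> extends the
  pullback of \<open>h\<close> near the base point and \<open>l\<close> is the lift in the chart.
  Membership of \<open>h \<circ> gauss_map \<sigma> \<nu>\<close> in \<open>smooth_at A p\<close>
  has to be checked as well, because \<open>D c\<close> is 0 on all other functions.\<close>

lemma dgauss_eq: "dgauss \<sigma> \<nu> p (D c) = dgeod (\<sigma> p, \<nu> p) (S c, N c)"
proof
  fix h
  have G: "gauss_map \<sigma> \<nu> p = geod (\<sigma> p, \<nu> p)" by (simp add: gauss_map_def lift_def)
  show "dgauss \<sigma> \<nu> p (D c) h = dgeod (\<sigma> p, \<nu> p) (S c, N c) h"
  proof (cases "h \<in> geod_smooth_at (geod (\<sigma> p, \<nu> p))")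
    case True
    obtain W F where W: "open W" "(\<sigma> p, \<nu> p) \<in> W" "smooth_on W F"
      and F: "\<And>b. b \<in> unit_tangent \<inter> W \<Longrightarrow> F b = h (geod b)"
      using geod_smooth_at_extension[OF True base] by blast
    define l where "l = lift \<sigma> \<nu> \<circ> inv_into U \<phi>"
    have l: "smooth_on (\<phi> ` U) l"
      using smooth_map_lift UA unfolding smooth_map_def l_def by blast
    have lp: "l (\<phi> p) = (\<sigma> p, \<nu> p)" by (simp add: l_def lift_def inv_chart pU)
    define W' where "W' = \<phi> ` U \<inter> l -` W"
    have W': "open W'" "\<phi> p \<in> W'" "W' \<subseteq> \<phi> ` U"
      unfolding W'_def using lp point_in_chart W(2)
      by (auto intro: continuous_open_preimage[OF smooth_on_continuous_on[OF l] chart(2) W(1)])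
    have eq: "F (l y) = ((h \<circ> gauss_map \<sigma> \<nu>) \<circ> inv_into U \<phi>) y" if "y \<in> W'" for y
      using that F[of "l y"] lift_in_unit_tangent[OF inv_in, of y]
      by (simp add: W'_def l_def lift_def gauss_map_def)
    have "smooth_on W' (\<lambda>y. F (l y))"
      by (rule smooth_on_compose[OF W'(1) W(1) _ smooth_on_mono[OF l W'(3)] W(3)])
         (auto simp: W'_def)
    then have "smooth_on W' ((h \<circ> gauss_map \<sigma> \<nu>) \<circ> inv_into U \<phi>)"
      by (rule smooth_on_cong[OF W'(1), rotated]) (rule eq)
    then have in_C: "h \<circ> gauss_map \<sigma> \<nu> \<in> smooth_at A p"
      by (rule smooth_atI[OF UA pU W'])
    have "(F has_derivative frechet_derivative F (at (\<sigma> p, \<nu> p))) (at (l (\<phi> p)))"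
      unfolding lp by (rule smooth_on_has_derivative[OF W(3,2)])
    from has_derivative_compose[OF derivative_lift[folded l_def] this]
    have "(((h \<circ> gauss_map \<sigma> \<nu>) \<circ> inv_into U \<phi>) has_derivative
        (\<lambda>c. frechet_derivative F (at (\<sigma> p, \<nu> p)) (S c, N c))) (at (\<phi> p))"
      by (rule has_derivative_transform_within_open[OF _ W'(1,2) eq])
    from chart_deriv_eq[OF this in_C]
    have "D c (h \<circ> gauss_map \<sigma> \<nu>) = frechet_derivative F (at (\<sigma> p, \<nu> p)) (S c, N c)" .
    also have "\<dots> = dgeod (\<sigma> p, \<nu> p) (S c, N c) h"
      by (rule dgeod_eq[OF base chi_perp_tangent[OF lift_chi_perp] True
          has_derivative_extension[OF W base F], symmetric])
    finally show ?thesis using True by (simp add: dgauss_def pushforward_def G)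
  next
    case False
    then show ?thesis by (simp add: dgauss_def pushforward_def G dgeod_outside)
  qed
qed

lemma gauss_metric_eq: "gauss_metric \<sigma> \<nu> p (D c) (D d) = I c d"
proof -
  have "gauss_metric \<sigma> \<nu> p (D c) (D d) = para_sasaki (\<sigma> p, \<nu> p) (S c, N c) (S d, N d)"
    using geod_metric_eq[OF base lift_chi_perp lift_chi_perp]
    by (simp add: gauss_metric_def dgauss_eq gauss_map_def lift_def)
  also have "\<dots> = I c d"
    unfolding I_def by (rule para_sasaki_chi_perp[OF base S_in_orth N_in_orth S_in_orth N_in_orth])
  finally show ?thesis .
qed

text \<open>\<open>D d f\<close> is linear in \<open>d\<close>, so the nondegenerate form
  \<open>I\<close> represents it by exactly one \<open>g\<close>.\<close>

lemma gauss_gradient_eq: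
  obtains g where "gauss_gradient A \<sigma> \<nu> f p = D g" "\<And>d. I g d = D d f"
proof -
  obtain g where g: "\<And>d. I g d = D d f"
    using I_represents[OF linear_chart_deriv[OF M UA pU, of f]] by blast
  have "gauss_gradient A \<sigma> \<nu> f p = D g"
    unfolding gauss_gradient_def tangent_space_eq
  proof (rule the_equality)
    fix V assume V: "V \<in> range D \<and> (\<forall>W\<in>range D. gauss_metric \<sigma> \<nu> p V W = W f)"
    then obtain c where c: "V = D c" by blast
    have "I c d = I g d" for d using V by (auto simp: c gauss_metric_eq g)
    then show "V = D g" using I_inject c by blast
  qed (auto simp: gauss_metric_eq g)
  then show thesis using g by (rule that)
qed

end

section \<open>Time derivatives\<close>

lemma smooth_on_product_chart:
  assumes sm: "smooth_map (product_atlas A J) (\<lambda>(p, t). F t p)"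
    and U: "(U, \<phi>) \<in> A" "inj_on \<phi> U" "open (\<phi> ` U)" and J: "open J"
  shows "smooth_on (\<phi> ` U \<times> J) (\<lambda>(y, t). F t (inv_into U \<phi> y))"
proof -
  let ?\<Phi> = "\<lambda>(p, t). (\<phi> p, t)"
  have im: "?\<Phi> ` (U \<times> J) = \<phi> ` U \<times> J" by force
  have inj: "inj_on ?\<Phi> (U \<times> J)" using U(2) by (auto simp: inj_on_def)
  have "(U \<times> J, ?\<Phi>) \<in> product_atlas A J" using U(1) by (force simp: product_atlas_def)
  then have sm1: "smooth_on (\<phi> ` U \<times> J) ((\<lambda>(p, t). F t p) \<circ> inv_into (U \<times> J) ?\<Phi>)"
    using sm im unfolding smooth_map_def by fastforce
  have eq: "((\<lambda>(p, t). F t p) \<circ> inv_into (U \<times> J) ?\<Phi>) z = (case z of (y, t) \<Rightarrow> F t (inv_into U \<phi> y))"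
    if z: "z \<in> \<phi> ` U \<times> J" for z
  proof -
    obtain q t where q: "q \<in> U" "t \<in> J" "z = ?\<Phi> (q, t)" using z by auto
    have "inv_into (U \<times> J) ?\<Phi> z = (q, t)"
      unfolding q(3) by (rule inv_into_f_f[OF inj]) (use q in auto)
    then show ?thesis using q U(2) by simp
  qed
  show ?thesis by (rule smooth_on_cong[OF open_Times[OF U(3) J] eq sm1])
qed

lemma has_derivative_slice_fst:
  assumes "smooth_on (O' \<times> J) \<Sigma>" "y \<in> O'" "t \<in> J"
  shows "((\<lambda>y. \<Sigma> (y, t)) has_derivative (\<lambda>c. frechet_derivative \<Sigma> (at (y, t)) (c, 0))) (at y)"
proof -
  have d: "(\<Sigma> has_derivative frechet_derivative \<Sigma> (at (y, t))) (at (y, t))"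
    using assms by (intro smooth_on_has_derivative) auto
  have "((\<lambda>y. (y, t)) has_derivative (\<lambda>c. (c, 0))) (at y)"
    by (intro has_derivative_Pair has_derivative_ident has_derivative_const)
  from has_derivative_compose[OF this d] show ?thesis .
qed

lemma has_vector_derivative_slice_snd:
  fixes \<Sigma> :: "'a::real_normed_vector \<times> real \<Rightarrow> 'b::real_normed_vector"
  assumes "smooth_on (O' \<times> J) \<Sigma>" "y \<in> O'" "t \<in> J"
  shows "((\<lambda>t. \<Sigma> (y, t)) has_vector_derivative frechet_derivative \<Sigma> (at (y, t)) (0, 1)) (at t)"
proof -
  have d: "(\<Sigma> has_derivative frechet_derivative \<Sigma> (at (y, t))) (at (y, t))"
    using assms by (intro smooth_on_has_derivative) auto
  have "((\<lambda>t. (y, t)) has_derivative (\<lambda>h. (0, h))) (at t)"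
    by (intro has_derivative_Pair has_derivative_ident has_derivative_const)
  from has_derivative_compose[OF this d]
  have der: "((\<lambda>t. \<Sigma> (y, t)) has_derivative (\<lambda>h. frechet_derivative \<Sigma> (at (y, t)) (0, h))) (at t)" .
  have "frechet_derivative \<Sigma> (at (y, t)) (0, h) = h *\<^sub>R frechet_derivative \<Sigma> (at (y, t)) (0, 1)" for h
    using linear_scale[OF has_derivative_linear[OF d], of h "(0, 1)"] by simp
  then have eq: "(\<lambda>h. frechet_derivative \<Sigma> (at (y, t)) (0, h))
      = (\<lambda>h. h *\<^sub>R frechet_derivative \<Sigma> (at (y, t)) (0, 1))" by (rule ext)
  from der show ?thesis unfolding has_vector_derivative_def eq .
qed

lemma smooth_on_slice_fst:
  fixes \<Sigma> :: "'a::euclidean_space \<times> real \<Rightarrow> 'b::real_normed_vector"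
  assumes "smooth_on (O' \<times> J) \<Sigma>" "open O'" "open J" "t \<in> J"
  shows "smooth_on O' (\<lambda>y. \<Sigma> (y, t))"
proof -
  have "smooth_on O' (\<lambda>y. (y, t))"
    by (rule smooth_on_Pair[OF assms(2) smooth_on_linear[OF assms(2) bounded_linear_ident]
        smooth_on_const[OF assms(2)]])
  from smooth_on_compose[OF assms(2) open_Times[OF assms(2,3)] _ this assms(1)]
  show ?thesis using assms(4) by blast
qed

text \<open>A single chart at \<open>p\<close> serves all times, so that time derivatives at
  \<open>p\<close> can be exchanged with chart derivatives.\<close>

locale normal_evolution =
  fixes X :: "'m topology" and A :: "('m, real ^ 'n) atlas"
    and \<sigma> \<nu> :: "real \<Rightarrow> 'm \<Rightarrow> 'n::finite minkowski"
    and f :: "real \<Rightarrow> 'm \<Rightarrow> real" and J :: "real set" and \<delta> :: real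
    and U :: "'m set" and \<phi> :: "'m \<Rightarrow> real ^ 'n" and p :: 'm
  assumes \<delta>: "\<delta> \<in> {-1, 1}" and J: "open J"
    and joint_\<sigma>: "smooth_map (product_atlas A J) (\<lambda>(p, t). \<sigma> t p)"
    and joint_f: "smooth_map (product_atlas A J) (\<lambda>(p, t). f t p)"
    and hyp: "\<And>t. t \<in> J \<Longrightarrow> hypersurface_chart X A (\<sigma> t) (\<nu> t) \<delta> U \<phi> p"
    and evolution: "\<And>t p. t \<in> J \<Longrightarrow> p \<in> topspace X \<Longrightarrow>
      ((\<lambda>s. \<sigma> s p) has_vector_derivative f t p *\<^sub>R \<nu> t p) (at t)"
begin

definition \<Sigma> :: "(real ^ 'n) \<times> real \<Rightarrow> 'n minkowski" where
  "\<Sigma> = (\<lambda>(y, t). \<sigma> t (inv_into U \<phi> y))"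

text \<open>The coordinate differential of \<open>\<sigma> s\<close> at \<open>p\<close>. At each
  time it agrees with \<open>S\<close>, but as a partial derivative of the joint map it can be
  differentiated in \<open>s\<close>.\<close>

definition E :: "real \<Rightarrow> real ^ 'n \<Rightarrow> 'n minkowski" where
  "E s c = frechet_derivative \<Sigma> (at (\<phi> p, s)) (c, 0)"

context
  fixes t assumes t: "t \<in> J"
begin

interpretation hypersurface_chart X A "\<sigma> t" "\<nu> t" \<delta> U \<phi> p
  by (rule hyp[OF t])

lemma smooth_\<Sigma>: "smooth_on (\<phi> ` U \<times> J) \<Sigma>"
  unfolding \<Sigma>_def by (rule smooth_on_product_chart[OF joint_\<sigma> UA chart(4,2) J])

lemma E_eq: "E t = S"
proof -
  have "((\<lambda>y. \<Sigma> (y, t)) has_derivative E t) (at (\<phi> p))"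
    unfolding E_def by (rule has_derivative_slice_fst[OF smooth_\<Sigma> point_in_chart t])
  then show ?thesis
    using has_derivative_unique[OF derivative_\<sigma>] by (simp add: \<Sigma>_def comp_def)
qed

lemma f_smooth_at: "f t \<in> smooth_at A p"
proof -
  have "smooth_on (\<phi> ` U) (\<lambda>y. (\<lambda>(y, t). f t (inv_into U \<phi> y)) (y, t))"
    by (rule smooth_on_slice_fst[OF smooth_on_product_chart[OF joint_f UA chart(4,2) J] chart(2) J t])
  then show ?thesis
    by (intro smooth_atI[OF UA pU chart(2) point_in_chart]) (simp_all add: comp_def)
qed

lemma time_derivative_\<Sigma>:
  assumes "y \<in> \<phi> ` U" "s \<in> J"
  shows "frechet_derivative \<Sigma> (at (y, s)) (0, 1) = f s (inv_into U \<phi> y) *\<^sub>R \<nu> s (inv_into U \<phi> y)"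
  using has_vector_derivative_slice_snd[OF smooth_\<Sigma> assms] evolution[OF assms(2) inv_in[OF assms(1)]]
  unfolding \<Sigma>_def prod.case by (rule vector_derivative_unique_at)

text \<open>Mixed derivatives of the joint map commute, so this is the derivative of f \<nu> in the
  direction \<open>c\<close>. That derivative is taken at the fixed time \<open>t\<close>, at which
  \<nu> is smooth on the chart.\<close>

lemma has_vector_derivative_E:
  "((\<lambda>s. E s c) has_vector_derivative f t p *\<^sub>R N c + D c (f t) *\<^sub>R \<nu> t p) (at t)"
proof -
  have o: "open (\<phi> ` U \<times> J)" "(\<phi> p, t) \<in> \<phi> ` U \<times> J"
    using chart(2) J open_Times point_in_chart t by blast+
  define V where "V z = frechet_derivative \<Sigma> (at z) (0, 1)" for z
  have V: "smooth_on (\<phi> ` U \<times> J) V"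
    unfolding V_def by (rule smooth_on_derivative[OF smooth_\<Sigma>])
  have "((\<lambda>s. E s c) has_vector_derivative
      frechet_derivative (\<lambda>z. frechet_derivative \<Sigma> (at z) (c, 0)) (at (\<phi> p, t)) (0, 1)) (at t)"
    unfolding E_def
    by (rule has_vector_derivative_slice_snd[OF smooth_on_derivative[OF smooth_\<Sigma>] point_in_chart t])
  moreover have "frechet_derivative (\<lambda>z. frechet_derivative \<Sigma> (at z) (c, 0)) (at (\<phi> p, t)) (0, 1)
      = frechet_derivative V (at (\<phi> p, t)) (c, 0)"
    unfolding V_def by (rule symmetric_second_derivative[OF o smooth_\<Sigma>])
  moreover have "frechet_derivative V (at (\<phi> p, t)) (c, 0) = f t p *\<^sub>R N c + D c (f t) *\<^sub>R \<nu> t p"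
  proof -
    have 1: "((\<lambda>y. V (y, t)) has_derivative (\<lambda>c. frechet_derivative V (at (\<phi> p, t)) (c, 0))) (at (\<phi> p))"
      by (rule has_derivative_slice_fst[OF V point_in_chart t])
    have "((\<lambda>y. (f t \<circ> inv_into U \<phi>) y *\<^sub>R (\<nu> t \<circ> inv_into U \<phi>) y) has_derivative
        (\<lambda>c. (f t \<circ> inv_into U \<phi>) (\<phi> p) *\<^sub>R N c + D c (f t) *\<^sub>R (\<nu> t \<circ> inv_into U \<phi>) (\<phi> p))) (at (\<phi> p))"
      by (rule has_derivative_scaleR[OF smooth_at_has_derivative[OF M UA pU f_smooth_at] derivative_\<nu>])
    then have "((\<lambda>y. V (y, t)) has_derivative
        (\<lambda>c. (f t \<circ> inv_into U \<phi>) (\<phi> p) *\<^sub>R N c + D c (f t) *\<^sub>R (\<nu> t \<circ> inv_into U \<phi>) (\<phi> p))) (at (\<phi> p))"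
      by (rule has_derivative_transform_within_open[OF _ chart(2) point_in_chart])
         (simp add: V_def time_derivative_\<Sigma> t)
    from has_derivative_unique[OF 1 this] show ?thesis
      by (simp add: fun_eq_iff inv_chart pU)
  qed
  ultimately show ?thesis by simp
qed

lemma E_normal: "mink (E t c) (\<nu> t p) = 0"
  using S_in_orth[of c] by (simp add: E_eq orth_space_def mink_commute[of _ "\<nu> t p"])

lemma normal_eq_cofactor:
  defines "n \<equiv> cofactor_vector (\<sigma> t p) (\<lambda>i. E t (axis i 1))"
  shows "mink n n > 0" "\<nu> t p = (\<delta> / sqrt (mink n n)) *\<^sub>R n"
  unfolding n_def E_eq
  by (rule unit_normal_eq_cofactor[OF linear_S \<delta> det_frame base S_in_orth])+

lemma base_in: "(\<sigma> t p, \<nu> t p) \<in> unit_tangent" and p_in_topspace: "p \<in> topspace X"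
  by (rule base, rule p_in)

end

text \<open>In the cofactor formula time enters only through \<sigma> and \<open>E\<close>, both
  differentiable at \<open>t\<close>; positivity of \<open>mink (n t) (n t)\<close> allows the
  square root and the quotient to be differentiated.\<close>

lemma normal_differentiable:
  assumes t: "t \<in> J"
  obtains P where "((\<lambda>s. \<nu> s p) has_vector_derivative P) (at t)"
proof -
  define n where "n s = cofactor_vector (\<sigma> s p) (\<lambda>i. E s (axis i 1))" for s
  have "(\<lambda>s. \<sigma> s p) differentiable at t" "(\<lambda>s. E s c) differentiable at t" for c
    using evolution[OF t p_in_topspace[OF t]] has_vector_derivative_E[OF t, of c]
    unfolding has_vector_derivative_def differentiable_def by blast+
  then have "n differentiable at t"
    unfolding n_def by (rule differentiable_cofactor_vector)
  then obtain n' where n': "(n has_vector_derivative n') (at t)"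
    using vector_derivative_works by blast
  have pos: "mink (n t) (n t) > 0"
    unfolding n_def by (rule normal_eq_cofactor(1)[OF t])
  have "((\<lambda>s. mink (n s) (n s)) has_real_derivative mink (n t) n' + mink n' (n t)) (at t)"
    using mink.has_vector_derivative[OF n' n'] by (simp add: has_real_derivative_iff_has_vector_derivative)
  from DERIV_real_sqrt[THEN DERIV_chain2, OF pos this]
  have "\<exists>r. ((\<lambda>s. sqrt (mink (n s) (n s))) has_real_derivative r) (at t)" by blast
  then obtain r where "((\<lambda>s. sqrt (mink (n s) (n s))) has_real_derivative r) (at t)" by blast
  from DERIV_divide[OF DERIV_const this]
  obtain r' where "((\<lambda>s. \<delta> / sqrt (mink (n s) (n s))) has_real_derivative r') (at t)"
    using pos by fastforce
  from has_vector_derivative_scaleR[OF this n'] obtain P where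
    P: "((\<lambda>s. (\<delta> / sqrt (mink (n s) (n s))) *\<^sub>R n s) has_vector_derivative P) (at t)" by blast
  have "((\<lambda>s. \<nu> s p) has_vector_derivative P) (at t)"
    by (rule has_vector_derivative_transform_within_open[OF P J t])
       (simp add: n_def normal_eq_cofactor(2))
  then show thesis by (rule that)
qed

lemma evolution_of_lift:
  assumes t: "t \<in> J"
  defines "grad \<equiv> gauss_gradient A (\<sigma> t) (\<nu> t) (f t) p"
    and "B' \<equiv> shape_operator A (\<sigma> t) (\<nu> t) p"
    and "d\<zeta> \<equiv> differential (lift (\<sigma> t) (\<nu> t))" and "\<zeta> \<equiv> \<lambda>s. lift (\<sigma> s) (\<nu> s) p"
    and "dG \<equiv> dgauss (\<sigma> t) (\<nu> t) p"
  shows "(\<zeta> has_vector_derivative - d\<zeta> (B' grad) - para_J (\<zeta> t) (d\<zeta> grad) + f t p *\<^sub>R chi (\<zeta> t)) (at t)"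
    and "has_velocity geod_smooth_at (\<lambda>s. geod (\<zeta> s))
      (\<lambda>h. - dG (B' grad) h - geod_J (geod (\<zeta> t)) (dG grad) h) t"
proof -
  interpret hypersurface_chart X A "\<sigma> t" "\<nu> t" \<delta> U \<phi> p
    by (rule hyp[OF t])
  note a = base and m = unit_tangentD[OF base]
  obtain g where g: "grad = D g" "\<And>d. I g d = D d (f t)"
    unfolding grad_def by (rule gauss_gradient_eq) blast
  obtain P where P: "((\<lambda>s. \<nu> s p) has_vector_derivative P) (at t)"
    using normal_differentiable[OF t] .
  have \<sigma>': "((\<lambda>s. \<sigma> s p) has_vector_derivative f t p *\<^sub>R \<nu> t p) (at t)"
    by (rule evolution[OF t p_in])
  have "mink (\<nu> t p) P + mink P (\<nu> t p) = 0"
    by (rule mink_const_vector_derivative[OF P P J t]) (rule unit_tangentD(5)[OF base_in])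
  then have 1: "mink P (\<nu> t p) = 0" by (simp add: mink_commute[of "\<nu> t p"])
  have "mink (\<sigma> t p) P + mink (f t p *\<^sub>R \<nu> t p) (\<nu> t p) = 0"
    by (rule mink_const_vector_derivative[OF \<sigma>' P J t]) (rule unit_tangentD(3)[OF base_in])
  then have 2: "mink P (\<sigma> t p) = - f t p"
    by (simp add: mink_commute[of "\<sigma> t p"] mink_simps m)
  \<comment> \<open>Differentiating <d\<sigma>(d), \<nu>> = 0 leaves <d\<sigma>(d), P> + df(d) = 0,
    because \<open>N d\<close> is orthogonal to \<nu>; by the choice of \<open>g\<close>, df(d) is
    \<open>I g d\<close>.\<close>
  have 3: "mink P (S d) = - I g d" for d
  proof -
    have "mink (E t d) P + mink (f t p *\<^sub>R N d + D d (f t) *\<^sub>R \<nu> t p) (\<nu> t p) = 0"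
      by (rule mink_const_vector_derivative[OF has_vector_derivative_E[OF t] P J t]) (rule E_normal)
    moreover have "mink (N d) (\<nu> t p) = 0"
      using N_in_orth[of d] by (simp add: orth_space_def mink_commute[of "N d"])
    ultimately show ?thesis
      by (simp add: E_eq[OF t] g(2) mink_simps m mink_commute[of P])
  qed
  have P_eq: "P = S (B (B g)) - S g + f t p *\<^sub>R \<sigma> t p"
    by (rule normal_velocity[OF 1 2 3])
  define a where "a = (\<sigma> t p, \<nu> t p)"
  define \<xi>\<^sub>1 \<xi>\<^sub>2 where "\<xi>\<^sub>1 = (S (B g), N (B g))" and "\<xi>\<^sub>2 = (N g, S g)"
  have \<zeta>: "\<zeta> t = a" "\<zeta> = (\<lambda>s. (\<sigma> s p, \<nu> s p))" by (simp_all add: \<zeta>_def lift_def a_def)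
  have J_g: "para_J a (S g, N g) = \<xi>\<^sub>2"
    unfolding a_def \<xi>\<^sub>2_def by (rule para_J_chi_perp[OF base S_in_orth N_in_orth])
  have \<xi>: "d\<zeta> (B' grad) = \<xi>\<^sub>1" "para_J a (d\<zeta> grad) = \<xi>\<^sub>2"
    by (simp_all add: d\<zeta>_def B'_def g(1) shape_operator_eq differential_lift \<xi>\<^sub>1_def J_g)
  define \<xi> where "\<xi> = - \<xi>\<^sub>1 - \<xi>\<^sub>2 + f t p *\<^sub>R chi a"
  \<comment> \<open>By \<open>S_B\<close> the first entries of \<open>\<xi>\<^sub>1\<close> and
    \<open>\<xi>\<^sub>2\<close> cancel, and the second ones give the tangential part of
    \<open>P\<close>.\<close>
  have "\<xi> = (f t p *\<^sub>R \<nu> t p, P)"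
    by (simp add: \<xi>_def \<xi>\<^sub>1_def \<xi>\<^sub>2_def a_def chi_def P_eq S_B)
  then have der: "(\<zeta> has_vector_derivative \<xi>) (at t)"
    unfolding \<zeta>(2) using has_vector_derivative_prod[OF \<sigma>' P] by simp
  then show "(\<zeta> has_vector_derivative - d\<zeta> (B' grad) - para_J (\<zeta> t) (d\<zeta> grad) + f t p *\<^sub>R chi (\<zeta> t)) (at t)"
    by (simp add: \<xi> \<zeta>(1) \<xi>_def)
  have aT: "a \<in> unit_tangent" unfolding a_def by (rule base)
  have "\<xi>\<^sub>1 \<in> chi_perp a" "\<xi>\<^sub>2 \<in> chi_perp a"
    unfolding a_def \<xi>\<^sub>1_def \<xi>\<^sub>2_def chi_perp_eq[OF base] using S_in_orth N_in_orth by auto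
  then have T: "\<xi>\<^sub>1 \<in> unit_tangent_tangent a" "\<xi>\<^sub>2 \<in> unit_tangent_tangent a"
    by (simp_all add: chi_perp_tangent)
  have T': "(-1) *\<^sub>R \<xi>\<^sub>1 + (-1) *\<^sub>R \<xi>\<^sub>2 \<in> unit_tangent_tangent a"
    by (rule unit_tangent_tangent_linear[OF T])
  have \<xi>_eq: "\<xi> = 1 *\<^sub>R ((-1) *\<^sub>R \<xi>\<^sub>1 + (-1) *\<^sub>R \<xi>\<^sub>2) + f t p *\<^sub>R chi a"
    by (simp add: \<xi>_def)
  have "\<xi> \<in> unit_tangent_tangent a"
    unfolding \<xi>_eq by (rule unit_tangent_tangent_linear[OF T' chi_tangent])
  then have "\<xi> \<in> unit_tangent_tangent (\<zeta> t)" by (simp only: \<zeta>(1))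
  then have "has_velocity geod_smooth_at (\<lambda>s. geod (\<zeta> s)) (dgeod (\<zeta> t) \<xi>) t"
    by (rule has_velocity_geod[OF der J t, rotated]) (simp add: \<zeta>(2) base_in)
  moreover have "dgeod (\<zeta> t) \<xi> = (\<lambda>h. - dG (B' grad) h - geod_J (geod (\<zeta> t)) (dG grad) h)"
  proof
    fix h
    \<comment> \<open>The multiple of \<open>chi a\<close> disappears here, since the projection
      collapses flow lines.\<close>
    have "dgeod a \<xi> h = - dgeod a \<xi>\<^sub>1 h - dgeod a \<xi>\<^sub>2 h"
      unfolding \<xi>_eq dgeod_linear[OF aT T' chi_tangent] dgeod_linear[OF aT T]
      by (simp add: dgeod_chi[OF aT])
    moreover have "dG (B' grad) = dgeod a \<xi>\<^sub>1"
      by (simp add: dG_def B'_def g(1) shape_operator_eq dgauss_eq \<xi>\<^sub>1_def a_def)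
    moreover have "geod_J (geod a) (dG grad) = dgeod a \<xi>\<^sub>2"
      using geod_J_eq[OF aT, of "(S g, N g)"] lift_chi_perp[of g]
      by (simp add: dG_def g(1) dgauss_eq J_g a_def[symmetric])
    ultimately show "dgeod (\<zeta> t) \<xi> h = - dG (B' grad) h - geod_J (geod (\<zeta> t)) (dG grad) h"
      by (simp add: \<zeta>(1))
  qed
  ultimately show "has_velocity geod_smooth_at (\<lambda>s. geod (\<zeta> s))
      (\<lambda>h. - dG (B' grad) h - geod_J (geod (\<zeta> t)) (dG grad) h) t" by simp
qed

end

theorem propositionA1:
  fixes X :: "'m topology" and A :: "('m, real ^ 'n) atlas"
    and \<sigma> \<nu> :: "real \<Rightarrow> 'm \<Rightarrow> 'n::finite minkowski"
    and f :: "real \<Rightarrow> 'm \<Rightarrow> real"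
    and \<epsilon> \<delta> :: real
  assumes "oriented_manifold X A" and "\<epsilon> > 0" and "\<delta> \<in> {-1, 1}"
    and "smooth_map (product_atlas A {-\<epsilon><..<\<epsilon>}) (\<lambda>(p, t). \<sigma> t p)"
    and "smooth_map (product_atlas A {-\<epsilon><..<\<epsilon>}) (\<lambda>(p, t). f t p)"
    and "\<And>t. t \<in> {-\<epsilon><..<\<epsilon>} \<Longrightarrow> immersion X A (\<sigma> t)"
    and "\<And>t. t \<in> {-\<epsilon><..<\<epsilon>} \<Longrightarrow> unit_normal_field X A \<delta> (\<sigma> t) (\<nu> t)"
    and "\<And>t. t \<in> {-\<epsilon><..<\<epsilon>} \<Longrightarrow> small_principal_curvatures X A (\<sigma> t) (\<nu> t)"
    and "\<And>t p. t \<in> {-\<epsilon><..<\<epsilon>} \<Longrightarrow> p \<in> topspace X \<Longrightarrow>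
      ((\<lambda>s. \<sigma> s p) has_vector_derivative f t p *\<^sub>R \<nu> t p) (at t)"
  shows "\<forall>t\<in>{-\<epsilon><..<\<epsilon>}. \<forall>p\<in>topspace X.
      (let B = shape_operator A (\<sigma> t) (\<nu> t) p;
           grad = gauss_gradient A (\<sigma> t) (\<nu> t) (f t) p;
           \<zeta> = (\<lambda>s. lift (\<sigma> s) (\<nu> s));
           d\<zeta> = differential (\<zeta> t);
           G = (\<lambda>s. gauss_map (\<sigma> s) (\<nu> s));
           dG = dgauss (\<sigma> t) (\<nu> t) p
       in ((\<lambda>s. \<zeta> s p) has_vector_derivative
             (- d\<zeta> (B grad) - para_J (\<zeta> t p) (d\<zeta> grad) + f t p *\<^sub>R chi (\<zeta> t p))) (at t) \<and>
          has_velocity geod_smooth_at (\<lambda>s. G s p)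
             (\<lambda>h. - dG (B grad) h - geod_J (G t p) (dG grad) h) t)"
proof (intro ballI)
  fix t p assume t: "t \<in> {-\<epsilon><..<\<epsilon>}" and p: "p \<in> topspace X"
  have M: "smooth_manifold X A" using assms(1) by (simp add: oriented_manifold_def)
  obtain U \<phi> where U: "(U, \<phi>) \<in> A" "p \<in> U" using smooth_manifold_chart_exists[OF M p] .
  have "normal_evolution X A \<sigma> \<nu> f {-\<epsilon><..<\<epsilon>} \<delta> U \<phi> p"
    by (intro normal_evolution.intro hypersurface_chart.intro M U assms(3-9) open_greaterThanLessThan)
  from normal_evolution.evolution_of_lift[OF this t]
  show "let B = shape_operator A (\<sigma> t) (\<nu> t) p;
           grad = gauss_gradient A (\<sigma> t) (\<nu> t) (f t) p;
           \<zeta> = (\<lambda>s. lift (\<sigma> s) (\<nu> s));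
           d\<zeta> = differential (\<zeta> t);
           G = (\<lambda>s. gauss_map (\<sigma> s) (\<nu> s));
           dG = dgauss (\<sigma> t) (\<nu> t) p
       in ((\<lambda>s. \<zeta> s p) has_vector_derivative
             (- d\<zeta> (B grad) - para_J (\<zeta> t p) (d\<zeta> grad) + f t p *\<^sub>R chi (\<zeta> t p))) (at t) \<and>
          has_velocity geod_smooth_at (\<lambda>s. G s p)
             (\<lambda>h. - dG (B grad) h - geod_J (G t p) (dG grad) h) t"
    unfolding Let_def gauss_map_def comp_def by (rule conjI)
qed

end
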